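(* For any $t\in[0,T]$, $$n^{2H-1}J_n(t)\ \longrightarrow\ \int_0^t\big(\sigma^{1,1}_s\sigma^{2,1}_s+\sigma^{1,2}_s\sigma^{2,2}_s\big)\,ds\qquad\text{in probability as } n\to\infty,$$ where $J_n(t)=\sum_{k=1}^{\lfloor nt\rfloor}\Delta X^{(1)}_{k/n}\,\Delta X^{(2)}_{k/n}$ is the cross-variation of the process $X=(X^{(1)},X^{(2)})$ given by $$X^{(i)}_t=x_i+\int_0^t\sigma^{i,1}_s\,dB^{(1)}_s+\int_0^t\sigma^{i,2}_s\,dB^{(2)}_s,\qquad t\in[0,T],\ i=1,2.$$
   Context: Fix $T>0$ and $H\in(\tfrac12,1)$. Let $B=(B^{(1)},B^{(2)})$ be a two-dimensional fractional Brownian motion of Hurst index $H$ on $[0,T]$ (two independent one-dimensional fractional Brownian motions, each of Hurst index $H$), defined on a complete probability space $(\Omega,\mathcal{F},P)$, where $\mathcal{F}$ is the (completed) $\sigma$-field generated by $B$. Let $x=(x_1,x_2)\in\mathbb{R}^2$. For $\alpha\in(0,1)$ and $f:[0,T]\to\mathbb{R}$, put $|f|_\alpha=\sup_{0\le s<t\le T}\frac{|f(t)-f(s)|}{(t-s)^\alpha}$, $|f|_\infty=\sup_{0\le t\le T}|f(t)|$ and $\|f\|_\alpha=|f|_\alpha+|f|_\infty$; $C^\alpha$ is the set of $f$ with $|f|_\alpha<\infty$. Standing assumptions: $\sigma^{i,j}:\Omega\times[0,T]\to\mathbb{R}$, $i,j=1,2$, are four stochastic processes measurable with respect to $\mathcal{F}$,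 and $\alpha$ is a fixed number such that (A) $\alpha\in\big(\tfrac14+\tfrac H2,\,H\big)$; (B) for each $(i,j)\in\{1,2\}^2$, the random variable $\|\sigma^{i,j}\|_\alpha$ has moments of all orders. No adaptedness is assumed. The integrals $\int_0^t\sigma^{i,j}_s\,dB^{(j)}_s$ are pathwise Young integrals: for $f\in C^\alpha$, $g\in C^\gamma$ with $\alpha+\gamma>1$, $\int_0^\cdot f\,dg$ is $T_f(g)$, where $T_f:C^\gamma\to C^\gamma$ is the unique extension of the operator $T_f(g)(t)=\int_0^t f(u)g'(u)\,du$ defined for $g\in C^1$. (The paths of $B^{(j)}$ are a.s. $\gamma$-Hölder for every $\gamma<H$, and $\alpha+H>1$.) Notation: $\Delta X^{(i)}_{k/n}=X^{(i)}_{k/n}-X^{(i)}_{(k-1)/n}$. *)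

theory Defs
  imports "HOL-Probability.Probability"
begin

subsection \<open>Hoelder spaces on \<open>[0,T]\<close>\<close>

text \<open>Functions on \<open>[0,T]\<close> are represented by functions on the reals of which only the values on
  \<open>[0,T]\<close> are ever inspected. The seminorms take values in \<open>[0,\<infinity>]\<close>.\<close>

definition holder_seminorm :: "real \<Rightarrow> real \<Rightarrow> (real \<Rightarrow> real) \<Rightarrow> ennreal" where
  "holder_seminorm T \<alpha> f =
     (SUP (s, t) \<in> {(s, t). 0 \<le> s \<and> s < t \<and> t \<le> T}. ennreal (\<bar>f t - f s\<bar> / (t - s) powr \<alpha>))"

definition sup_seminorm :: "real \<Rightarrow> (real \<Rightarrow> real) \<Rightarrow> ennreal" where
  "sup_seminorm T f = (SUP t \<in> {0..T}. ennreal \<bar>f t\<bar>)"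

definition holder_norm :: "real \<Rightarrow> real \<Rightarrow> (real \<Rightarrow> real) \<Rightarrow> ennreal" where
  "holder_norm T \<alpha> f = holder_seminorm T \<alpha> f + sup_seminorm T f"

definition holder_space :: "real \<Rightarrow> real \<Rightarrow> (real \<Rightarrow> real) set" where
  "holder_space T \<alpha> = {f. holder_seminorm T \<alpha> f < \<infinity>}"


subsection \<open>The Young integral\<close>

definition has_C1_derivative_on ::
    "real \<Rightarrow> (real \<Rightarrow> real) \<Rightarrow> (real \<Rightarrow> real) \<Rightarrow> bool" where
  "has_C1_derivative_on T g g' \<longleftrightarrow>
     continuous_on {0..T} g' \<and>
     (\<forall>t\<in>{0..T}. (g has_real_derivative g' t) (at t within {0..T}))"

text \<open>\<open>L\<close> restricts to a continuous linear operator on \<open>C\<^sup>\<gamma>\<close>; as functions are only considered on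
  \<open>[0,T]\<close>, linearity is required there.\<close>

definition bounded_linear_holder ::
    "real \<Rightarrow> real \<Rightarrow> ((real \<Rightarrow> real) \<Rightarrow> real \<Rightarrow> real) \<Rightarrow> bool" where
  "bounded_linear_holder T \<gamma> L \<longleftrightarrow>
     (\<forall>g\<in>holder_space T \<gamma>. L g \<in> holder_space T \<gamma>) \<and>
     (\<forall>g\<in>holder_space T \<gamma>. \<forall>h\<in>holder_space T \<gamma>. \<forall>a b. \<forall>t\<in>{0..T}.
        L (\<lambda>u. a * g u + b * h u) t = a * L g t + b * L h t) \<and>
     (\<exists>K::real. \<forall>g\<in>holder_space T \<gamma>. holder_norm T \<gamma> (L g) \<le> ennreal K * holder_norm T \<gamma> g)"

text \<open>The extension of \<open>T\<^sub>f(g)(t) = \<integral>\<^sub>0\<^sup>t f(u) g'(u) du\<close> from \<open>C\<^sup>1\<close> to the spaces \<open>C\<^sup>\<gamma>\<close>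
  with \<open>\<alpha> + \<gamma> > 1\<close>, where \<open>f\<close> is in \<open>C\<^sup>\<alpha>\<close>. Since \<open>C\<^sup>1\<close> is not dense in \<open>C\<^sup>\<gamma>\<close>, a continuous extension
  on a single \<open>C\<^sup>\<gamma>\<close> would not be unique. Here one operator acts continuously on all of these spaces
  at once, and it is unique because \<open>C\<^sup>\<gamma>\<close> is contained in the closure of \<open>C\<^sup>1\<close> in
  \<open>C\<^bsup>\<gamma>'\<^esup>\<close> for \<open>\<gamma>' < \<gamma>\<close>.\<close>

definition young_extension ::
    "real \<Rightarrow> real \<Rightarrow> (real \<Rightarrow> real) \<Rightarrow> ((real \<Rightarrow> real) \<Rightarrow> real \<Rightarrow> real) \<Rightarrow> bool" where
  "young_extension T \<alpha> f L \<longleftrightarrow>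
     (\<forall>\<gamma>. 0 < \<gamma> \<and> \<gamma> < 1 \<and> \<alpha> + \<gamma> > 1 \<longrightarrow> bounded_linear_holder T \<gamma> L) \<and>
     (\<forall>g g'. has_C1_derivative_on T g g' \<longrightarrow>
        (\<forall>t\<in>{0..T}. L g t = integral {0..t} (\<lambda>u. f u * g' u)))"

text \<open>Meaningful for \<open>f\<close> in \<open>C\<^sup>\<alpha>\<close>, \<open>g\<close> in some \<open>C\<^sup>\<gamma>\<close> with \<open>\<alpha> + \<gamma> > 1\<close>, and \<open>t\<close> in \<open>[0,T]\<close>.\<close>

definition young_integral ::
    "real \<Rightarrow> real \<Rightarrow> (real \<Rightarrow> real) \<Rightarrow> (real \<Rightarrow> real) \<Rightarrow> real \<Rightarrow> real" where
  "young_integral T \<alpha> f g t = (THE y. \<exists>L. young_extension T \<alpha> f L \<and> L g t = y)"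


subsection \<open>Fractional Brownian motion\<close>

text \<open>Normal law, allowing the degenerate case of zero variance.\<close>

definition gaussian_rv :: "'a measure \<Rightarrow> ('a \<Rightarrow> real) \<Rightarrow> bool" where
  "gaussian_rv M X \<longleftrightarrow> X \<in> borel_measurable M \<and>
     ((\<exists>\<mu>. AE \<omega> in M. X \<omega> = \<mu>) \<or>
      (\<exists>\<mu> s. 0 < s \<and> distributed M lborel X (\<lambda>y. ennreal (normal_density \<mu> s y))))"

definition gaussian_process :: "'a measure \<Rightarrow> 'i set \<Rightarrow> ('i \<Rightarrow> 'a \<Rightarrow> real) \<Rightarrow> bool" where
  "gaussian_process M I X \<longleftrightarrow>
     (\<forall>J c. finite J \<and> J \<subseteq> I \<longrightarrow> gaussian_rv M (\<lambda>\<omega>. \<Sum>t\<in>J. c t * X t \<omega>))"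

definition fractional_brownian_motion ::
    "'a measure \<Rightarrow> real \<Rightarrow> real \<Rightarrow> (real \<Rightarrow> 'a \<Rightarrow> real) \<Rightarrow> bool" where
  "fractional_brownian_motion M T H B \<longleftrightarrow>
     gaussian_process M {0..T} B \<and>
     (\<forall>t\<in>{0..T}. (\<integral>\<omega>. B t \<omega> \<partial>M) = 0) \<and>
     (\<forall>s\<in>{0..T}. \<forall>t\<in>{0..T}. (\<integral>\<omega>. B s \<omega> * B t \<omega> \<partial>M) =
        (s powr (2 * H) + t powr (2 * H) - \<bar>t - s\<bar> powr (2 * H)) / 2) \<and>
     (AE \<omega> in M. continuous_on {0..T} (\<lambda>t. B t \<omega>))"

text \<open>Components are indexed by the two-element type \<open>2\<close>, with elements \<open>1\<close> and \<open>2\<close>. Independence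
  is that of the whole paths, as random elements of the product space over \<open>[0,T]\<close>.\<close>

definition fractional_brownian_motion_2d ::
    "'a measure \<Rightarrow> real \<Rightarrow> real \<Rightarrow> (2 \<Rightarrow> real \<Rightarrow> 'a \<Rightarrow> real) \<Rightarrow> bool" where
  "fractional_brownian_motion_2d M T H B \<longleftrightarrow>
     (\<forall>j. fractional_brownian_motion M T H (B j)) \<and>
     prob_space.indep_vars M (\<lambda>j. Pi\<^sub>M {0..T} (\<lambda>t. borel))
       (\<lambda>j \<omega>. \<lambda>t\<in>{0..T}. B j t \<omega>) UNIV"

definition generated_sigma_field ::
    "'a measure \<Rightarrow> real \<Rightarrow> (2 \<Rightarrow> real \<Rightarrow> 'a \<Rightarrow> real) \<Rightarrow> 'a measure" where
  "generated_sigma_field M T B =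
     sigma (space M) {B j t -` A \<inter> space M | j t A. t \<in> {0..T} \<and> A \<in> sets borel}"

text \<open>The measurable sets of \<open>M\<close> are exactly those of the completion, under the probability measure
  of \<open>M\<close>, of the sigma-field generated by \<open>B\<close>; in particular \<open>M\<close> is complete.\<close>

definition completed_generated_by ::
    "'a measure \<Rightarrow> real \<Rightarrow> (2 \<Rightarrow> real \<Rightarrow> 'a \<Rightarrow> real) \<Rightarrow> bool" where
  "completed_generated_by M T B \<longleftrightarrow>
     subalgebra M (generated_sigma_field M T B) \<and>
     M = completion (restr_to_subalg M (generated_sigma_field M T B))"


subsection \<open>Moments, convergence in probability, and the process \<open>X\<close>\<close>

definition has_moments_of_all_orders :: "'a measure \<Rightarrow> ('a \<Rightarrow> ennreal) \<Rightarrow> bool" where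
  "has_moments_of_all_orders M Z \<longleftrightarrow>
     Z \<in> borel_measurable M \<and> (\<forall>p::nat. (\<integral>\<^sup>+ \<omega>. Z \<omega> ^ p \<partial>M) < \<infinity>)"

definition converges_in_probability ::
    "'a measure \<Rightarrow> (nat \<Rightarrow> 'a \<Rightarrow> real) \<Rightarrow> ('a \<Rightarrow> real) \<Rightarrow> bool" where
  "converges_in_probability M Y Z \<longleftrightarrow>
     (\<forall>n. Y n \<in> borel_measurable M) \<and> Z \<in> borel_measurable M \<and>
     (\<forall>\<epsilon>>0. (\<lambda>n. measure M {\<omega> \<in> space M. \<bar>Y n \<omega> - Z \<omega>\<bar> > \<epsilon>}) \<longlonglongrightarrow> 0)"

definition young_process ::
    "real \<Rightarrow> real \<Rightarrow> real ^ 2 \<Rightarrow> (2 \<Rightarrow> 2 \<Rightarrow> real \<Rightarrow> 'a \<Rightarrow> real) \<Rightarrow>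
     (2 \<Rightarrow> real \<Rightarrow> 'a \<Rightarrow> real) \<Rightarrow> 2 \<Rightarrow> real \<Rightarrow> 'a \<Rightarrow> real" where
  "young_process T \<alpha> x \<sigma> B i t \<omega> =
     x $ i + young_integral T \<alpha> (\<lambda>s. \<sigma> i 1 s \<omega>) (\<lambda>s. B 1 s \<omega>) t
           + young_integral T \<alpha> (\<lambda>s. \<sigma> i 2 s \<omega>) (\<lambda>s. B 2 s \<omega>) t"

definition cross_variation ::
    "(2 \<Rightarrow> real \<Rightarrow> 'a \<Rightarrow> real) \<Rightarrow> nat \<Rightarrow> real \<Rightarrow> 'a \<Rightarrow> real" where
  "cross_variation X n t \<omega> =
     (\<Sum>k = 1..nat \<lfloor>real n * t\<rfloor>.
        (X 1 (real k / real n) \<omega> - X 1 (real (k - 1) / real n) \<omega>) *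
        (X 2 (real k / real n) \<omega> - X 2 (real (k - 1) / real n) \<omega>))"

end

theory Submission
  imports Defs
begin

text \<open>
  The proof has a pathwise part and a probabilistic part, joined by the following observation:
  it is enough to bound \<open>\<bar>n\<^bsup>2H-1\<^esup> J\<^sub>n(t) - \<integral>\<dots>\<bar>\<close> by \<open>C(\<omega>) Q\<^sub>n(\<omega>)\<close> with \<open>C\<close> almost surely finite
  and \<open>Q\<^sub>n \<rightarrow> 0\<close> in \<open>L\<^sup>1\<close> (\<open>converges_in_probability_if_dominated\<close>). All the influence of the
  integrands goes into \<open>C(\<omega>)\<close>, so that their dependence on the whole path of \<open>B\<close> is harmless,
  and \<open>Q\<^sub>n\<close> involves the two fractional Brownian motions only.

  \<^bold>\<open>Freezing the integrands.\<close> The Young integral satisfies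
  \<open>\<bar>\<integral>\<^sub>s\<^sup>t f dg - f(s) (g(t) - g(s))\<bar> \<le> c (t - s)\<^bsup>\<alpha>+\<gamma>\<^esup>\<close> (\<open>young_integral_increment\<close>), and the paths of \<open>B\<close> are
  \<open>\<gamma>\<close>-Hoelder for every \<open>\<gamma> < H\<close> (\<open>holder_paths\<close>). Hence the increment of \<open>X\<^bsup>(i)\<^esup>\<close> over a cell of length
  \<open>h = 1/n\<close> is \<open>\<Sum>\<^sub>j \<sigma>\<^bsup>i,j\<^esup> \<Delta>B\<^bsup>(j)\<^esup>\<close> with \<open>\<sigma>\<close> taken at the left end point, up to \<open>O(h\<^bsup>\<alpha>+\<gamma>\<^esup>)\<close>. As the increments
  themselves are \<open>O(h\<^bsup>\<gamma>\<^esup>)\<close>, replacing \<open>X\<close> by these sums changes \<open>n\<^bsup>2H-1\<^esup> J\<^sub>n(t)\<close> by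
  \<open>O(h\<^bsup>1-2H\<^esup> \<cdot> h\<^sup>-\<^sup>1 \<cdot> h\<^bsup>\<alpha>+2\<gamma>\<^esup>) = O(h\<^bsup>\<alpha>+2\<gamma>-2H\<^esup>)\<close>, which vanishes once \<open>\<gamma>\<close> is close enough to \<open>H\<close>.

  \<^bold>\<open>Centring.\<close> What remains are the sums of \<open>a(kh) \<Delta>B\<^bsup>(j)\<^esup> \<Delta>B\<^bsup>(l)\<^esup>\<close> with \<open>a = \<sigma>\<^bsup>1,j\<^esup> \<sigma>\<^bsup>2,l\<^esup>\<close>. The mean of
  \<open>\<Delta>B\<^bsup>(j)\<^esup> \<Delta>B\<^bsup>(l)\<^esup>\<close> is \<open>h\<^bsup>2H\<^esup>\<close> if \<open>j = l\<close> and \<open>0\<close> otherwise, so the means produce a Riemann sum of the limit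
  integral and leave the centred products, called fluctuations below.

  \<^bold>\<open>Fluctuations.\<close> Let \<open>c(k,m)\<close> be the covariance of the increments of one component over the cells
  \<open>k\<close> and \<open>m\<close>. By the Gaussian fourth moment formula, or by independence, the covariance of two
  fluctuations is at most \<open>2 c(k,m)\<^sup>2\<close>. For \<open>H > 1/2\<close> one has \<open>0 \<le> c(k,m) \<le> h\<^bsup>2H\<^esup>\<close>, therefore
  \<open>\<Sum> c(k,m)\<^sup>2 \<le> h\<^bsup>2H\<^esup> \<Sum> c(k,m)\<close>, and over a block of \<open>b\<close> consecutive cells the last sum is the variance
  \<open>(b h)\<^bsup>2H\<^esup>\<close> of a single increment. Thus a block of fluctuations has \<open>L\<^sup>1\<close> norm of order \<open>h\<^bsup>2H\<^esup> b\<^bsup>H\<^esup>\<close>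
  (\<open>fluctuation_block\<close>), much less than the order \<open>h\<^bsup>2H\<^esup> b\<close> of the sum of the absolute values. With
  \<open>b\<close> about \<open>\<surd>n\<close>, the weight \<open>a\<close> is nearly constant on each block because it is Hoelder, and the
  blocks, about \<open>t/(b h)\<close> in number, contribute \<open>O(b\<^bsup>H-1\<^esup>)\<close> in total.\<close>

section \<open>Hoelder functions\<close>

text \<open>The seminorms of the definitions are \<open>ennreal\<close>-valued suprema. This real-valued form, with the constant as
  a parameter, is the one in which estimates are computed.\<close>

definition holder_with :: "real \<Rightarrow> real \<Rightarrow> real \<Rightarrow> (real \<Rightarrow> real) \<Rightarrow> bool" where
  "holder_with T \<alpha> C f \<longleftrightarrow>
     (\<forall>s t. 0 \<le> s \<and> s \<le> t \<and> t \<le> T \<longrightarrow> \<bar>f t - f s\<bar> \<le> C * (t - s) powr \<alpha>)"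

lemma holder_withD:
  "holder_with T \<alpha> C f \<Longrightarrow> 0 \<le> s \<Longrightarrow> s \<le> t \<Longrightarrow> t \<le> T \<Longrightarrow> \<bar>f t - f s\<bar> \<le> C * (t - s) powr \<alpha>"
  unfolding holder_with_def by blast

lemma holder_withD_abs:
  assumes "holder_with T \<alpha> C f" "s \<in> {0..T}" "t \<in> {0..T}"
  shows "\<bar>f t - f s\<bar> \<le> C * \<bar>t - s\<bar> powr \<alpha>"
proof (cases "s \<le> t")
  case True
  then show ?thesis using holder_withD[OF assms(1), of s t] assms by auto
next
  case False
  then show ?thesis using holder_withD[OF assms(1), of t s] assms
    by (auto simp: abs_minus_commute)
qed

lemma holder_with_mono:
  assumes "holder_with T \<alpha> C f" "C \<le> D"
  shows "holder_with T \<alpha> D f"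
  unfolding holder_with_def
  by (meson assms holder_withD mult_right_mono order_trans powr_ge_zero)

lemma holder_with_lower_exponent:
  assumes f: "holder_with T \<alpha> C f" and "0 \<le> C" "0 < \<beta>" "\<beta> \<le> \<alpha>"
  shows "holder_with T \<beta> (C * T powr (\<alpha> - \<beta>)) f"
  unfolding holder_with_def
proof (intro allI impI)
  fix s t assume st: "0 \<le> s \<and> s \<le> t \<and> t \<le> T"
  have "\<bar>f t - f s\<bar> \<le> C * (t - s) powr \<alpha>" using holder_withD[OF f] st by auto
  also have "(t - s) powr \<alpha> = (t - s) powr (\<alpha> - \<beta>) * (t - s) powr \<beta>"
    using assms by (simp flip: powr_add)
  also have "C * ((t - s) powr (\<alpha> - \<beta>) * (t - s) powr \<beta>)
      \<le> C * (T powr (\<alpha> - \<beta>) * (t - s) powr \<beta>)"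
    using assms st by (intro mult_left_mono mult_right_mono powr_mono2) auto
  finally show "\<bar>f t - f s\<bar> \<le> C * T powr (\<alpha> - \<beta>) * (t - s) powr \<beta>" by (simp add: mult.assoc)
qed

lemma holder_with_lincomb:
  assumes "holder_with T \<alpha> C f" "holder_with T \<alpha> D g"
  shows "holder_with T \<alpha> (\<bar>a\<bar> * C + \<bar>b\<bar> * D) (\<lambda>u. a * f u + b * g u)"
  unfolding holder_with_def
proof (intro allI impI)
  fix s t assume st: "0 \<le> s \<and> s \<le> t \<and> t \<le> T"
  have "\<bar>(a * f t + b * g t) - (a * f s + b * g s)\<bar> = \<bar>a * (f t - f s) + b * (g t - g s)\<bar>"
    by (simp add: algebra_simps)
  also have "\<dots> \<le> \<bar>a\<bar> * \<bar>f t - f s\<bar> + \<bar>b\<bar> * \<bar>g t - g s\<bar>"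
    by (metis abs_mult abs_triangle_ineq)
  also have "\<dots> \<le> \<bar>a\<bar> * (C * (t - s) powr \<alpha>) + \<bar>b\<bar> * (D * (t - s) powr \<alpha>)"
    using assms st by (intro add_mono mult_left_mono holder_withD) auto
  finally show "\<bar>(a * f t + b * g t) - (a * f s + b * g s)\<bar>
      \<le> (\<bar>a\<bar> * C + \<bar>b\<bar> * D) * (t - s) powr \<alpha>"
    by (simp add: algebra_simps)
qed

lemma holder_with_mult:
  assumes f: "holder_with T \<alpha> C f" "\<And>u. u \<in> {0..T} \<Longrightarrow> \<bar>f u\<bar> \<le> A"
    and g: "holder_with T \<alpha> D g" "\<And>u. u \<in> {0..T} \<Longrightarrow> \<bar>g u\<bar> \<le> B"
    and "0 \<le> A" "0 \<le> C"
  shows "holder_with T \<alpha> (A * D + C * B) (\<lambda>u. f u * g u)"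
  unfolding holder_with_def
proof (intro allI impI)
  fix s t assume st: "0 \<le> s \<and> s \<le> t \<and> t \<le> T"
  have "\<bar>f t * g t - f s * g s\<bar> = \<bar>f t * (g t - g s) + (f t - f s) * g s\<bar>"
    by (simp add: algebra_simps)
  also have "\<dots> \<le> \<bar>f t\<bar> * \<bar>g t - g s\<bar> + \<bar>f t - f s\<bar> * \<bar>g s\<bar>"
    by (metis abs_mult abs_triangle_ineq)
  also have "\<dots> \<le> A * (D * (t - s) powr \<alpha>) + (C * (t - s) powr \<alpha>) * B"
    using st assms by (intro add_mono mult_mono holder_withD) auto
  finally show "\<bar>f t * g t - f s * g s\<bar> \<le> (A * D + C * B) * (t - s) powr \<alpha>"
    by (simp add: algebra_simps)
qed

lemma holder_with_continuous_on:
  assumes f: "holder_with T \<alpha> C f" and "0 < \<alpha>"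
  shows "continuous_on {0..T} f"
  unfolding continuous_on_def
proof
  fix s assume s: "s \<in> {0..T}"
  have "((\<lambda>t. C * \<bar>t - s\<bar> powr \<alpha>) \<longlongrightarrow> C * \<bar>s - s\<bar> powr \<alpha>) (at s within {0..T})"
    using assms(2) by (intro tendsto_intros tendsto_powr') auto
  then have "((\<lambda>t. C * \<bar>t - s\<bar> powr \<alpha>) \<longlongrightarrow> 0) (at s within {0..T})" by simp
  moreover have "\<forall>\<^sub>F t in at s within {0..T}. norm (f t - f s) \<le> C * \<bar>t - s\<bar> powr \<alpha>"
    unfolding eventually_at_filter using holder_withD_abs[OF f s] by (auto intro!: always_eventually)
  ultimately have "((\<lambda>t. f t - f s) \<longlongrightarrow> 0) (at s within {0..T})"
    by (rule Lim_null_comparison[rotated])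
  then show "(f \<longlongrightarrow> f s) (at s within {0..T})" using LIM_zero_iff by blast
qed

lemma holder_with_imp_seminorm_le:
  assumes "holder_with T \<alpha> C f"
  shows "holder_seminorm T \<alpha> f \<le> ennreal C"
  unfolding holder_seminorm_def
proof (rule SUP_least, clarify)
  fix s t assume st: "0 \<le> s" "s < t" "t \<le> T"
  have "\<bar>f t - f s\<bar> \<le> C * (t - s) powr \<alpha>" using holder_withD[OF assms] st by auto
  then have "\<bar>f t - f s\<bar> / (t - s) powr \<alpha> \<le> C" using st by (simp add: divide_le_eq)
  then show "ennreal (\<bar>f t - f s\<bar> / (t - s) powr \<alpha>) \<le> ennreal C" by (rule ennreal_leI)
qed

lemma holder_seminorm_imp_holder_with:
  assumes "holder_seminorm T \<alpha> f \<le> ennreal C" "0 \<le> C"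
  shows "holder_with T \<alpha> C f"
  unfolding holder_with_def
proof (intro allI impI)
  fix s t assume st: "0 \<le> s \<and> s \<le> t \<and> t \<le> T"
  show "\<bar>f t - f s\<bar> \<le> C * (t - s) powr \<alpha>"
  proof (cases "s = t")
    case False
    then have "ennreal (\<bar>f t - f s\<bar> / (t - s) powr \<alpha>) \<le> holder_seminorm T \<alpha> f"
      unfolding holder_seminorm_def using st by (intro SUP_upper2[of "(s, t)"]) auto
    then have "\<bar>f t - f s\<bar> / (t - s) powr \<alpha> \<le> C"
      using assms by (meson ennreal_le_iff order_trans)
    then show ?thesis using False st by (simp add: divide_le_eq)
  qed simp
qed

lemma holder_space_holder_with:
  assumes "f \<in> holder_space T \<alpha>"
  obtains C where "0 \<le> C" "holder_with T \<alpha> C f" "ennreal C = holder_seminorm T \<alpha> f"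
proof
  have e: "ennreal (enn2real (holder_seminorm T \<alpha> f)) = holder_seminorm T \<alpha> f"
    using assms unfolding holder_space_def by (simp add: less_top)
  show "0 \<le> enn2real (holder_seminorm T \<alpha> f)" by simp
  show "ennreal (enn2real (holder_seminorm T \<alpha> f)) = holder_seminorm T \<alpha> f" by (rule e)
  show "holder_with T \<alpha> (enn2real (holder_seminorm T \<alpha> f)) f"
    by (rule holder_seminorm_imp_holder_with) (simp_all add: e)
qed

lemma holder_with_imp_holder_space: "holder_with T \<alpha> C f \<Longrightarrow> f \<in> holder_space T \<alpha>"
  unfolding holder_space_def using holder_with_imp_seminorm_le
  by (metis (mono_tags, lifting) ennreal_less_top infinity_ennreal_def mem_Collect_eq order_le_less_trans)

lemma holder_norm_le:
  assumes "holder_with T \<alpha> C f" "\<And>u. u \<in> {0..T} \<Longrightarrow> \<bar>f u\<bar> \<le> D" "0 \<le> C" "0 \<le> D"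
  shows "holder_norm T \<alpha> f \<le> ennreal (C + D)"
proof -
  have "sup_seminorm T f \<le> ennreal D"
    unfolding sup_seminorm_def by (rule SUP_least) (auto intro!: ennreal_leI assms(2))
  with holder_with_imp_seminorm_le[OF assms(1)] show ?thesis
    unfolding holder_norm_def using assms by (simp add: add_mono)
qed

lemma abs_le_holder_norm:
  assumes "u \<in> {0..T}"
  shows "ennreal \<bar>f u\<bar> \<le> holder_norm T \<alpha> f"
proof -
  have "ennreal \<bar>f u\<bar> \<le> sup_seminorm T f"
    unfolding sup_seminorm_def using assms by (intro SUP_upper)
  then show ?thesis unfolding holder_norm_def by (simp add: add_increasing)
qed

lemma has_C1_derivative_on_integral:
  assumes "has_C1_derivative_on T g g'" "0 \<le> s" "s \<le> t" "t \<le> T"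
  shows "(g' has_integral (g t - g s)) {s..t}"
proof (rule fundamental_theorem_of_calculus)
  fix u assume "u \<in> {s..t}"
  then have "(g has_real_derivative g' u) (at u within {0..T})"
    using assms unfolding has_C1_derivative_on_def by auto
  then have "(g has_real_derivative g' u) (at u within {s..t})"
    by (rule has_field_derivative_subset) (use assms in auto)
  then show "(g has_vector_derivative g' u) (at u within {s..t})"
    by (simp add: has_real_derivative_iff_has_vector_derivative)
qed fact

lemma has_C1_derivative_on_bounded:
  assumes "has_C1_derivative_on T g g'"
  obtains M where "0 \<le> M" "\<And>u. u \<in> {0..T} \<Longrightarrow> \<bar>g' u\<bar> \<le> M"
proof -
  have "continuous_on {0..T} g'" using assms unfolding has_C1_derivative_on_def by blast
  then have "bounded (g' ` {0..T})"
    by (intro compact_imp_bounded compact_continuous_image) auto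
  then obtain b where "b > 0" "\<forall>x\<in>g' ` {0..T}. norm x \<le> b" unfolding bounded_pos by blast
  then show ?thesis by (intro that[of b]) auto
qed

lemma has_C1_derivative_on_lipschitz:
  assumes "has_C1_derivative_on T g g'"
  obtains M where "0 \<le> M" "holder_with T 1 M g"
proof -
  obtain M where M: "0 \<le> M" "\<And>u. u \<in> {0..T} \<Longrightarrow> \<bar>g' u\<bar> \<le> M"
    using has_C1_derivative_on_bounded[OF assms] by blast
  have "holder_with T 1 M g"
    unfolding holder_with_def
  proof (intro allI impI)
    fix s t assume st: "0 \<le> s \<and> s \<le> t \<and> t \<le> T"
    have "norm (g t - g s) \<le> M * measure lborel {s..t}"
      by (rule has_integral_bound_real[of _ "{}" g'])
        (use has_C1_derivative_on_integral[OF assms, of s t] st M in auto)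
    then show "\<bar>g t - g s\<bar> \<le> M * (t - s) powr 1" using st by simp
  qed
  then show ?thesis using that M by blast
qed

lemma has_C1_derivative_on_lincomb:
  assumes "has_C1_derivative_on T g g'" "has_C1_derivative_on T h h'"
  shows "has_C1_derivative_on T (\<lambda>u. a * g u + b * h u) (\<lambda>u. a * g' u + b * h' u)"
  using assms unfolding has_C1_derivative_on_def
  by (auto intro!: continuous_intros derivative_eq_intros)

text \<open>Bisection. Put \<open>I(s,t) = \<integral>\<^sub>s\<^sup>t (f - f(s)) dg\<close>. With \<open>m\<close> the midpoint,
  \<open>I(s,t) = I(s,m) + I(m,t) + (f(m) - f(s)) (g(t) - g(m))\<close>, and the constant \<open>F G / (2\<^bsup>\<theta>\<^esup> - 2)\<close>, where
  \<open>\<theta> = \<alpha> + \<gamma> > 1\<close>, is the fixed point of the resulting recursion. Halving \<open>n\<close> times, the crude bound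
  \<open>F M (t - s)\<^bsup>1+\<alpha>\<^esup>\<close>, where \<open>M\<close> bounds the derivative of \<open>g\<close>, is only felt with the factor \<open>2\<^bsup>-\<alpha>n\<^esup>\<close>. So the
  final estimate depends on \<open>g\<close> through its Hoelder constant \<open>G\<close> alone, which is what makes it stable under
  approximation of a Hoelder function by \<open>C\<^sup>1\<close> functions.\<close>

lemma young_estimate_C1:
  assumes f: "holder_with T \<alpha> F f" and g: "holder_with T \<gamma> G g" and C1: "has_C1_derivative_on T g g'"
    and "0 \<le> F" "0 \<le> G" "0 < \<alpha>" "1 < \<alpha> + \<gamma>" and st: "0 \<le> s" "s \<le> t" "t \<le> T"
  shows "\<bar>integral {s..t} (\<lambda>u. f u * g' u) - f s * (g t - g s)\<bar>
      \<le> F * G / (2 powr (\<alpha> + \<gamma>) - 2) * (t - s) powr (\<alpha> + \<gamma>)"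
proof -
  define \<theta> where "\<theta> = \<alpha> + \<gamma>"
  define K where "K = F * G / (2 powr \<theta> - 2)"
  have \<theta>: "2 powr \<theta> > 2" using powr_less_mono[of 1 \<theta> 2] assms by (simp add: \<theta>_def)
  define I where "I s t = integral {s..t} (\<lambda>u. f u * g' u) - f s * (g t - g s)" for s t
  obtain M where M: "0 \<le> M" "\<And>u. u \<in> {0..T} \<Longrightarrow> \<bar>g' u\<bar> \<le> M"
    using has_C1_derivative_on_bounded[OF C1] by blast
  have cf: "continuous_on {0..T} f" using holder_with_continuous_on[OF f] assms by blast
  have cg: "continuous_on {0..T} g'" using C1 unfolding has_C1_derivative_on_def by blast
  have cont: "continuous_on {s..t} f" "continuous_on {s..t} g'" if "0 \<le> s" "t \<le> T" for s t
    using that by (auto intro!: continuous_on_subset[OF cf] continuous_on_subset[OF cg])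
  have bound: "\<bar>I s t\<bar> \<le> F * M * (t - s) powr (1 + \<alpha>) * (2 powr (- \<alpha>)) ^ n + K * (t - s) powr \<theta>"
    if "0 \<le> s" "s \<le> t" "t \<le> T" for s t and n :: nat
    using that
  proof (induction n arbitrary: s t)
    case 0
    have int: "(g' has_integral (g t - g s)) {s..t}"
      using has_C1_derivative_on_integral[OF C1] 0 by auto
    have "((\<lambda>u. f u * g' u - f s * g' u) has_integral I s t) {s..t}"
      unfolding I_def using 0
      by (intro has_integral_diff integrable_integral integrable_continuous_interval
          continuous_intros cont has_integral_mult_right int) auto
    moreover have "norm (f u * g' u - f s * g' u) \<le> F * (t - s) powr \<alpha> * M" if "u \<in> {s..t}" for u
    proof -
      have "\<bar>f u - f s\<bar> \<le> F * (u - s) powr \<alpha>" using holder_withD[OF f] 0 that by auto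
      also have "\<dots> \<le> F * (t - s) powr \<alpha>"
        using that assms by (intro mult_left_mono powr_mono2) auto
      finally have "\<bar>f u - f s\<bar> * \<bar>g' u\<bar> \<le> F * (t - s) powr \<alpha> * M"
        using that 0 M assms by (intro mult_mono) auto
      then show ?thesis by (simp add: abs_mult flip: left_diff_distrib)
    qed
    ultimately have "norm (I s t) \<le> F * (t - s) powr \<alpha> * M * measure lborel {s..t}"
      using M assms by (intro has_integral_bound_real[of _ "{}" "\<lambda>u. f u * g' u - f s * g' u"]) auto
    then have "\<bar>I s t\<bar> \<le> F * M * (t - s) powr (1 + \<alpha>)"
      using 0 by (cases "s = t") (simp_all add: powr_add mult_ac)
    moreover have "0 \<le> K * (t - s) powr \<theta>" using \<theta> assms unfolding K_def by auto
    ultimately show ?case by simp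
  next
    case (Suc n)
    define m where "m = (s + t) / 2"
    have m: "0 \<le> s" "s \<le> m" "m \<le> t" "t \<le> T" "m \<le> T" "0 \<le> m" using Suc.prems by (auto simp: m_def)
    have half: "m - s = (t - s) / 2" "t - m = (t - s) / 2" by (auto simp: m_def field_simps)
    have "integral {s..m} (\<lambda>u. f u * g' u) + integral {m..t} (\<lambda>u. f u * g' u)
        = integral {s..t} (\<lambda>u. f u * g' u)"
      using m by (intro Henstock_Kurzweil_Integration.integral_combine
          integrable_continuous_interval continuous_intros cont) auto
    then have split: "I s t = I s m + I m t + (f m - f s) * (g t - g m)"
      unfolding I_def by (simp add: algebra_simps)
    have "\<bar>f m - f s\<bar> * \<bar>g t - g m\<bar> \<le> (F * (m - s) powr \<alpha>) * (G * (t - m) powr \<gamma>)"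
      using m assms by (intro mult_mono holder_withD[OF f] holder_withD[OF g]) auto
    also have "\<dots> = F * G * ((t - s) / 2) powr \<theta>"
      unfolding half \<theta>_def by (simp add: powr_add)
    finally have cross: "\<bar>(f m - f s) * (g t - g m)\<bar> \<le> F * G * ((t - s) / 2) powr \<theta>"
      by (simp add: abs_mult)
    \<comment> \<open>The induction hypothesis bounds both halves by the same \<open>Q\<close>.\<close>
    define Q where "Q = F * M * ((t - s) / 2) powr (1 + \<alpha>) * (2 powr (- \<alpha>)) ^ n
        + K * ((t - s) / 2) powr \<theta>"
    have "\<bar>I s m\<bar> \<le> Q" "\<bar>I m t\<bar> \<le> Q"
      using Suc.IH[of s m] Suc.IH[of m t] m unfolding half Q_def by auto
    then have "\<bar>I s t\<bar> \<le> 2 * Q + F * G * ((t - s) / 2) powr \<theta>"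
      using cross abs_triangle_ineq[of "I s m + I m t" "(f m - f s) * (g t - g m)"]
        abs_triangle_ineq[of "I s m" "I m t"] unfolding split by linarith
    also have "2 * Q + F * G * ((t - s) / 2) powr \<theta> = F * M * (2 * ((t - s) / 2) powr (1 + \<alpha>)) * (2 powr (- \<alpha>)) ^ n
        + (2 * K + F * G) * ((t - s) / 2) powr \<theta>"
      by (simp add: Q_def algebra_simps)
    also have "2 * ((t - s) / 2) powr (1 + \<alpha>) = (t - s) powr (1 + \<alpha>) * 2 powr (- \<alpha>)"
      using Suc.prems by (simp add: powr_divide powr_add powr_minus field_simps)
    also have "(2 * K + F * G) * ((t - s) / 2) powr \<theta> = K * (t - s) powr \<theta>"
    proof -
      have "2 * K + F * G = K * 2 powr \<theta>" using \<theta> unfolding K_def by (simp add: field_simps)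
      then show ?thesis using Suc.prems by (simp add: powr_divide)
    qed
    finally show ?case by (simp add: mult_ac)
  qed
  have "(\<lambda>n. F * M * (t - s) powr (1 + \<alpha>) * (2 powr (- \<alpha>)) ^ n + K * (t - s) powr \<theta>)
      \<longlonglongrightarrow> F * M * (t - s) powr (1 + \<alpha>) * 0 + K * (t - s) powr \<theta>"
    using assms by (intro tendsto_intros LIMSEQ_realpow_zero) (auto simp: powr_minus field_simps)
  then have "\<bar>I s t\<bar> \<le> K * (t - s) powr \<theta>"
    using bound[OF st] by (intro LIMSEQ_le_const) auto
  then show ?thesis unfolding I_def K_def \<theta>_def .
qed

section \<open>Approximation of Hoelder functions by smooth ones\<close>

lemma LIMSEQ_abs_diff_le:
  fixes x e :: "nat \<Rightarrow> real"
  assumes "\<And>n. \<bar>x n - a\<bar> \<le> e n" "e \<longlonglongrightarrow> 0"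
  shows "x \<longlonglongrightarrow> a"
proof -
  have "(\<lambda>n. x n - a) \<longlonglongrightarrow> 0"
    by (rule Lim_null_comparison[of _ e]) (use assms in \<open>auto intro: always_eventually\<close>)
  then show ?thesis using LIM_zero_iff by blast
qed

text \<open>Composition with this map extends a function on \<open>[0,T]\<close> to the line by constants, which preserves its
  Hoelder constant.\<close>

definition clamp_to :: "real \<Rightarrow> real \<Rightarrow> real" where
  "clamp_to T u = max 0 (min T u)"

lemma clamp_to_id [simp]: "u \<in> {0..T} \<Longrightarrow> clamp_to T u = u"
  by (auto simp: clamp_to_def)

lemma holder_with_clamp:
  assumes "holder_with T \<gamma> G g" "0 \<le> G" "0 < \<gamma>" "0 \<le> T"
  shows "\<bar>g (clamp_to T t) - g (clamp_to T s)\<bar> \<le> G * \<bar>t - s\<bar> powr \<gamma>"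
proof -
  have "\<bar>g (clamp_to T t) - g (clamp_to T s)\<bar> \<le> G * \<bar>clamp_to T t - clamp_to T s\<bar> powr \<gamma>"
    by (rule holder_withD_abs[OF assms(1)]) (use assms in \<open>auto simp: clamp_to_def\<close>)
  also have "\<dots> \<le> G * \<bar>t - s\<bar> powr \<gamma>"
    using assms by (intro mult_left_mono powr_mono2) (auto simp: clamp_to_def)
  finally show ?thesis .
qed

lemma continuous_clamp:
  assumes "holder_with T \<gamma> G g" "0 < \<gamma>" "0 \<le> T"
  shows "continuous_on A (\<lambda>u. g (clamp_to T u))"
  by (rule continuous_on_compose2[OF holder_with_continuous_on[OF assms(1,2)]])
    (use assms in \<open>auto simp: clamp_to_def intro!: continuous_intros\<close>)

text \<open>This is the derivative of the moving average \<open>(\<integral>\<^bsub>t\<^esub>\<^bsup>t+h\<^esup> g) / h\<close>. Working with the derivative keeps all operators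
  below linear in \<open>g\<close> by inspection.\<close>

definition forward_quotient :: "real \<Rightarrow> (real \<Rightarrow> real) \<Rightarrow> real \<Rightarrow> real \<Rightarrow> real" where
  "forward_quotient T g h u = (g (clamp_to T (u + h)) - g (clamp_to T u)) / h"

text \<open>The approximation is the moving average \<open>(P(t + h) - P(t)) / h\<close> for a primitive \<open>P\<close> of \<open>g\<close>. By the mean value
  theorem its increments are increments of \<open>g\<close> itself, shifted by some \<open>\<xi>\<close>, so that averaging does not increase
  the Hoelder constant.\<close>

lemma C1_approximation:
  assumes g: "holder_with T \<gamma> G g" and "0 \<le> G" "0 < \<gamma>" "0 \<le> T" "0 < h"
  obtains gh where "has_C1_derivative_on T gh (forward_quotient T g h)"
    and "holder_with T \<gamma> G gh"
    and "\<forall>t\<in>{0..T}. \<bar>gh t - g t\<bar> \<le> G * h powr \<gamma>"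
proof -
  define c where "c u = g (clamp_to T u)" for u
  define P where "P u = integral {-1..u} c" for u
  define gh where "gh t = (P (t + h) - P t) / h" for t
  have cc: "continuous_on A c" for A
    unfolding c_def by (rule continuous_clamp[OF g]) (use assms in auto)
  have DP: "(P has_real_derivative c u) (at u)" if "-1 < u" for u
  proof -
    have "(P has_real_derivative c u) (at u within {-1..u+1})"
      unfolding P_def by (rule integral_has_real_derivative[OF cc]) (use that in auto)
    moreover have "at u within {-1..u+1} = at u"
      by (rule at_within_interior) (use that in auto)
    ultimately show ?thesis by simp
  qed
  have DPs: "((\<lambda>t. P (t + x)) has_real_derivative c (t + x)) (at t)" if "-1 < t + x" for t x
    using DP[OF that] by (simp add: DERIV_shift)
  have c_holder: "\<bar>c t - c s\<bar> \<le> G * \<bar>t - s\<bar> powr \<gamma>" for s t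
    unfolding c_def by (rule holder_with_clamp[OF g]) (use assms in auto)
  have 1: "has_C1_derivative_on T gh (forward_quotient T g h)"
    unfolding has_C1_derivative_on_def
  proof
    have "continuous_on {0..T} (\<lambda>u. (c (u + h) - c u) / h)"
      using assms by (intro continuous_intros continuous_on_compose2[OF cc[of UNIV]]) auto
    then show "continuous_on {0..T} (forward_quotient T g h)"
      unfolding forward_quotient_def c_def .
    show "\<forall>t\<in>{0..T}. (gh has_real_derivative forward_quotient T g h t) (at t within {0..T})"
    proof
      fix t assume "t \<in> {0..T}"
      then have "((\<lambda>t. (P (t + h) - P t) / h) has_real_derivative (c (t + h) - c t) / h) (at t)"
        using assms by (intro DERIV_cdivide DERIV_diff DPs DP) auto
      then show "(gh has_real_derivative forward_quotient T g h t) (at t within {0..T})"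
        unfolding gh_def[abs_def] forward_quotient_def c_def by (rule has_field_derivative_at_within)
    qed
  qed
  have hold: "holder_with T \<gamma> G gh"
    unfolding holder_with_def
  proof (intro allI impI)
    fix s t assume st: "0 \<le> s \<and> s \<le> t \<and> t \<le> T"
    define \<phi> where "\<phi> x = P (t + x) - P (s + x)" for x
    have "(\<phi> has_real_derivative (c (t + x) - c (s + x))) (at x)" if "0 \<le> x" for x
      unfolding \<phi>_def using DPs[of x t] DPs[of x s] st that
      by (auto intro!: DERIV_diff simp: add.commute)
    then obtain \<xi> where "\<phi> h - \<phi> 0 = (h - 0) * (c (t + \<xi>) - c (s + \<xi>))"
      using MVT2[of 0 h \<phi> "\<lambda>x. c (t + x) - c (s + x)"] assms by auto
    moreover have "gh t - gh s = (\<phi> h - \<phi> 0) / h"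
      unfolding gh_def \<phi>_def by (simp add: diff_divide_distrib add_divide_distrib)
    ultimately have "gh t - gh s = c (t + \<xi>) - c (s + \<xi>)" using assms by simp
    then show "\<bar>gh t - gh s\<bar> \<le> G * (t - s) powr \<gamma>"
      using c_holder[of "t + \<xi>" "s + \<xi>"] st by simp
  qed
  have close: "\<bar>gh t - g t\<bar> \<le> G * h powr \<gamma>" if t: "t \<in> {0..T}" for t
  proof -
    obtain \<xi> where \<xi>: "t < \<xi>" "\<xi> < t + h" "P (t + h) - P t = (t + h - t) * c \<xi>"
      using MVT2[of t "t + h" P c] DP assms t by force
    then have "gh t - g t = c \<xi> - c t" unfolding gh_def using assms t by (simp add: c_def)
    also have "\<bar>\<dots>\<bar> \<le> G * \<bar>\<xi> - t\<bar> powr \<gamma>" by (rule c_holder)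
    also have "\<dots> \<le> G * h powr \<gamma>" using \<xi> assms by (intro mult_left_mono powr_mono2) auto
    finally show ?thesis .
  qed
  show ?thesis by (rule that[OF 1 hold]) (use close in blast)
qed

text \<open>A function that is small in the uniform norm and bounded in a Hoelder norm is small in every weaker
  Hoelder norm: the first bound is used for increments over distances above \<open>h\<close>, the second one below.\<close>

lemma holder_with_interpolation:
  assumes d: "holder_with T \<gamma> (2 * G) d" and small: "\<And>t. t \<in> {0..T} \<Longrightarrow> \<bar>d t\<bar> \<le> G * h powr \<gamma>"
    and "0 \<le> G" "0 < \<beta>" "\<beta> \<le> \<gamma>" "0 < h"
  shows "holder_with T \<beta> (2 * G * h powr (\<gamma> - \<beta>)) d"
  unfolding holder_with_def
proof (intro allI impI)
  fix s t assume st: "0 \<le> s \<and> s \<le> t \<and> t \<le> T"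
  show "\<bar>d t - d s\<bar> \<le> 2 * G * h powr (\<gamma> - \<beta>) * (t - s) powr \<beta>"
  proof (cases "t - s \<le> h")
    case True
    have "\<bar>d t - d s\<bar> \<le> 2 * G * ((t - s) powr (\<gamma> - \<beta>) * (t - s) powr \<beta>)"
      using holder_withD[OF d, of s t] st assms by (simp flip: powr_add)
    also have "\<dots> \<le> 2 * G * (h powr (\<gamma> - \<beta>) * (t - s) powr \<beta>)"
      using True st assms by (intro mult_left_mono mult_right_mono powr_mono2) auto
    finally show ?thesis by (simp add: mult_ac)
  next
    case False
    have "\<bar>d t - d s\<bar> \<le> 2 * G * h powr \<gamma>" using small[of s] small[of t] st by force
    also have "h powr \<gamma> = h powr (\<gamma> - \<beta>) * h powr \<beta>" by (simp flip: powr_add)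
    also have "2 * G * (h powr (\<gamma> - \<beta>) * h powr \<beta>) \<le> 2 * G * (h powr (\<gamma> - \<beta>) * (t - s) powr \<beta>)"
      using False assms by (intro mult_left_mono powr_mono2) auto
    finally show ?thesis by (simp add: mult_ac)
  qed
qed

text \<open>The moving averages of a \<open>\<gamma>\<close>-Hoelder function need not converge to it in the \<open>\<gamma>\<close>-Hoelder norm, but they do so
  for each smaller exponent \<open>\<beta>\<close>.\<close>

lemma C1_approximation_weak:
  assumes g: "holder_with T \<gamma> G g" and "0 \<le> G" "0 < \<beta>" "\<beta> \<le> \<gamma>" "0 \<le> T" "0 < h"
  obtains gh where "has_C1_derivative_on T gh (forward_quotient T g h)"
    and "holder_with T \<gamma> G gh"
    and "\<forall>t\<in>{0..T}. \<bar>gh t - g t\<bar> \<le> G * h powr \<gamma>"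
    and "holder_with T \<beta> (2 * G * h powr (\<gamma> - \<beta>)) (\<lambda>u. gh u - g u)"
proof -
  obtain gh where gh: "has_C1_derivative_on T gh (forward_quotient T g h)" "holder_with T \<gamma> G gh"
    "\<forall>t\<in>{0..T}. \<bar>gh t - g t\<bar> \<le> G * h powr \<gamma>"
    using C1_approximation[OF g, of h] assms by auto
  have "holder_with T \<gamma> (2 * G) (\<lambda>u. gh u - g u)"
    using holder_with_lincomb[OF gh(2) g, of 1 "- 1"] by simp
  then have "holder_with T \<beta> (2 * G * h powr (\<gamma> - \<beta>)) (\<lambda>u. gh u - g u)"
    by (rule holder_with_interpolation) (use gh assms in auto)
  then show ?thesis using that gh by blast
qed

section \<open>Existence and uniqueness of the Young integral\<close>

text \<open>In the \<open>\<beta>\<close>-Hoelder norm \<open>T\<^sub>f\<close> is Lipschitz, uniformly over \<open>C\<^sup>1\<close>.\<close>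

lemma young_C1_stability:
  assumes f: "holder_with T \<alpha> F f" "0 \<le> F" and "0 < \<alpha>" "1 < \<alpha> + \<beta>"
    and C1: "has_C1_derivative_on T g1 g1'" "has_C1_derivative_on T g2 g2'"
    and d: "holder_with T \<beta> D (\<lambda>u. g1 u - g2 u)" "0 \<le> D" and t: "t \<in> {0..T}"
  shows "\<bar>integral {0..t} (\<lambda>u. f u * g1' u) - integral {0..t} (\<lambda>u. f u * g2' u)\<bar>
      \<le> D * (F / (2 powr (\<alpha> + \<beta>) - 2) * t powr (\<alpha> + \<beta>) + \<bar>f 0\<bar> * t powr \<beta>)"
proof -
  have C: "has_C1_derivative_on T (\<lambda>u. g1 u - g2 u) (\<lambda>u. g1' u - g2' u)"
    using has_C1_derivative_on_lincomb[OF C1, of 1 "- 1"] by simp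
  have cont: "continuous_on {0..t} f" "continuous_on {0..t} g1'" "continuous_on {0..t} g2'"
    using holder_with_continuous_on[OF f(1) \<open>0 < \<alpha>\<close>] C1 t unfolding has_C1_derivative_on_def
    by (auto elim!: continuous_on_subset)
  have "integral {0..t} (\<lambda>u. f u * g1' u) - integral {0..t} (\<lambda>u. f u * g2' u)
      = integral {0..t} (\<lambda>u. f u * g1' u - f u * g2' u)"
    by (intro integral_diff[symmetric] integrable_continuous_interval continuous_intros cont)
  also have "\<dots> = integral {0..t} (\<lambda>u. f u * (g1' u - g2' u))"
    by (simp add: algebra_simps)
  finally have eq: "integral {0..t} (\<lambda>u. f u * g1' u) - integral {0..t} (\<lambda>u. f u * g2' u)
      = integral {0..t} (\<lambda>u. f u * (g1' u - g2' u))" .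
  let ?d = "g1 t - g2 t - (g1 0 - g2 0)"
  have "\<bar>integral {0..t} (\<lambda>u. f u * (g1' u - g2' u)) - f 0 * ?d\<bar>
      \<le> F * D / (2 powr (\<alpha> + \<beta>) - 2) * (t - 0) powr (\<alpha> + \<beta>)"
    by (rule young_estimate_C1[OF f(1) d(1) C]) (use assms in auto)
  moreover have "\<bar>f 0 * ?d\<bar> \<le> \<bar>f 0\<bar> * (D * (t - 0) powr \<beta>)"
    unfolding abs_mult using t by (intro mult_left_mono holder_withD[OF d(1)]) auto
  ultimately show ?thesis unfolding eq by (simp add: algebra_simps)
qed

lemma convergent_if_close:
  fixes x e :: "nat \<Rightarrow> real"
  assumes close: "\<And>m l. \<bar>x m - x l\<bar> \<le> e m + e l" and e: "e \<longlonglongrightarrow> 0"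
  shows "convergent x"
proof (rule Cauchy_convergent, rule metric_CauchyI)
  fix r :: real assume "0 < r"
  then have "\<forall>\<^sub>F n in sequentially. \<bar>e n\<bar> < r / 2"
    using e[unfolded tendsto_iff, rule_format, of "r / 2"] by (simp add: dist_real_def)
  then obtain N where N: "\<And>n. n \<ge> N \<Longrightarrow> \<bar>e n\<bar> < r / 2" unfolding eventually_sequentially by blast
  have "dist (x m) (x l) < r" if "m \<ge> N" "l \<ge> N" for m l
    using close[of m l] N[OF that(1)] N[OF that(2)] by (simp add: dist_real_def)
  then show "\<exists>N. \<forall>m\<ge>N. \<forall>l\<ge>N. dist (x m) (x l) < r" by blast
qed

text \<open>The approximations \<open>\<integral>\<^sub>0\<^sup>t f(u) (g(u + h) - g(u)) / h du\<close> of the forward integral of Russo and Vallois, for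
  \<open>h = 1/(m+1)\<close>. They are the values of the operator \<open>T\<^sub>f\<close> at the moving averages of \<open>g\<close>.\<close>

definition forward_integral :: "real \<Rightarrow> (real \<Rightarrow> real) \<Rightarrow> (real \<Rightarrow> real) \<Rightarrow> nat \<Rightarrow> real \<Rightarrow> real" where
  "forward_integral T f g m t
     = integral {0..t} (\<lambda>u. f u * forward_quotient T g (inverse (real (Suc m))) u)"

lemma tendsto_inverse_powr_0:
  assumes "0 < p"
  shows "(\<lambda>m. inverse (real (Suc m)) powr p) \<longlonglongrightarrow> 0"
proof -
  have "(\<lambda>m. inverse (real (Suc m)) powr p) \<longlonglongrightarrow> 0 powr p"
    using LIMSEQ_inverse_real_of_nat assms by (intro tendsto_powr') auto
  then show ?thesis by simp
qed

text \<open>The moving averages form a Cauchy sequence in the \<open>\<beta>\<close>-Hoelder norm for \<open>1 - \<alpha> < \<beta> < \<gamma>\<close>, and \<open>T\<^sub>f\<close> is bounded in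
  that norm by the estimate for \<open>C\<^sup>1\<close> functions.\<close>

lemma forward_integral_convergent:
  assumes f: "holder_with T \<alpha> F f" "0 \<le> F" and g: "holder_with T \<gamma> G g" "0 \<le> G"
    and "0 < \<alpha>" "\<alpha> < 1" "1 < \<alpha> + \<gamma>" and t: "t \<in> {0..T}"
  shows "convergent (\<lambda>m. forward_integral T f g m t)"
proof -
  define \<beta> where "\<beta> = (1 - \<alpha> + \<gamma>) / 2"
  have \<beta>: "0 < \<beta>" "\<beta> < \<gamma>" "1 < \<alpha> + \<beta>" using assms by (auto simp: \<beta>_def field_simps)
  define h where "h m = inverse (real (Suc m))" for m
  have h: "h m > 0" for m unfolding h_def by simp
  have "\<exists>gh. has_C1_derivative_on T gh (forward_quotient T g (h m)) \<and>
      holder_with T \<beta> (2 * G * h m powr (\<gamma> - \<beta>)) (\<lambda>u. gh u - g u)" for m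
    using C1_approximation_weak[OF g \<beta>(1) less_imp_le[OF \<beta>(2)] _ h, of m] t by force
  then obtain gh where gh: "\<And>m. has_C1_derivative_on T (gh m) (forward_quotient T g (h m))"
    "\<And>m. holder_with T \<beta> (2 * G * h m powr (\<gamma> - \<beta>)) (\<lambda>u. gh m u - g u)"
    by metis
  define C where "C = F / (2 powr (\<alpha> + \<beta>) - 2) * t powr (\<alpha> + \<beta>) + \<bar>f 0\<bar> * t powr \<beta>"
  define e where "e m = 2 * G * h m powr (\<gamma> - \<beta>) * C" for m
  have "\<bar>forward_integral T f g m t - forward_integral T f g l t\<bar> \<le> e m + e l" for m l
  proof -
    have "holder_with T \<beta> (2 * G * h m powr (\<gamma> - \<beta>) + 2 * G * h l powr (\<gamma> - \<beta>)) (\<lambda>u. gh m u - gh l u)"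
      using holder_with_lincomb[OF gh(2) gh(2), of 1 m "- 1" l] by simp
    then have "\<bar>forward_integral T f g m t - forward_integral T f g l t\<bar>
        \<le> (2 * G * h m powr (\<gamma> - \<beta>) + 2 * G * h l powr (\<gamma> - \<beta>)) * C"
      unfolding C_def forward_integral_def h_def[symmetric]
      by (intro young_C1_stability[OF f _ _ gh(1) gh(1)]) (use assms \<beta> in auto)
    then show ?thesis unfolding e_def by (simp add: algebra_simps)
  qed
  moreover have "e \<longlonglongrightarrow> 2 * G * 0 * C"
    unfolding e_def h_def using \<beta> by (intro tendsto_intros tendsto_inverse_powr_0) auto
  ultimately show ?thesis by (intro convergent_if_close[of _ e]) auto
qed

lemma forward_integral_C1:
  assumes f: "holder_with T \<alpha> F f" "0 \<le> F" and "0 < \<alpha>" "\<alpha> < 1"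
    and C1: "has_C1_derivative_on T g g'" and t: "t \<in> {0..T}"
  shows "(\<lambda>m. forward_integral T f g m t) \<longlonglongrightarrow> integral {0..t} (\<lambda>u. f u * g' u)"
proof -
  define \<beta> where "\<beta> = 1 - \<alpha> / 2"
  have \<beta>: "0 < \<beta>" "\<beta> < 1" "1 < \<alpha> + \<beta>" using assms by (auto simp: \<beta>_def field_simps)
  obtain G where G: "0 \<le> G" "holder_with T 1 G g" using has_C1_derivative_on_lipschitz[OF C1] .
  define h where "h m = inverse (real (Suc m))" for m
  have h: "h m > 0" for m unfolding h_def by simp
  define C where "C = F / (2 powr (\<alpha> + \<beta>) - 2) * t powr (\<alpha> + \<beta>) + \<bar>f 0\<bar> * t powr \<beta>"
  have "\<bar>forward_integral T f g m t - integral {0..t} (\<lambda>u. f u * g' u)\<bar>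
      \<le> 2 * G * h m powr (1 - \<beta>) * C" for m
  proof -
    obtain gh where gh: "has_C1_derivative_on T gh (forward_quotient T g (h m))"
      "holder_with T \<beta> (2 * G * h m powr (1 - \<beta>)) (\<lambda>u. gh u - g u)"
      using C1_approximation_weak[OF G(2,1) \<beta>(1) less_imp_le[OF \<beta>(2)] _ h, of m] t by force
    show ?thesis
      unfolding C_def forward_integral_def h_def[symmetric]
      by (rule young_C1_stability[OF f _ _ gh(1) C1 gh(2)]) (use assms \<beta> G in auto)
  qed
  moreover have "(\<lambda>m. 2 * G * h m powr (1 - \<beta>) * C) \<longlonglongrightarrow> 0"
    unfolding h_def using \<beta>
    by (intro tendsto_mult_left_zero tendsto_mult_right_zero tendsto_inverse_powr_0) auto
  ultimately show ?thesis by (rule LIMSEQ_abs_diff_le)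
qed

text \<open>The estimate for \<open>C\<^sup>1\<close> functions passes to the limit because the moving averages have the same
  Hoelder constant as \<open>g\<close>.\<close>

lemma forward_integral_limit_estimate:
  assumes f: "holder_with T \<alpha> F f" "0 \<le> F" and g: "holder_with T \<gamma> G g" "0 \<le> G"
    and "0 < \<alpha>" "\<alpha> < 1" "1 < \<alpha> + \<gamma>" and st: "0 \<le> s" "s \<le> t" "t \<le> T"
    and lim: "(\<lambda>m. forward_integral T f g m s) \<longlonglongrightarrow> Is" "(\<lambda>m. forward_integral T f g m t) \<longlonglongrightarrow> It"
  shows "\<bar>It - Is - f s * (g t - g s)\<bar> \<le> F * G / (2 powr (\<alpha> + \<gamma>) - 2) * (t - s) powr (\<alpha> + \<gamma>)"
proof -
  define h where "h m = inverse (real (Suc m))" for m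
  have h: "h m > 0" for m unfolding h_def by simp
  have \<gamma>: "0 < \<gamma>" using assms by auto
  have "\<exists>gh. has_C1_derivative_on T gh (forward_quotient T g (h m)) \<and> holder_with T \<gamma> G gh
      \<and> (\<forall>t\<in>{0..T}. \<bar>gh t - g t\<bar> \<le> G * h m powr \<gamma>)" (is "\<exists>gh. ?P gh m") for m
  proof -
    have "0 \<le> T" using st by auto
    obtain gh where "has_C1_derivative_on T gh (forward_quotient T g (h m))" "holder_with T \<gamma> G gh"
      "\<forall>t\<in>{0..T}. \<bar>gh t - g t\<bar> \<le> G * h m powr \<gamma>"
      by (rule C1_approximation[OF g \<gamma> \<open>0 \<le> T\<close> h[of m]])
    then show ?thesis by blast
  qed
  then have ex: "\<And>m. \<exists>gh. ?P gh m" .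
  define gh where "gh m = (SOME gh. ?P gh m)" for m
  have P: "?P (gh m) m" for m
    unfolding gh_def using ex[of m] by (rule someI_ex)
  have gh: "has_C1_derivative_on T (gh m) (forward_quotient T g (h m))" "holder_with T \<gamma> G (gh m)"
    "u \<in> {0..T} \<Longrightarrow> \<bar>gh m u - g u\<bar> \<le> G * h m powr \<gamma>" for m u
    using P[of m] by simp_all
  have gh_lim: "(\<lambda>m. gh m u) \<longlonglongrightarrow> g u" if "u \<in> {0..T}" for u
  proof -
    have "(\<lambda>m. G * h m powr \<gamma>) \<longlonglongrightarrow> G * 0"
      unfolding h_def using \<gamma> by (intro tendsto_intros tendsto_inverse_powr_0) auto
    then show ?thesis using LIMSEQ_abs_diff_le[OF gh(3)[OF that]] by simp
  qed
  have "\<bar>forward_integral T f g m t - forward_integral T f g m s - f s * (gh m t - gh m s)\<bar>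
      \<le> F * G / (2 powr (\<alpha> + \<gamma>) - 2) * (t - s) powr (\<alpha> + \<gamma>)" for m
  proof -
    have "continuous_on {0..T} (forward_quotient T g (h m))"
      using gh(1)[of m] unfolding has_C1_derivative_on_def by blast
    then have "continuous_on {0..T} (\<lambda>u. f u * forward_quotient T g (h m) u)"
      by (intro continuous_on_mult holder_with_continuous_on[OF f(1) \<open>0 < \<alpha>\<close>])
    then have cont: "continuous_on {0..t} (\<lambda>u. f u * forward_quotient T g (h m) u)"
      by (rule continuous_on_subset) (use st in auto)
    have "integral {0..s} (\<lambda>u. f u * forward_quotient T g (h m) u)
        + integral {s..t} (\<lambda>u. f u * forward_quotient T g (h m) u)
        = integral {0..t} (\<lambda>u. f u * forward_quotient T g (h m) u)"
      using st by (intro Henstock_Kurzweil_Integration.integral_combine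
          integrable_continuous_interval cont) auto
    then have "forward_integral T f g m t - forward_integral T f g m s
        = integral {s..t} (\<lambda>u. f u * forward_quotient T g (h m) u)"
      unfolding forward_integral_def h_def by linarith
    then show ?thesis
      using young_estimate_C1[OF f(1) gh(2)[of m] gh(1)[of m], of s t] assms by simp
  qed
  moreover have "(\<lambda>m. \<bar>forward_integral T f g m t - forward_integral T f g m s - f s * (gh m t - gh m s)\<bar>)
      \<longlonglongrightarrow> \<bar>It - Is - f s * (g t - g s)\<bar>"
    using st by (intro tendsto_intros lim gh_lim) auto
  ultimately show ?thesis by (intro LIMSEQ_le_const2) auto
qed

definition forward_limit :: "real \<Rightarrow> (real \<Rightarrow> real) \<Rightarrow> (real \<Rightarrow> real) \<Rightarrow> real \<Rightarrow> real" where
  "forward_limit T f g t = lim (\<lambda>m. forward_integral T f g m t)"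

lemma forward_integral_tendsto:
  assumes "holder_with T \<alpha> F f" "0 \<le> F" "holder_with T \<gamma> G g" "0 \<le> G"
    "0 < \<alpha>" "\<alpha> < 1" "1 < \<alpha> + \<gamma>" "t \<in> {0..T}"
  shows "(\<lambda>m. forward_integral T f g m t) \<longlonglongrightarrow> forward_limit T f g t"
  unfolding forward_limit_def using forward_integral_convergent[OF assms] convergent_LIMSEQ_iff by blast

lemma forward_limit_estimate:
  assumes "holder_with T \<alpha> F f" "0 \<le> F" "holder_with T \<gamma> G g" "0 \<le> G"
    "0 < \<alpha>" "\<alpha> < 1" "1 < \<alpha> + \<gamma>" "0 \<le> s" "s \<le> t" "t \<le> T"
  shows "\<bar>forward_limit T f g t - forward_limit T f g s - f s * (g t - g s)\<bar>
    \<le> F * G / (2 powr (\<alpha> + \<gamma>) - 2) * (t - s) powr (\<alpha> + \<gamma>)"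
  using assms(8-10) by (intro forward_integral_limit_estimate[OF assms]
      forward_integral_tendsto[OF assms(1-7)]) auto

lemma forward_limit_0 [simp]: "forward_limit T f g 0 = 0"
  unfolding forward_limit_def forward_integral_def by (simp add: limI)

lemma forward_quotient_continuous:
  assumes "holder_with T \<gamma> G g" "0 < \<gamma>" "0 \<le> T"
  shows "continuous_on A (forward_quotient T g h)"
proof -
  have "continuous_on A (\<lambda>u. (g (clamp_to T (u + h)) - g (clamp_to T u)) * inverse h)"
    by (intro continuous_intros continuous_clamp[OF assms]
        continuous_on_compose2[OF continuous_clamp[OF assms, of UNIV]]) auto
  then show ?thesis unfolding forward_quotient_def[abs_def] by (simp add: divide_inverse)
qed

lemma forward_limit_linear:
  assumes f: "holder_with T \<alpha> F f" "0 \<le> F" and g: "holder_with T \<gamma> G g" "0 \<le> G"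
    and k: "holder_with T \<gamma> K k" "0 \<le> K"
    and \<alpha>: "0 < \<alpha>" "\<alpha> < 1" "1 < \<alpha> + \<gamma>" and t: "t \<in> {0..T}"
  shows "forward_limit T f (\<lambda>u. a * g u + b * k u) t
      = a * forward_limit T f g t + b * forward_limit T f k t"
proof -
  have gk: "holder_with T \<gamma> (\<bar>a\<bar> * G + \<bar>b\<bar> * K) (\<lambda>u. a * g u + b * k u)"
    by (rule holder_with_lincomb[OF g(1) k(1)])
  have T: "0 \<le> T" and \<gamma>: "0 < \<gamma>" using t \<alpha> by auto
  have cf: "continuous_on {0..t} f"
    by (rule continuous_on_subset[OF holder_with_continuous_on[OF f(1) \<alpha>(1)]]) (use t in auto)
  have "forward_integral T f (\<lambda>u. a * g u + b * k u) m t
      = a * forward_integral T f g m t + b * forward_integral T f k m t" for m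
  proof -
    define h where "h = inverse (real (Suc m))"
    have int: "(\<lambda>u. f u * forward_quotient T g h u) integrable_on {0..t}"
      "(\<lambda>u. f u * forward_quotient T k h u) integrable_on {0..t}"
      by (intro integrable_continuous_interval continuous_on_mult cf
          forward_quotient_continuous[OF g(1) \<gamma> T] forward_quotient_continuous[OF k(1) \<gamma> T])+
    have "((\<lambda>u. a * (f u * forward_quotient T g h u) + b * (f u * forward_quotient T k h u))
        has_integral (a * forward_integral T f g m t + b * forward_integral T f k m t)) {0..t}"
      unfolding forward_integral_def h_def[symmetric]
      by (intro has_integral_add has_integral_mult_right integrable_integral int)
    moreover have "(\<lambda>u. a * (f u * forward_quotient T g h u) + b * (f u * forward_quotient T k h u))
        = (\<lambda>u. f u * forward_quotient T (\<lambda>u. a * g u + b * k u) h u)"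
      unfolding forward_quotient_def by (auto simp: divide_inverse algebra_simps)
    ultimately have "((\<lambda>u. f u * forward_quotient T (\<lambda>u. a * g u + b * k u) h u)
        has_integral (a * forward_integral T f g m t + b * forward_integral T f k m t)) {0..t}" by simp
    then show ?thesis
      unfolding forward_integral_def[of T f "\<lambda>u. a * g u + b * k u"] h_def by (rule integral_unique)
  qed
  then have "(\<lambda>m. forward_integral T f (\<lambda>u. a * g u + b * k u) m t)
      \<longlonglongrightarrow> a * forward_limit T f g t + b * forward_limit T f k t"
    using tendsto_add[OF tendsto_mult_left[OF forward_integral_tendsto[OF f g \<alpha> t], of a]
        tendsto_mult_left[OF forward_integral_tendsto[OF f k \<alpha> t], of b]] by presburger
  moreover have "(\<lambda>m. forward_integral T f (\<lambda>u. a * g u + b * k u) m t)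
      \<longlonglongrightarrow> forward_limit T f (\<lambda>u. a * g u + b * k u) t"
    by (rule forward_integral_tendsto[OF f gk _ \<alpha> t]) (use g k in auto)
  ultimately show ?thesis using LIMSEQ_unique by blast
qed

text \<open>Existence: the forward integral extends \<open>T\<^sub>f\<close>, and the increment estimate bounds it on every \<open>C\<^bsup>\<gamma>\<^esup>\<close>.\<close>

lemma young_extension_forward_limit:
  assumes f: "holder_with T \<alpha> F f" "0 \<le> F" and \<alpha>: "0 < \<alpha>" "\<alpha> < 1" and T: "0 \<le> T"
  shows "young_extension T \<alpha> f (forward_limit T f)"
  unfolding young_extension_def
proof (intro conjI allI impI ballI)
  fix g g' t assume "has_C1_derivative_on T g g'" "t \<in> {0..T}"
  then show "forward_limit T f g t = integral {0..t} (\<lambda>u. f u * g' u)"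
    unfolding forward_limit_def by (intro limI forward_integral_C1[OF f \<alpha>])
next
  fix \<gamma> assume \<gamma>: "0 < \<gamma> \<and> \<gamma> < 1 \<and> 1 < \<alpha> + \<gamma>"
  define A where "A = \<bar>f 0\<bar> + F * T powr \<alpha>"
  have A: "\<bar>f u\<bar> \<le> A" if "u \<in> {0..T}" for u
  proof -
    have "\<bar>f u - f 0\<bar> \<le> F * (u - 0) powr \<alpha>" by (rule holder_withD[OF f(1)]) (use that in auto)
    also have "\<dots> \<le> F * T powr \<alpha>" using that f \<alpha> by (intro mult_left_mono powr_mono2) auto
    finally show ?thesis unfolding A_def by linarith
  qed
  define q where "q = F / (2 powr (\<alpha> + \<gamma>) - 2)"
  have q: "0 \<le> q" using powr_less_mono[of 1 "\<alpha> + \<gamma>" 2] \<gamma> f by (simp add: q_def)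
  define C where "C = A + q * T powr \<alpha>"
  have A0: "0 \<le> A" using f unfolding A_def by auto
  have C: "0 \<le> C" unfolding C_def using q A0 by auto
  have hold: "holder_with T \<gamma> (C * G) (forward_limit T f g)"
    if g: "holder_with T \<gamma> G g" "0 \<le> G" for g G
    unfolding holder_with_def
  proof (intro allI impI)
    fix s t assume st: "0 \<le> s \<and> s \<le> t \<and> t \<le> T"
    let ?d = "forward_limit T f g t - forward_limit T f g s"
    have "\<bar>?d - f s * (g t - g s)\<bar> \<le> F * G / (2 powr (\<alpha> + \<gamma>) - 2) * (t - s) powr (\<alpha> + \<gamma>)"
      by (rule forward_limit_estimate[OF f g \<alpha>]) (use \<gamma> st in auto)
    also have "\<dots> = q * G * ((t - s) powr \<alpha> * (t - s) powr \<gamma>)" by (simp add: q_def powr_add)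
    also have "\<dots> \<le> q * G * (T powr \<alpha> * (t - s) powr \<gamma>)"
      using q g st \<alpha> by (intro mult_left_mono mult_right_mono powr_mono2) auto
    finally have 1: "\<bar>?d - f s * (g t - g s)\<bar> \<le> q * G * (T powr \<alpha> * (t - s) powr \<gamma>)" .
    have "\<bar>f s * (g t - g s)\<bar> \<le> A * (G * (t - s) powr \<gamma>)"
      unfolding abs_mult using st A0 by (intro mult_mono A holder_withD[OF g(1)]) auto
    with 1 have "\<bar>?d\<bar> \<le> q * G * (T powr \<alpha> * (t - s) powr \<gamma>) + A * (G * (t - s) powr \<gamma>)" by linarith
    then show "\<bar>?d\<bar> \<le> C * G * (t - s) powr \<gamma>" by (simp add: C_def algebra_simps)
  qed
  define K where "K = C + C * T powr \<gamma>"
  show "bounded_linear_holder T \<gamma> (forward_limit T f)"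
    unfolding bounded_linear_holder_def
  proof (intro conjI ballI allI)
    fix g assume "g \<in> holder_space T \<gamma>"
    then obtain G where "0 \<le> G" "holder_with T \<gamma> G g" by (rule holder_space_holder_with)
    then show "forward_limit T f g \<in> holder_space T \<gamma>"
      using hold holder_with_imp_holder_space by blast
  next
    fix g k a b t assume gk: "g \<in> holder_space T \<gamma>" "k \<in> holder_space T \<gamma>" and t: "t \<in> {0..T}"
    obtain G where "0 \<le> G" "holder_with T \<gamma> G g" using gk(1) by (rule holder_space_holder_with)
    moreover obtain L where "0 \<le> L" "holder_with T \<gamma> L k" using gk(2) by (rule holder_space_holder_with)
    ultimately show "forward_limit T f (\<lambda>u. a * g u + b * k u) t
        = a * forward_limit T f g t + b * forward_limit T f k t"
      using forward_limit_linear[OF f] \<alpha> \<gamma> t by blast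
  next
    show "\<exists>K. \<forall>g\<in>holder_space T \<gamma>. holder_norm T \<gamma> (forward_limit T f g) \<le> ennreal K * holder_norm T \<gamma> g"
    proof (intro exI ballI)
      fix g assume "g \<in> holder_space T \<gamma>"
      then obtain G where G: "0 \<le> G" "holder_with T \<gamma> G g" "ennreal G = holder_seminorm T \<gamma> g"
        by (rule holder_space_holder_with)
      note h = hold[OF G(2,1)]
      have "\<bar>forward_limit T f g u\<bar> \<le> C * G * T powr \<gamma>" if "u \<in> {0..T}" for u
      proof -
        have "\<bar>forward_limit T f g u - forward_limit T f g 0\<bar> \<le> C * G * (u - 0) powr \<gamma>"
          by (rule holder_withD[OF h]) (use that in auto)
        also have "\<dots> \<le> C * G * T powr \<gamma>"
          using that C G \<gamma> by (intro mult_left_mono powr_mono2) auto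
        finally show ?thesis by simp
      qed
      then have "holder_norm T \<gamma> (forward_limit T f g) \<le> ennreal (C * G + C * G * T powr \<gamma>)"
        using C G by (intro holder_norm_le[OF h]) auto
      also have "C * G + C * G * T powr \<gamma> = K * G" by (simp add: K_def algebra_simps)
      also have "ennreal (K * G) = ennreal K * ennreal G"
        using C G by (intro ennreal_mult) (auto simp: K_def)
      also have "\<dots> \<le> ennreal K * holder_norm T \<gamma> g"
        unfolding G(3) holder_norm_def by (intro mult_left_mono) auto
      finally show "holder_norm T \<gamma> (forward_limit T f g) \<le> ennreal K * holder_norm T \<gamma> g" .
    qed
  qed
qed

text \<open>Uniqueness: an extension is continuous on \<open>C\<^bsup>\<beta>\<^esup>\<close> for some \<open>\<beta> < \<gamma>\<close> with \<open>\<alpha> + \<beta> > 1\<close>, and there the moving averages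
  converge to \<open>g\<close>. So every extension has the forward integral as its value.\<close>

lemma young_extension_unique:
  assumes L: "young_extension T \<alpha> f L" and g: "holder_with T \<gamma> G g" "0 \<le> G"
    and \<alpha>: "0 < \<alpha>" "\<alpha> < 1" "1 < \<alpha> + \<gamma>" "\<gamma> < 1" and t: "t \<in> {0..T}"
  shows "(\<lambda>m. forward_integral T f g m t) \<longlonglongrightarrow> L g t"
proof -
  define \<beta> where "\<beta> = (1 - \<alpha> + \<gamma>) / 2"
  have \<beta>: "0 < \<beta>" "\<beta> < \<gamma>" "1 < \<alpha> + \<beta>" "\<beta> < 1" using \<alpha> by (auto simp: \<beta>_def field_simps)
  have T: "0 \<le> T" using t by auto
  define h where "h m = inverse (real (Suc m))" for m
  have h: "h m > 0" for m unfolding h_def by simp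
  have bl: "bounded_linear_holder T \<beta> L" using L \<beta> unfolding young_extension_def by blast
  then obtain K where K: "\<And>g. g \<in> holder_space T \<beta> \<Longrightarrow> holder_norm T \<beta> (L g) \<le> ennreal K * holder_norm T \<beta> g"
    unfolding bounded_linear_holder_def by blast
  have gs: "g \<in> holder_space T \<beta>"
    using holder_with_lower_exponent[OF g \<beta>(1)] \<beta> holder_with_imp_holder_space by (metis less_imp_le)
  have "\<bar>forward_integral T f g m t - L g t\<bar>
      \<le> max K 0 * (2 * G * h m powr (\<gamma> - \<beta>) + G * h m powr \<gamma>)" for m
  proof -
    obtain gh where gh: "has_C1_derivative_on T gh (forward_quotient T g (h m))"
      "holder_with T \<gamma> G gh" "\<forall>t\<in>{0..T}. \<bar>gh t - g t\<bar> \<le> G * h m powr \<gamma>"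
      "holder_with T \<beta> (2 * G * h m powr (\<gamma> - \<beta>)) (\<lambda>u. gh u - g u)"
      using C1_approximation_weak[OF g \<beta>(1) less_imp_le[OF \<beta>(2)] T h[of m]] by blast
    have ghs: "gh \<in> holder_space T \<beta>"
      using holder_with_lower_exponent[OF gh(2) g(2) \<beta>(1)] \<beta> holder_with_imp_holder_space
      by (metis less_imp_le)
    have ds: "(\<lambda>u. gh u - g u) \<in> holder_space T \<beta>" using gh(4) by (rule holder_with_imp_holder_space)
    have "L gh t = forward_integral T f g m t"
      using L gh(1) t unfolding young_extension_def forward_integral_def h_def by blast
    moreover have "L (\<lambda>u. 1 * gh u + (- 1) * g u) t = 1 * L gh t + (- 1) * L g t"
      using bl ghs gs t unfolding bounded_linear_holder_def by blast
    ultimately have "forward_integral T f g m t - L g t = L (\<lambda>u. gh u - g u) t" by simp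
    then have "ennreal \<bar>forward_integral T f g m t - L g t\<bar> \<le> holder_norm T \<beta> (L (\<lambda>u. gh u - g u))"
      using abs_le_holder_norm[OF t] by metis
    also have "\<dots> \<le> ennreal K * holder_norm T \<beta> (\<lambda>u. gh u - g u)" by (rule K[OF ds])
    also have "\<dots> \<le> ennreal (max K 0) * ennreal (2 * G * h m powr (\<gamma> - \<beta>) + G * h m powr \<gamma>)"
      using gh g by (intro mult_mono ennreal_leI holder_norm_le[OF gh(4)]) auto
    also have "\<dots> = ennreal (max K 0 * (2 * G * h m powr (\<gamma> - \<beta>) + G * h m powr \<gamma>))"
      using g by (intro ennreal_mult[symmetric]) auto
    finally show ?thesis using g by (subst (asm) ennreal_le_iff) auto
  qed
  moreover have "(\<lambda>m. max K 0 * (2 * G * h m powr (\<gamma> - \<beta>) + G * h m powr \<gamma>)) \<longlonglongrightarrow> 0"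
    unfolding h_def using \<beta>
    by (intro tendsto_mult_right_zero tendsto_add_zero tendsto_inverse_powr_0) auto
  ultimately show ?thesis by (rule LIMSEQ_abs_diff_le)
qed

lemma young_integral_eq_forward_limit:
  assumes f: "holder_with T \<alpha> F f" "0 \<le> F" and g: "holder_with T \<gamma> G g" "0 \<le> G"
    and \<alpha>: "0 < \<alpha>" "\<alpha> < 1" "1 < \<alpha> + \<gamma>" "\<gamma> < 1" and t: "t \<in> {0..T}"
  shows "young_integral T \<alpha> f g t = forward_limit T f g t"
  unfolding young_integral_def
proof (rule the_equality)
  have "0 \<le> T" using t by auto
  then show "\<exists>L. young_extension T \<alpha> f L \<and> L g t = forward_limit T f g t"
    using young_extension_forward_limit[OF f \<alpha>(1,2)] by blast
next
  fix y assume "\<exists>L. young_extension T \<alpha> f L \<and> L g t = y"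
  then obtain L where "young_extension T \<alpha> f L" "L g t = y" by blast
  then have "(\<lambda>m. forward_integral T f g m t) \<longlonglongrightarrow> y"
    using young_extension_unique[OF _ g \<alpha> t] by blast
  then show "y = forward_limit T f g t"
    using forward_integral_tendsto[OF f g \<alpha>(1-3) t] LIMSEQ_unique by blast
qed

theorem young_integral_increment:
  assumes f: "holder_with T \<alpha> F f" "0 \<le> F" and g: "holder_with T \<gamma> G g" "0 \<le> G"
    and \<alpha>: "0 < \<alpha>" "\<alpha> < 1" "1 < \<alpha> + \<gamma>" "\<gamma> < 1" and st: "0 \<le> s" "s \<le> t" "t \<le> T"
  shows "\<bar>young_integral T \<alpha> f g t - young_integral T \<alpha> f g s - f s * (g t - g s)\<bar>
    \<le> F * G / (2 powr (\<alpha> + \<gamma>) - 2) * (t - s) powr (\<alpha> + \<gamma>)"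
  using forward_limit_estimate[OF f g \<alpha>(1-3) st] young_integral_eq_forward_limit[OF f g \<alpha>] st
  by simp

lemma young_integral_0:
  assumes "holder_with T \<alpha> F f" "0 \<le> F" "holder_with T \<gamma> G g" "0 \<le> G"
    "0 < \<alpha>" "\<alpha> < 1" "1 < \<alpha> + \<gamma>" "\<gamma> < 1" "0 \<le> T"
  shows "young_integral T \<alpha> f g 0 = 0"
  using young_integral_eq_forward_limit[OF assms(1-8), of 0] assms(9) by simp

text \<open>Summing the local errors \<open>K (t/n)\<^bsup>\<theta>\<^esup>\<close> over \<open>n\<close> cells leaves \<open>O(n\<^bsup>1-\<theta>\<^esup>)\<close>. Besides the convergence itself,
  this yields measurability: Young integrals and Lebesgue integrals of the processes are almost sure limits of
  sums of finitely many random variables.\<close>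

lemma riemann_sum_tendsto:
  fixes J f g :: "real \<Rightarrow> real"
  assumes inc: "\<And>s u. 0 \<le> s \<Longrightarrow> s \<le> u \<Longrightarrow> u \<le> t \<Longrightarrow>
      \<bar>J u - J s - f s * (g u - g s)\<bar> \<le> K * (u - s) powr \<theta>"
    and "1 < \<theta>" "0 \<le> t"
  shows "(\<lambda>n. \<Sum>k<n. f (t * real k / real n) * (g (t * real (Suc k) / real n) - g (t * real k / real n)))
      \<longlonglongrightarrow> J t - J 0"
proof -
  define S where "S n = (\<Sum>k<n. f (t * real k / real n) *
    (g (t * real (Suc k) / real n) - g (t * real k / real n)))" for n
  have "\<bar>S (Suc n) - (J t - J 0)\<bar> \<le> K * t powr \<theta> * real (Suc n) powr (1 - \<theta>)" for n
  proof -
    define N where "N = real (Suc n)"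
    define p where "p k = t * real k / N" for k :: nat
    have N: "N > 0" unfolding N_def by simp
    have tele: "J t - J 0 = (\<Sum>k<Suc n. J (p (Suc k)) - J (p k))"
    proof -
      have "(\<Sum>k<Suc n. J (p (Suc k)) - J (p k)) = J (p (Suc n)) - J (p 0)"
        by (rule sum_lessThan_telescope)
      moreover have "p (Suc n) = t" "p 0 = 0" unfolding p_def N_def by simp_all
      ultimately show ?thesis by simp
    qed
    have "\<bar>S (Suc n) - (J t - J 0)\<bar>
        = \<bar>\<Sum>k<Suc n. f (p k) * (g (p (Suc k)) - g (p k)) - (J (p (Suc k)) - J (p k))\<bar>"
      unfolding S_def tele sum_subtractf N_def p_def ..
    also have "\<dots> \<le> (\<Sum>k<Suc n. \<bar>f (p k) * (g (p (Suc k)) - g (p k)) - (J (p (Suc k)) - J (p k))\<bar>)"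
      by (rule sum_abs)
    also have "\<dots> \<le> (\<Sum>k<Suc n. K * (t / N) powr \<theta>)"
    proof (rule sum_mono)
      fix k assume "k \<in> {..<Suc n}"
      then have "real (Suc k) \<le> N" unfolding N_def by auto
      then have "p (Suc k) \<le> t" unfolding p_def using N \<open>0 \<le> t\<close>
        by (simp add: divide_le_eq mult_left_mono)
      moreover have "0 \<le> p k" "p k \<le> p (Suc k)"
        unfolding p_def using N \<open>0 \<le> t\<close> by (auto simp: divide_right_mono mult_left_mono)
      moreover have "p (Suc k) - p k = t / N"
        unfolding p_def by (simp add: diff_divide_distrib[symmetric] algebra_simps)
      ultimately show "\<bar>f (p k) * (g (p (Suc k)) - g (p k)) - (J (p (Suc k)) - J (p k))\<bar> \<le> K * (t / N) powr \<theta>"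
        using inc[of "p k" "p (Suc k)"] by (simp add: abs_minus_commute)
    qed
    also have "\<dots> = N * (K * (t / N) powr \<theta>)" by (simp add: N_def)
    also have "\<dots> = K * t powr \<theta> * N powr (1 - \<theta>)"
      using N \<open>0 \<le> t\<close> by (simp add: powr_divide powr_diff)
    finally show ?thesis unfolding N_def .
  qed
  moreover have "(\<lambda>n. real n powr (1 - \<theta>)) \<longlonglongrightarrow> 0"
    using tendsto_neg_powr[OF _ filterlim_real_sequentially, of "1 - \<theta>"] \<open>1 < \<theta>\<close> by simp
  then have "(\<lambda>n. K * t powr \<theta> * real (Suc n) powr (1 - \<theta>)) \<longlonglongrightarrow> 0"
    by (intro tendsto_mult_right_zero) (rule LIMSEQ_Suc)
  ultimately have "(\<lambda>n. S (Suc n)) \<longlonglongrightarrow> J t - J 0" by (rule LIMSEQ_abs_diff_le)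
  then show ?thesis unfolding S_def[symmetric] by (rule LIMSEQ_imp_Suc)
qed

text \<open>An integral in time is a Young integral against the identity.\<close>

lemma integral_increment_estimate:
  assumes a: "holder_with T \<alpha> C a" and "0 \<le> C" "0 < \<alpha>" and st: "0 \<le> s" "s \<le> u" "u \<le> T"
  shows "\<bar>integral {0..u} a - integral {0..s} a - a s * (u - s)\<bar>
    \<le> C / (2 powr (\<alpha> + 1) - 2) * (u - s) powr (\<alpha> + 1)"
proof -
  have C1: "has_C1_derivative_on T (\<lambda>u. u) (\<lambda>u. 1)"
    unfolding has_C1_derivative_on_def by (auto intro!: derivative_eq_intros)
  have id: "holder_with T 1 1 (\<lambda>u. u)" unfolding holder_with_def by auto
  have "integral {0..s} a + integral {s..u} a = integral {0..u} a"
    using st holder_with_continuous_on[OF a \<open>0 < \<alpha>\<close>]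
    by (intro Henstock_Kurzweil_Integration.integral_combine integrable_continuous_interval)
      (auto elim: continuous_on_subset)
  then have "integral {0..u} a - integral {0..s} a = integral {s..u} (\<lambda>x. a x * 1)" by simp
  then show ?thesis using young_estimate_C1[OF a id C1 \<open>0 \<le> C\<close> _ \<open>0 < \<alpha>\<close> _ st] \<open>0 < \<alpha>\<close> by simp
qed

section \<open>Moments of centred Gaussian variables\<close>

text \<open>Expressed by the variance, the formula also covers the degenerate law.\<close>

lemma (in prob_space) centred_gaussian_even_moment:
  assumes X: "gaussian_rv M X" and E: "expectation X = 0"
  shows "integrable M (\<lambda>\<omega>. X \<omega> ^ (2 * p))" (is ?int)
    and "expectation (\<lambda>\<omega>. X \<omega> ^ (2 * p)) = fact (2 * p) / (2 ^ p * fact p) * expectation (\<lambda>\<omega>. X \<omega> ^ 2) ^ p"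
      (is ?eq)
proof -
  have meas [measurable]: "X \<in> borel_measurable M" using X unfolding gaussian_rv_def by blast
  consider (const) \<mu> where "AE \<omega> in M. X \<omega> = \<mu>"
    | (normal) \<mu> s where "0 < s" "distributed M lborel X (\<lambda>y. ennreal (normal_density \<mu> s y))"
    using X unfolding gaussian_rv_def by blast
  then have "?int \<and> ?eq"
  proof cases
    case const
    have "expectation X = expectation (\<lambda>_. \<mu>)"
      by (rule integral_cong_AE) (use const in auto)
    then have ae: "AE \<omega> in M. X \<omega> = 0" using const E by (simp add: prob_space)
    have pow: "integrable M (\<lambda>\<omega>. X \<omega> ^ q) \<and> expectation (\<lambda>\<omega>. X \<omega> ^ q) = 0 ^ q" for q
    proof -
      have "integrable M (\<lambda>\<omega>. X \<omega> ^ q) = integrable M (\<lambda>\<omega>. 0 ^ q :: real)"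
        by (rule integrable_cong_AE) (use ae in auto)
      moreover have "expectation (\<lambda>\<omega>. X \<omega> ^ q) = expectation (\<lambda>\<omega>. 0 ^ q)"
        by (rule integral_cong_AE) (use ae in auto)
      ultimately show ?thesis by (simp add: prob_space)
    qed
    show ?thesis using pow[of "2 * p"] pow[of 2] by (cases p) auto
  next
    case normal
    note d = normal(2)
    have "expectation X = \<mu>"
      using normal by (intro normal_distributed_expectation[of s]) auto
    then have \<mu>: "\<mu> = 0" using E by simp
    have moment: "integrable M (\<lambda>\<omega>. X \<omega> ^ (2 * q)) \<and>
        expectation (\<lambda>\<omega>. X \<omega> ^ (2 * q)) = fact (2 * q) / ((2 / s\<^sup>2) ^ q * fact q)" for q
    proof -
      have h: "has_bochner_integral lborel (\<lambda>x. normal_density 0 s x * x ^ (2 * q))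
          (fact (2 * q) / ((2 / s\<^sup>2) ^ q * fact q))"
        using normal_moment_even[OF normal(1), of 0 q] by simp
      have "integrable lborel (\<lambda>x. normal_density \<mu> s x * x ^ (2 * q)) = integrable M (\<lambda>\<omega>. X \<omega> ^ (2 * q))"
        by (rule distributed_integrable[OF d]) (auto simp: normal_density_nonneg)
      moreover have "(\<integral>x. normal_density \<mu> s x * x ^ (2 * q) \<partial>lborel) = expectation (\<lambda>\<omega>. X \<omega> ^ (2 * q))"
        by (rule distributed_integral[OF d]) (auto simp: normal_density_nonneg)
      ultimately show ?thesis using h unfolding \<mu> has_bochner_integral_iff by simp
    qed
    have "expectation (\<lambda>\<omega>. X \<omega> ^ 2) = s\<^sup>2" using moment[of 1] by (simp add: fact_numeral)
    then show ?thesis using moment[of p] normal(1) by (simp add: power_divide)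
  qed
  then show ?int ?eq by auto
qed

lemma (in prob_space) gaussian_rv_integrable:
  assumes X: "gaussian_rv M X"
  shows "integrable M X"
proof -
  have meas [measurable]: "X \<in> borel_measurable M" using X unfolding gaussian_rv_def by blast
  consider (const) \<mu> where "AE \<omega> in M. X \<omega> = \<mu>"
    | (normal) \<mu> s where "0 < s" "distributed M lborel X (\<lambda>y. ennreal (normal_density \<mu> s y))"
    using X unfolding gaussian_rv_def by blast
  then show ?thesis
  proof cases
    case const
    have "integrable M X = integrable M (\<lambda>\<omega>. \<mu>)"
      by (rule integrable_cong_AE) (use const in auto)
    then show ?thesis by simp
  next
    case normal
    have "integrable lborel (\<lambda>x. normal_density \<mu> s x * x) = integrable M (\<lambda>\<omega>. X \<omega>)"
      by (rule distributed_integrable[OF normal(2)]) (auto simp: normal_density_nonneg)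
    then show ?thesis using integrable_normal_moment_nz_1[OF normal(1), of \<mu>] by simp
  qed
qed

text \<open>The fourth moment formula \<open>E X\<^sup>2 Y\<^sup>2 = E X\<^sup>2 E Y\<^sup>2 + 2 (E X Y)\<^sup>2\<close> follows from the one-dimensional one by
  polarization, as \<open>12 X\<^sup>2 Y\<^sup>2 = (X + Y)\<^sup>4 + (X - Y)\<^sup>4 - 2 X\<^sup>4 - 2 Y\<^sup>4\<close>.\<close>

lemma (in prob_space) centred_gaussian_pair:
  assumes g: "gaussian_rv M X" "gaussian_rv M Y"
    "gaussian_rv M (\<lambda>\<omega>. X \<omega> + Y \<omega>)" "gaussian_rv M (\<lambda>\<omega>. X \<omega> - Y \<omega>)"
    and E: "expectation X = 0" "expectation Y = 0"
  shows "integrable M (\<lambda>\<omega>. X \<omega> * Y \<omega>)" (is ?int1)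
    and "integrable M (\<lambda>\<omega>. (X \<omega>)\<^sup>2 * (Y \<omega>)\<^sup>2)" (is ?int2)
    and "expectation (\<lambda>\<omega>. (X \<omega>)\<^sup>2 * (Y \<omega>)\<^sup>2)
      = expectation (\<lambda>\<omega>. (X \<omega>)\<^sup>2) * expectation (\<lambda>\<omega>. (Y \<omega>)\<^sup>2) + 2 * (expectation (\<lambda>\<omega>. X \<omega> * Y \<omega>))\<^sup>2"
      (is ?eq)
proof -
  note int = g[THEN gaussian_rv_integrable]
  have E': "expectation (\<lambda>\<omega>. X \<omega> + Y \<omega>) = 0" "expectation (\<lambda>\<omega>. X \<omega> - Y \<omega>) = 0"
    using int(1,2) E by simp_all
  note m = centred_gaussian_even_moment[OF g(1) E(1)] centred_gaussian_even_moment[OF g(2) E(2)]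
    centred_gaussian_even_moment[OF g(3) E'(1)] centred_gaussian_even_moment[OF g(4) E'(2)]
  note i2 = m(1,3,5,7)[of 1, simplified]
  note i4 = m(1,3,5,7)[of 2, simplified]
  have e4: "expectation (\<lambda>\<omega>. X \<omega> ^ 4) = 3 * (expectation (\<lambda>\<omega>. (X \<omega>)\<^sup>2))\<^sup>2"
    "expectation (\<lambda>\<omega>. Y \<omega> ^ 4) = 3 * (expectation (\<lambda>\<omega>. (Y \<omega>)\<^sup>2))\<^sup>2"
    "expectation (\<lambda>\<omega>. (X \<omega> + Y \<omega>) ^ 4) = 3 * (expectation (\<lambda>\<omega>. (X \<omega> + Y \<omega>)\<^sup>2))\<^sup>2"
    "expectation (\<lambda>\<omega>. (X \<omega> - Y \<omega>) ^ 4) = 3 * (expectation (\<lambda>\<omega>. (X \<omega> - Y \<omega>)\<^sup>2))\<^sup>2"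
    using m(2,4,6,8)[of 2] by (simp_all add: fact_numeral)
  have XY: "X \<omega> * Y \<omega> = ((X \<omega> + Y \<omega>)\<^sup>2 - (X \<omega> - Y \<omega>)\<^sup>2) / 4" for \<omega>
    by (simp add: power2_eq_square algebra_simps)
  have XY4: "(X \<omega>)\<^sup>2 * (Y \<omega>)\<^sup>2 = ((X \<omega> + Y \<omega>) ^ 4 + (X \<omega> - Y \<omega>) ^ 4 - 2 * X \<omega> ^ 4 - 2 * Y \<omega> ^ 4) / 12" for \<omega>
    by algebra
  show ?int1 unfolding XY using i2 by simp
  show ?int2 unfolding XY4 using i4 by simp
  have c: "expectation (\<lambda>\<omega>. X \<omega> * Y \<omega>)
      = (expectation (\<lambda>\<omega>. (X \<omega> + Y \<omega>)\<^sup>2) - expectation (\<lambda>\<omega>. (X \<omega> - Y \<omega>)\<^sup>2)) / 4"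
    unfolding XY using i2 by simp
  have "expectation (\<lambda>\<omega>. (X \<omega> + Y \<omega>)\<^sup>2) + expectation (\<lambda>\<omega>. (X \<omega> - Y \<omega>)\<^sup>2)
      = expectation (\<lambda>\<omega>. (X \<omega> + Y \<omega>)\<^sup>2 + (X \<omega> - Y \<omega>)\<^sup>2)"
    using i2 by simp
  also have "\<dots> = expectation (\<lambda>\<omega>. 2 * (X \<omega>)\<^sup>2 + 2 * (Y \<omega>)\<^sup>2)"
    by (rule arg_cong[of _ _ expectation]) (simp add: fun_eq_iff power2_eq_square algebra_simps)
  also have "\<dots> = 2 * expectation (\<lambda>\<omega>. (X \<omega>)\<^sup>2) + 2 * expectation (\<lambda>\<omega>. (Y \<omega>)\<^sup>2)"
    using i2 by simp
  finally have p: "expectation (\<lambda>\<omega>. (X \<omega> + Y \<omega>)\<^sup>2) + expectation (\<lambda>\<omega>. (X \<omega> - Y \<omega>)\<^sup>2)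
      = 2 * expectation (\<lambda>\<omega>. (X \<omega>)\<^sup>2) + 2 * expectation (\<lambda>\<omega>. (Y \<omega>)\<^sup>2)" .
  have "expectation (\<lambda>\<omega>. (X \<omega>)\<^sup>2 * (Y \<omega>)\<^sup>2) = (expectation (\<lambda>\<omega>. (X \<omega> + Y \<omega>) ^ 4)
      + expectation (\<lambda>\<omega>. (X \<omega> - Y \<omega>) ^ 4) - 2 * expectation (\<lambda>\<omega>. X \<omega> ^ 4) - 2 * expectation (\<lambda>\<omega>. Y \<omega> ^ 4)) / 12"
    unfolding XY4 using i4 by simp
  moreover have "(3 * a\<^sup>2 + 3 * b\<^sup>2 - 2 * (3 * v\<^sup>2) - 2 * (3 * w\<^sup>2)) / 12 = v * w + 2 * ((a - b) / 4)\<^sup>2"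
    if "a + b = 2 * v + 2 * w" for a b v w :: real
  proof -
    have "a = 2 * v + 2 * w - b" using that by simp
    show ?thesis unfolding \<open>a = 2 * v + 2 * w - b\<close> by (simp add: power2_eq_square field_simps)
  qed
  ultimately show ?eq unfolding e4 c using p by simp
qed

definition linear_combinations :: "'i set \<Rightarrow> ('i \<Rightarrow> 'a \<Rightarrow> real) \<Rightarrow> ('a \<Rightarrow> real) set" where
  "linear_combinations I X = {\<lambda>\<omega>. \<Sum>t\<in>J. c t * X t \<omega> | J c. finite J \<and> J \<subseteq> I}"

lemma linear_combinations_base:
  assumes "t \<in> I"
  shows "X t \<in> linear_combinations I X"
proof -
  have "X t = (\<lambda>\<omega>. \<Sum>s\<in>{t}. 1 * X s \<omega>)" by simp
  then show ?thesis unfolding linear_combinations_def using assms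
    by (intro CollectI exI[of _ "{t}"] exI[of _ "\<lambda>_. 1"]) auto
qed

lemma linear_combinations_lincomb:
  assumes "Y \<in> linear_combinations I X" "Z \<in> linear_combinations I X"
  shows "(\<lambda>\<omega>. a * Y \<omega> + b * Z \<omega>) \<in> linear_combinations I X"
proof -
  obtain J c where J: "finite J" "J \<subseteq> I" and Y: "Y = (\<lambda>\<omega>. \<Sum>t\<in>J. c t * X t \<omega>)"
    using assms(1) unfolding linear_combinations_def by blast
  obtain K d where K: "finite K" "K \<subseteq> I" and Z: "Z = (\<lambda>\<omega>. \<Sum>t\<in>K. d t * X t \<omega>)"
    using assms(2) unfolding linear_combinations_def by blast
  define e where "e t = a * (if t \<in> J then c t else 0) + b * (if t \<in> K then d t else 0)" for t
  have "Y \<omega> = (\<Sum>t\<in>J \<union> K. (if t \<in> J then c t else 0) * X t \<omega>)" for \<omega>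
    unfolding Y using J K by (intro sum.mono_neutral_cong_left) auto
  moreover have "Z \<omega> = (\<Sum>t\<in>J \<union> K. (if t \<in> K then d t else 0) * X t \<omega>)" for \<omega>
    unfolding Z using J K by (intro sum.mono_neutral_cong_left) auto
  ultimately have "a * Y \<omega> + b * Z \<omega> = (\<Sum>t\<in>J \<union> K. e t * X t \<omega>)" for \<omega>
    by (simp add: e_def sum_distrib_left sum.distrib algebra_simps)
  then show ?thesis unfolding linear_combinations_def using J K
    by (intro CollectI exI[of _ "J \<union> K"] exI[of _ e]) auto
qed

lemma linear_combinations_add:
  assumes "Y \<in> linear_combinations I X" "Z \<in> linear_combinations I X"
  shows "(\<lambda>\<omega>. Y \<omega> + Z \<omega>) \<in> linear_combinations I X"
  using linear_combinations_lincomb[OF assms, of 1 1] by simp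

lemma linear_combinations_diff:
  assumes "Y \<in> linear_combinations I X" "Z \<in> linear_combinations I X"
  shows "(\<lambda>\<omega>. Y \<omega> - Z \<omega>) \<in> linear_combinations I X"
  using linear_combinations_lincomb[OF assms, of 1 "- 1"] by simp

lemma convex_midpoint_powr:
  fixes a b p :: real
  assumes "0 \<le> a" "0 \<le> b" "1 \<le> p"
  shows "2 * ((a + b) / 2) powr p \<le> a powr p + b powr p"
proof -
  have half: "2 * (x / 2) powr p \<le> x powr p" if "0 \<le> x" for x :: real
  proof -
    have "2 powr 1 \<le> 2 powr p" using assms by (intro powr_mono) auto
    then have "2 * x powr p \<le> 2 powr p * x powr p" by (intro mult_right_mono) auto
    then show ?thesis using that by (simp add: powr_divide field_simps)
  qed
  show ?thesis
  proof (cases "a = 0 \<or> b = 0")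
    case True
    then show ?thesis using half[of a] half[of b] assms by auto
  next
    case False
    then have "((1 - 1/2) *\<^sub>R a + (1/2) *\<^sub>R b) powr p \<le> (1 - 1/2) * a powr p + (1/2) * b powr p"
      using assms by (intro convex_onD[OF powr_convex]) auto
    then show ?thesis by (simp add: add_divide_distrib)
  qed
qed

text \<open>Convexity of \<open>\<bar>x\<bar>\<^bsup>p\<^esup>\<close>. With \<open>p = 2 H\<close> this is the nonnegative correlation of the increments of fractional
  Brownian motion for \<open>H > 1/2\<close>.\<close>

lemma second_difference_abs_powr_nonneg:
  fixes x h p :: real
  assumes "1 \<le> p"
  shows "0 \<le> \<bar>x + h\<bar> powr p + \<bar>x - h\<bar> powr p - 2 * \<bar>x\<bar> powr p"
proof -
  have "\<bar>x\<bar> \<le> (\<bar>x + h\<bar> + \<bar>x - h\<bar>) / 2" by (simp add: abs_real_def)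
  then have "2 * \<bar>x\<bar> powr p \<le> 2 * ((\<bar>x + h\<bar> + \<bar>x - h\<bar>) / 2) powr p"
    using assms by (intro mult_left_mono powr_mono2) auto
  also have "\<dots> \<le> \<bar>x + h\<bar> powr p + \<bar>x - h\<bar> powr p"
    using assms by (intro convex_midpoint_powr) auto
  finally show ?thesis by simp
qed

section \<open>Increments of fractional Brownian motion\<close>

locale fbm = prob_space M for M :: "'a measure" +
  fixes T H :: real and B :: "real \<Rightarrow> 'a \<Rightarrow> real"
  assumes T_pos: "0 < T" and H_bounds: "1 / 2 < H" "H < 1"
    and fBm: "fractional_brownian_motion M T H B"
begin

lemma gaussian_combination:
  "Y \<in> linear_combinations {0..T} B \<Longrightarrow> gaussian_rv M Y"
  using fBm unfolding fractional_brownian_motion_def gaussian_process_def linear_combinations_def by blast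

lemma measurable_B [measurable]: "t \<in> {0..T} \<Longrightarrow> B t \<in> borel_measurable M"
  using gaussian_combination[OF linear_combinations_base] unfolding gaussian_rv_def by blast

lemma centred_combination:
  assumes "Y \<in> linear_combinations {0..T} B"
  shows "expectation Y = 0"
proof -
  obtain J c where J: "finite J" "J \<subseteq> {0..T}" and Y: "Y = (\<lambda>\<omega>. \<Sum>t\<in>J. c t * B t \<omega>)"
    using assms unfolding linear_combinations_def by blast
  have int: "integrable M (B t)" if "t \<in> {0..T}" for t
    by (rule gaussian_rv_integrable[OF gaussian_combination[OF linear_combinations_base[OF that]]])
  have "expectation Y = (\<Sum>t\<in>J. c t * expectation (B t))"
    unfolding Y using J int by (subst Bochner_Integration.integral_sum) auto
  also have "\<dots> = 0" using J fBm unfolding fractional_brownian_motion_def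
    by (intro sum.neutral) auto
  finally show ?thesis .
qed

lemma combination_pair:
  assumes "X \<in> linear_combinations {0..T} B" "Y \<in> linear_combinations {0..T} B"
  shows "integrable M (\<lambda>\<omega>. X \<omega> * Y \<omega>)"
    and "integrable M (\<lambda>\<omega>. (X \<omega>)\<^sup>2 * (Y \<omega>)\<^sup>2)"
    and "expectation (\<lambda>\<omega>. (X \<omega>)\<^sup>2 * (Y \<omega>)\<^sup>2)
      = expectation (\<lambda>\<omega>. (X \<omega>)\<^sup>2) * expectation (\<lambda>\<omega>. (Y \<omega>)\<^sup>2) + 2 * (expectation (\<lambda>\<omega>. X \<omega> * Y \<omega>))\<^sup>2"
  using centred_gaussian_pair[OF gaussian_combination[OF assms(1)] gaussian_combination[OF assms(2)]
      gaussian_combination[OF linear_combinations_add[OF assms]]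
      gaussian_combination[OF linear_combinations_diff[OF assms]]
      centred_combination[OF assms(1)] centred_combination[OF assms(2)]]
  by blast+

definition inc :: "real \<Rightarrow> real \<Rightarrow> 'a \<Rightarrow> real" where
  "inc s t \<omega> = B t \<omega> - B s \<omega>"

lemma inc_combination:
  assumes "s \<in> {0..T}" "t \<in> {0..T}"
  shows "inc s t \<in> linear_combinations {0..T} B"
  unfolding inc_def[abs_def] using assms by (intro linear_combinations_diff linear_combinations_base)

lemma covariance_inc:
  assumes t: "s \<in> {0..T}" "t \<in> {0..T}" "u \<in> {0..T}" "v \<in> {0..T}"
  shows "expectation (\<lambda>\<omega>. inc s t \<omega> * inc u v \<omega>)
    = (\<bar>v - s\<bar> powr (2 * H) + \<bar>t - u\<bar> powr (2 * H) - \<bar>v - t\<bar> powr (2 * H) - \<bar>u - s\<bar> powr (2 * H)) / 2"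
proof -
  have int: "integrable M (\<lambda>\<omega>. B a \<omega> * B b \<omega>)" if "a \<in> {0..T}" "b \<in> {0..T}" for a b
    using that by (intro combination_pair linear_combinations_base)
  have cov: "expectation (\<lambda>\<omega>. B a \<omega> * B b \<omega>) = (a powr (2 * H) + b powr (2 * H) - \<bar>b - a\<bar> powr (2 * H)) / 2"
    if "a \<in> {0..T}" "b \<in> {0..T}" for a b
    using fBm that unfolding fractional_brownian_motion_def by blast
  have "inc s t \<omega> * inc u v \<omega> = B t \<omega> * B v \<omega> - B t \<omega> * B u \<omega> - B s \<omega> * B v \<omega> + B s \<omega> * B u \<omega>" for \<omega>
    unfolding inc_def by (simp add: algebra_simps)
  then have "expectation (\<lambda>\<omega>. inc s t \<omega> * inc u v \<omega>) = expectation (\<lambda>\<omega>. B t \<omega> * B v \<omega>)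
      - expectation (\<lambda>\<omega>. B t \<omega> * B u \<omega>) - expectation (\<lambda>\<omega>. B s \<omega> * B v \<omega>) + expectation (\<lambda>\<omega>. B s \<omega> * B u \<omega>)"
    using int t by simp
  then show ?thesis using t by (simp add: cov abs_minus_commute field_simps)
qed

lemma variance_inc:
  assumes "s \<in> {0..T}" "t \<in> {0..T}"
  shows "expectation (\<lambda>\<omega>. (inc s t \<omega>)\<^sup>2) = \<bar>t - s\<bar> powr (2 * H)"
  using covariance_inc[OF assms assms] by (simp add: power2_eq_square abs_minus_commute)

lemma even_moment_inc:
  assumes "s \<in> {0..T}" "t \<in> {0..T}"
  shows "integrable M (\<lambda>\<omega>. inc s t \<omega> ^ (2 * p))"
    and "expectation (\<lambda>\<omega>. inc s t \<omega> ^ (2 * p)) = fact (2 * p) / (2 ^ p * fact p) * (\<bar>t - s\<bar> powr (2 * H)) ^ p"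
  using centred_gaussian_even_moment[OF gaussian_combination centred_combination, of "inc s t" p]
    inc_combination[OF assms] by (simp_all add: variance_inc[OF assms])

text \<open>The lower bound is the convexity of \<open>\<bar>x\<bar>\<^bsup>2H\<^esup>\<close>, the upper one is \<open>2 x y \<le> x\<^sup>2 + y\<^sup>2\<close>.\<close>

lemma adjacent_covariance:
  assumes h: "0 \<le> h" "real (Suc k) * h \<le> T" "real (Suc l) * h \<le> T"
  shows "0 \<le> expectation (\<lambda>\<omega>. inc (real k * h) (real (Suc k) * h) \<omega> * inc (real l * h) (real (Suc l) * h) \<omega>)"
    and "expectation (\<lambda>\<omega>. inc (real k * h) (real (Suc k) * h) \<omega> * inc (real l * h) (real (Suc l) * h) \<omega>)
      \<le> h powr (2 * H)"
proof -
  let ?I = "\<lambda>k. inc (real k * h) (real (Suc k) * h)"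
  have mem: "real m * h \<in> {0..T}" "real (Suc m) * h \<in> {0..T}" if "real (Suc m) * h \<le> T" for m
  proof -
    have "real m * h \<le> real (Suc m) * h" using h by (intro mult_right_mono) auto
    then show "real m * h \<in> {0..T}" "real (Suc m) * h \<in> {0..T}" using that h by auto
  qed
  note m = mem[OF h(2)] mem[OF h(3)]
  let ?r = "real l * h - real k * h"
  have eq: "real (Suc l) * h - real k * h = ?r + h" "\<bar>real (Suc k) * h - real l * h\<bar> = \<bar>?r - h\<bar>"
    "real (Suc l) * h - real (Suc k) * h = ?r"
    by (simp_all add: algebra_simps abs_real_def)
  have "expectation (\<lambda>\<omega>. ?I k \<omega> * ?I l \<omega>)
      = (\<bar>?r + h\<bar> powr (2 * H) + \<bar>?r - h\<bar> powr (2 * H) - 2 * \<bar>?r\<bar> powr (2 * H)) / 2"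
    unfolding covariance_inc[OF m] eq by simp
  then show "0 \<le> expectation (\<lambda>\<omega>. ?I k \<omega> * ?I l \<omega>)"
    using second_difference_abs_powr_nonneg[of "2 * H" ?r h] H_bounds by simp
  have sq: "integrable M (\<lambda>\<omega>. (?I k \<omega>)\<^sup>2)" "integrable M (\<lambda>\<omega>. (?I l \<omega>)\<^sup>2)"
    using even_moment_inc(1)[OF m(1,2), of 1] even_moment_inc(1)[OF m(3,4), of 1] by simp_all
  have "expectation (\<lambda>\<omega>. ?I k \<omega> * ?I l \<omega>) \<le> expectation (\<lambda>\<omega>. ((?I k \<omega>)\<^sup>2 + (?I l \<omega>)\<^sup>2) / 2)"
  proof (rule integral_mono)
    show "integrable M (\<lambda>\<omega>. ?I k \<omega> * ?I l \<omega>)"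
      by (rule combination_pair[OF inc_combination[OF m(1,2)] inc_combination[OF m(3,4)]])
    show "integrable M (\<lambda>\<omega>. ((?I k \<omega>)\<^sup>2 + (?I l \<omega>)\<^sup>2) / 2)" using sq by simp
    show "?I k \<omega> * ?I l \<omega> \<le> ((?I k \<omega>)\<^sup>2 + (?I l \<omega>)\<^sup>2) / 2" for \<omega>
      using sum_squares_bound[of "?I k \<omega>" "?I l \<omega>"] by simp
  qed
  also have "\<dots> = (expectation (\<lambda>\<omega>. (?I k \<omega>)\<^sup>2) + expectation (\<lambda>\<omega>. (?I l \<omega>)\<^sup>2)) / 2"
    using sq by simp
  also have "\<dots> = h powr (2 * H)"
  proof -
    have "\<bar>real (Suc m) * h - real m * h\<bar> = h" for m using h(1) by (simp add: algebra_simps)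
    then show ?thesis unfolding variance_inc[OF m(1,2)] variance_inc[OF m(3,4)] by simp
  qed
  finally show "expectation (\<lambda>\<omega>. ?I k \<omega> * ?I l \<omega>) \<le> h powr (2 * H)" .
qed

text \<open>One factor of each square is bounded by \<open>h\<^bsup>2H\<^esup>\<close>. The remaining sum of covariances is the variance of the
  total increment.\<close>

lemma sum_squared_covariance:
  assumes h: "0 \<le> h" "p \<le> q" "real q * h \<le> T"
  shows "(\<Sum>k\<in>{p..<q}. \<Sum>l\<in>{p..<q}. (expectation (\<lambda>\<omega>. inc (real k * h) (real (Suc k) * h) \<omega>
      * inc (real l * h) (real (Suc l) * h) \<omega>))\<^sup>2)
    \<le> h powr (2 * H) * (real (q - p) * h) powr (2 * H)"
proof -
  let ?I = "\<lambda>k. inc (real k * h) (real (Suc k) * h)"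
  let ?c = "\<lambda>k l. expectation (\<lambda>\<omega>. ?I k \<omega> * ?I l \<omega>)"
  have bound: "real m * h \<le> T" if "m \<le> q" for m
    using mult_right_mono[of "real m" "real q" h] that h by auto
  have mem: "real m * h \<in> {0..T}" if "m \<le> q" for m using bound[OF that] h by auto
  have cov: "0 \<le> ?c k l" "?c k l \<le> h powr (2 * H)" if "k < q" "l < q" for k l
    using adjacent_covariance[OF h(1) bound bound, of k l] that by auto
  have int: "integrable M (\<lambda>\<omega>. ?I k \<omega> * ?I l \<omega>)" if "k < q" "l < q" for k l
    using that by (intro combination_pair inc_combination mem) auto
  have "(\<Sum>k\<in>{p..<q}. \<Sum>l\<in>{p..<q}. (?c k l)\<^sup>2) \<le> (\<Sum>k\<in>{p..<q}. \<Sum>l\<in>{p..<q}. h powr (2 * H) * ?c k l)"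
    unfolding power2_eq_square using cov by (intro sum_mono mult_right_mono) auto
  also have "\<dots> = h powr (2 * H) * (\<Sum>k\<in>{p..<q}. \<Sum>l\<in>{p..<q}. ?c k l)"
    by (simp add: sum_distrib_left)
  also have "(\<Sum>k\<in>{p..<q}. \<Sum>l\<in>{p..<q}. ?c k l) = expectation (\<lambda>\<omega>. \<Sum>k\<in>{p..<q}. \<Sum>l\<in>{p..<q}. ?I k \<omega> * ?I l \<omega>)"
  proof -
    have "expectation (\<lambda>\<omega>. \<Sum>k\<in>{p..<q}. \<Sum>l\<in>{p..<q}. ?I k \<omega> * ?I l \<omega>)
        = (\<Sum>k\<in>{p..<q}. expectation (\<lambda>\<omega>. \<Sum>l\<in>{p..<q}. ?I k \<omega> * ?I l \<omega>))"
      by (rule Bochner_Integration.integral_sum, rule Bochner_Integration.integrable_sum)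
        (rule int, simp_all)
    also have "\<dots> = (\<Sum>k\<in>{p..<q}. \<Sum>l\<in>{p..<q}. ?c k l)"
      by (rule sum.cong[OF refl], rule Bochner_Integration.integral_sum) (rule int, simp_all)
    finally show ?thesis by simp
  qed
  also have "(\<lambda>\<omega>. \<Sum>k\<in>{p..<q}. \<Sum>l\<in>{p..<q}. ?I k \<omega> * ?I l \<omega>) = (\<lambda>\<omega>. (inc (real p * h) (real q * h) \<omega>)\<^sup>2)"
  proof
    fix \<omega>
    have eq: "(\<Sum>k\<in>{p..<q}. ?I k \<omega>) = inc (real p * h) (real q * h) \<omega>"
      unfolding inc_def using sum_Suc_diff'[OF h(2), of "\<lambda>k. B (real k * h) \<omega>"] by simp
    show "(\<Sum>k\<in>{p..<q}. \<Sum>l\<in>{p..<q}. ?I k \<omega> * ?I l \<omega>) = (inc (real p * h) (real q * h) \<omega>)\<^sup>2"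
      unfolding power2_eq_square eq[symmetric] sum_product ..
  qed
  also have "expectation (\<lambda>\<omega>. (inc (real p * h) (real q * h) \<omega>)\<^sup>2) = (real (q - p) * h) powr (2 * H)"
  proof -
    have "real p * h \<le> real q * h" using h by (intro mult_right_mono) auto
    then have "\<bar>real q * h - real p * h\<bar> = real (q - p) * h"
      using h by (simp add: of_nat_diff left_diff_distrib)
    then show ?thesis using variance_inc[OF mem mem, of p q] h by simp
  qed
  finally show ?thesis .
qed

end

section \<open>Hoelder continuity of the paths\<close>

lemma dyadic_floor_step:
  fixes x :: real and m :: nat
  assumes "0 \<le> x"
  shows "nat \<lfloor>2 ^ Suc m * x\<rfloor> = 2 * nat \<lfloor>2 ^ m * x\<rfloor> \<or> nat \<lfloor>2 ^ Suc m * x\<rfloor> = Suc (2 * nat \<lfloor>2 ^ m * x\<rfloor>)"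
proof -
  have "\<lfloor>2 * (2 ^ m * x)\<rfloor> = 2 * \<lfloor>2 ^ m * x\<rfloor> \<or> \<lfloor>2 * (2 ^ m * x)\<rfloor> = 2 * \<lfloor>2 ^ m * x\<rfloor> + 1"
    by linarith
  then show ?thesis using assms by (auto simp: mult.assoc nat_mult_distrib nat_add_distrib)
qed

lemma dyadic_bracket:
  fixes y :: real
  assumes "0 < y" "y \<le> 1"
  obtains m where "(1 / 2) ^ Suc m < y" "y \<le> (1 / 2) ^ m"
proof -
  obtain n where n: "(1 / 2 :: real) ^ n < y" using real_arch_pow_inv[OF assms(1), of "1 / 2"] by auto
  define k where "k = (LEAST n. (1 / 2 :: real) ^ n < y)"
  have k: "(1 / 2) ^ k < y" unfolding k_def using n by (rule LeastI)
  then have "k \<noteq> 0" using assms by (cases k) auto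
  then obtain m where m: "k = Suc m" by (cases k) auto
  have "\<not> (1 / 2) ^ m < y" using not_less_Least[of m "\<lambda>n. (1 / 2 :: real) ^ n < y"] m k_def by simp
  then show ?thesis using that k m by auto
qed

text \<open>The chaining step of the theorem of Kolmogorov and Chentsov. Each \<open>t\<close> is the limit of its dyadic
  approximations \<open>d m t\<close> from below, of which two consecutive ones are equal or adjacent in the finer grid.
  Two points at distance about \<open>T 2\<^bsup>-m\<^esup>\<close> have equal or adjacent approximations of level \<open>m\<close>.\<close>

lemma dyadic_increments_imp_holder:
  fixes f :: "real \<Rightarrow> real"
  assumes T: "0 < T" and cont: "continuous_on {0..T} f" and \<gamma>: "0 < \<gamma>" and K: "0 \<le> K"
    and dyadic: "\<And>m k. k < 2 ^ m \<Longrightarrow>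
      \<bar>f (T * real (Suc k) / 2 ^ m) - f (T * real k / 2 ^ m)\<bar> \<le> K * (2 powr (- \<gamma>)) ^ m"
  shows "\<exists>C\<ge>0. holder_with T \<gamma> C f"
proof -
  define q where "q = 2 powr (- \<gamma>)"
  have q: "0 < q" "q < 1" using \<gamma> by (auto simp: q_def powr_minus field_simps)
  \<comment> \<open>\<open>A q\<^sup>m\<close> is the geometric tail \<open>\<Sum>\<^sub>i K q\<^sup>i\<close> over \<open>i > m\<close>, a bound for the chain from level \<open>m\<close> on.\<close>
  define A where "A = K * q / (1 - q)"
  have A: "0 \<le> A" "A * (1 - q) = K * q" using q K by (auto simp: A_def)
  define i where "i m t = nat \<lfloor>2 ^ m * (t / T)\<rfloor>" for m :: nat and t
  define d where "d m t = T * real (i m t) / 2 ^ m" for m t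
  have i_le: "i m t \<le> 2 ^ m" if "t \<in> {0..T}" for m t
  proof -
    have "2 ^ m * (t / T) \<le> 2 ^ m" using that T by (auto simp: field_simps)
    then have "\<lfloor>2 ^ m * (t / T)\<rfloor> \<le> \<lfloor>real_of_int (2 ^ m)\<rfloor>" by (intro floor_mono) simp
    then have "\<lfloor>2 ^ m * (t / T)\<rfloor> \<le> 2 ^ m" unfolding floor_of_int .
    then show ?thesis unfolding i_def by (simp add: nat_le_iff)
  qed
  have d_in: "d m t \<in> {0..T}" if "t \<in> {0..T}" for m t
  proof -
    have "real (i m t) \<le> 2 ^ m" using i_le[OF that, of m] by (metis of_nat_le_iff of_nat_numeral of_nat_power)
    then show ?thesis unfolding d_def using T by (auto simp: field_simps)
  qed
  have step: "\<bar>f (d (Suc m) t) - f (d m t)\<bar> \<le> K * q ^ Suc m" if "t \<in> {0..T}" for m t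
  proof -
    have "i (Suc m) t = 2 * i m t \<or> i (Suc m) t = Suc (2 * i m t)"
      unfolding i_def by (rule dyadic_floor_step) (use that T in auto)
    then show ?thesis
    proof
      assume "i (Suc m) t = 2 * i m t"
      then have "d (Suc m) t = d m t" unfolding d_def by simp
      then show ?thesis using K q by simp
    next
      assume e: "i (Suc m) t = Suc (2 * i m t)"
      then have "2 * i m t < 2 ^ Suc m" using i_le[OF that, of "Suc m"] by simp
      from dyadic[OF this] show ?thesis unfolding d_def e q_def by simp
    qed
  qed
  have chain: "\<bar>f (d (m + j) t) - f (d m t)\<bar> \<le> A * q ^ m * (1 - q ^ j)" if "t \<in> {0..T}" for m j t
  proof (induction j)
    case (Suc j)
    have "\<bar>f (d (m + Suc j) t) - f (d m t)\<bar> \<le> K * q ^ Suc (m + j) + A * q ^ m * (1 - q ^ j)"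
      using step[OF that, of "m + j"] Suc by simp
    also have "K * q ^ Suc (m + j) = A * (1 - q) * q ^ m * q ^ j"
      unfolding A(2) by (simp add: power_add mult_ac)
    finally show ?case by (simp add: algebra_simps)
  qed simp
  have lim: "(\<lambda>m. d m t) \<longlonglongrightarrow> t" if "t \<in> {0..T}" for t
  proof (rule LIMSEQ_abs_diff_le)
    fix m
    have "0 \<le> 2 ^ m * (t / T)" using that T by auto
    then have "\<bar>real (i m t) - 2 ^ m * (t / T)\<bar> \<le> 1" unfolding i_def by linarith
    then have "T / 2 ^ m * \<bar>real (i m t) - 2 ^ m * (t / T)\<bar> \<le> T / 2 ^ m"
      using mult_left_mono[of "\<bar>real (i m t) - 2 ^ m * (t / T)\<bar>" 1 "T / 2 ^ m"] T by simp
    moreover have "d m t - t = T / 2 ^ m * (real (i m t) - 2 ^ m * (t / T))"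
      unfolding d_def using T by (simp add: field_simps)
    ultimately show "\<bar>d m t - t\<bar> \<le> T * (1 / 2) ^ m" using T by (simp add: abs_mult power_divide)
  next
    show "(\<lambda>m. T * (1 / 2) ^ m) \<longlonglongrightarrow> 0"
      by (intro tendsto_mult_right_zero LIMSEQ_realpow_zero) auto
  qed
  have tail: "\<bar>f t - f (d m t)\<bar> \<le> A * q ^ m" if "t \<in> {0..T}" for m t
  proof -
    have "(\<lambda>m. f (d m t)) \<longlonglongrightarrow> f t"
      using lim[OF that] d_in[OF that] that by (intro continuous_on_tendsto_compose[OF cont]) auto
    then have "(\<lambda>j. f (d (j + m) t)) \<longlonglongrightarrow> f t" by (rule LIMSEQ_ignore_initial_segment)
    then have "(\<lambda>j. \<bar>f (d (m + j) t) - f (d m t)\<bar>) \<longlonglongrightarrow> \<bar>f t - f (d m t)\<bar>"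
      by (intro tendsto_intros) (simp add: add.commute)
    moreover have "\<bar>f (d (m + j) t) - f (d m t)\<bar> \<le> A * q ^ m" for j
    proof -
      have "A * q ^ m * (1 - q ^ j) \<le> A * q ^ m * 1"
        using A q by (intro mult_left_mono) auto
      then show ?thesis using chain[OF that, of m j] by simp
    qed
    ultimately show ?thesis by (intro LIMSEQ_le_const2) auto
  qed
  define C where "C = (2 * A + K) * (2 / T) powr \<gamma>"
  have "holder_with T \<gamma> C f"
    unfolding holder_with_def
  proof (intro allI impI)
    fix s t assume st: "0 \<le> s \<and> s \<le> t \<and> t \<le> T"
    show "\<bar>f t - f s\<bar> \<le> C * (t - s) powr \<gamma>"
    proof (cases "s = t")
      case False
      then have y: "0 < (t - s) / T" "(t - s) / T \<le> 1" using st T by auto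
      obtain m where m: "(1 / 2) ^ Suc m < (t - s) / T" "(t - s) / T \<le> (1 / 2) ^ m"
        using dyadic_bracket[OF y] by blast
      have mem: "s \<in> {0..T}" "t \<in> {0..T}" using st by auto
      have "2 ^ m * (t / T) - 2 ^ m * (s / T) \<le> 1"
      proof -
        have "2 ^ m * (t / T) - 2 ^ m * (s / T) = 2 ^ m * ((t - s) / T)"
          by (simp add: right_diff_distrib diff_divide_distrib)
        also have "\<dots> \<le> 2 ^ m * (1 / 2) ^ m" using m(2) by (intro mult_left_mono) auto
        also have "\<dots> = 1" by (simp add: power_divide)
        finally show ?thesis .
      qed
      moreover have "2 ^ m * (s / T) \<le> 2 ^ m * (t / T)"
        using st T by (intro mult_left_mono divide_right_mono) auto
      moreover have "0 \<le> 2 ^ m * (s / T)" using st T by auto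
      ultimately have "i m t = i m s \<or> i m t = Suc (i m s)" unfolding i_def by linarith
      then have near: "\<bar>f (d m t) - f (d m s)\<bar> \<le> K * q ^ m"
      proof
        assume "i m t = i m s"
        then show ?thesis unfolding d_def using K q by simp
      next
        assume e: "i m t = Suc (i m s)"
        then have "i m s < 2 ^ m" using i_le[OF mem(2), of m] by simp
        from dyadic[OF this] show ?thesis unfolding d_def e q_def by simp
      qed
      have "\<bar>f t - f s\<bar> \<le> (2 * A + K) * q ^ m"
        using tail[OF mem(1), of m] tail[OF mem(2), of m] near by (simp add: algebra_simps)
      also have "q ^ m = ((1 / 2) ^ m) powr \<gamma>"
      proof -
        have "(1 / 2 :: real) ^ m = 2 powr (- real m)"
          by (simp add: powr_minus powr_realpow power_divide inverse_eq_divide)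
        then have "((1 / 2 :: real) ^ m) powr \<gamma> = 2 powr (- real m * \<gamma>)" by (simp only: powr_powr)
        moreover have "q ^ m = 2 powr (real m * - \<gamma>)" unfolding q_def by (rule powr_power) simp
        ultimately show ?thesis by simp
      qed
      also have "(2 * A + K) * ((1 / 2) ^ m) powr \<gamma> \<le> C * (t - s) powr \<gamma>"
      proof -
      have "(1 / 2) ^ m \<le> 2 * ((t - s) / T)" using m(1) unfolding power_Suc by linarith
      then have "(2 * A + K) * ((1 / 2) ^ m) powr \<gamma> \<le> (2 * A + K) * (2 * ((t - s) / T)) powr \<gamma>"
        using A K \<gamma> by (intro mult_left_mono powr_mono2) auto
      also have "\<dots> = C * (t - s) powr \<gamma>"
      proof -
        have "2 * ((t - s) / T) = 2 / T * (t - s)" by simp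
        moreover have "(2 / T * (t - s)) powr \<gamma> = (2 / T) powr \<gamma> * (t - s) powr \<gamma>"
          by (rule powr_mult)
        ultimately show ?thesis unfolding C_def by (simp only: mult.assoc)
      qed
      finally show ?thesis .
      qed
      finally show ?thesis .
    qed simp
  qed
  moreover have "0 \<le> C" unfolding C_def using A K by auto
  ultimately show ?thesis by blast
qed

context fbm
begin

text \<open>All dyadic increments are controlled at once by the random variable
  \<open>Z = \<Sum>\<^sub>m \<Sum>\<^sub>k (2\<^bsup>\<gamma>m\<^esup> \<bar>D m k\<bar>)\<^bsup>2p\<^esup>\<close>. Its mean is a multiple of \<open>\<Sum>\<^sub>m 2\<^bsup>m(1 - 2p(H - \<gamma>))\<^esup>\<close>, finite for large \<open>p\<close>, so
  that \<open>Z\<close> is finite almost surely, and \<open>\<bar>D m k\<bar> \<le> Z\<^bsup>1/(2p)\<^esup> 2\<^bsup>-\<gamma>m\<^esup>\<close>.\<close>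

lemma holder_paths:
  assumes \<gamma>: "0 < \<gamma>" "\<gamma> < H"
  shows "AE \<omega> in M. \<exists>C\<ge>0. holder_with T \<gamma> C (\<lambda>t. B t \<omega>)"
proof -
  obtain p :: nat where p: "1 / (H - \<gamma>) < real p" using reals_Archimedean2 by blast
  have p0: "0 < p" using p \<gamma> by (cases p) (auto simp: divide_less_0_iff)
  have p1: "1 < real p * (H - \<gamma>)" using p \<gamma> by (simp add: divide_less_eq)
  define D where "D m k \<omega> = inc (T * real k / 2 ^ m) (T * real (Suc k) / 2 ^ m) \<omega>" for m k :: nat and \<omega>
  define c :: real where "c = fact (2 * p) / (2 ^ p * fact p) * T powr (2 * H * real p)"
  have c: "0 \<le> c" unfolding c_def by simp
  define r :: real where "r = 2 powr (1 - 2 * (real p * (H - \<gamma>)))"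
  have r: "0 < r" "r < 1" using p1 by (auto simp: r_def powr_less_one)
  define w where "w m = 2 powr (2 * real p * \<gamma> * real m)" for m :: nat
  define Z where "Z \<omega> = (\<Sum>m. \<Sum>k<2^m. ennreal (w m * D m k \<omega> ^ (2 * p)))" for \<omega>
  have mem: "T * real k / 2 ^ m \<in> {0..T}" if "k \<le> 2 ^ m" for m k :: nat
  proof -
    have "real k \<le> 2 ^ m" using that by (metis of_nat_le_iff of_nat_numeral of_nat_power)
    then show ?thesis using T_pos by (auto simp: field_simps)
  qed
  have D_int: "integrable M (\<lambda>\<omega>. D m k \<omega> ^ (2 * p))"
    and D_exp: "expectation (\<lambda>\<omega>. w m * D m k \<omega> ^ (2 * p)) = c * (r / 2) ^ m" if "k < 2 ^ m" for m k
  proof -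
    have k: "T * real k / 2 ^ m \<in> {0..T}" "T * real (Suc k) / 2 ^ m \<in> {0..T}"
      using mem[of k m] mem[of "Suc k" m] that by simp_all
    show "integrable M (\<lambda>\<omega>. D m k \<omega> ^ (2 * p))" unfolding D_def by (rule even_moment_inc(1)[OF k])
    have "T * real (Suc k) / 2 ^ m - T * real k / 2 ^ m = T / 2 ^ m"
      by (simp add: diff_divide_distrib[symmetric] algebra_simps)
    then have "expectation (\<lambda>\<omega>. w m * D m k \<omega> ^ (2 * p))
        = w m * (fact (2 * p) / (2 ^ p * fact p) * ((T / 2 ^ m) powr (2 * H)) ^ p)"
      unfolding D_def using T_pos even_moment_inc(2)[OF k, of p] by simp
    also have "((T / 2 ^ m) powr (2 * H)) ^ p = T powr (2 * H * real p) * 2 powr (- (2 * H * real p * real m))"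
    proof -
      have "T / 2 ^ m = T * 2 powr (- real m)"
        by (simp add: powr_minus divide_inverse powr_realpow)
      moreover have "((T / 2 ^ m) powr (2 * H)) ^ p = (T / 2 ^ m) powr (2 * H * real p)"
        using T_pos by (simp add: powr_power mult_ac)
      ultimately show ?thesis
        using T_pos by (simp add: powr_mult powr_powr mult_ac)
    qed
    also have "w m * (fact (2 * p) / (2 ^ p * fact p) * \<dots>) = c * (2 powr (2 * real p * \<gamma> * real m) * 2 powr (- (2 * H * real p * real m)))"
      unfolding w_def c_def by simp
    also have "2 powr (2 * real p * \<gamma> * real m) * 2 powr (- (2 * H * real p * real m)) = (2 powr (- 2 * (real p * (H - \<gamma>)))) ^ m"
      by (simp add: powr_power algebra_simps flip: powr_add)
    also have "2 powr (- 2 * (real p * (H - \<gamma>))) = r / 2"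
    proof -
      have "r = 2 powr (1 + (- 2 * (real p * (H - \<gamma>))))" unfolding r_def by simp
      then show ?thesis unfolding powr_add by simp
    qed
    finally show "expectation (\<lambda>\<omega>. w m * D m k \<omega> ^ (2 * p)) = c * (r / 2) ^ m" .
  qed
  have D_meas [measurable]: "D m k \<in> borel_measurable M" if "k < 2 ^ m" for m k
    unfolding D_def[abs_def] inc_def using that mem[of k m] mem[of "Suc k" m]
    by (intro borel_measurable_diff measurable_B) auto
  have term_meas: "(\<lambda>\<omega>. \<Sum>k<2^m. ennreal (w m * D m k \<omega> ^ (2 * p))) \<in> borel_measurable M" for m
    using D_meas by (intro borel_measurable_sum) auto
  have Z_meas: "Z \<in> borel_measurable M" unfolding Z_def[abs_def] using term_meas by measurable
  have "(\<integral>\<^sup>+\<omega>. Z \<omega> \<partial>M) = (\<Sum>m. \<integral>\<^sup>+\<omega>. (\<Sum>k<2^m. ennreal (w m * D m k \<omega> ^ (2 * p))) \<partial>M)"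
    unfolding Z_def by (rule nn_integral_suminf[OF term_meas])
  also have "\<dots> = (\<Sum>m. ennreal (c * r ^ m))"
  proof (rule suminf_cong)
    fix m
    have "(\<integral>\<^sup>+\<omega>. (\<Sum>k<2^m. ennreal (w m * D m k \<omega> ^ (2 * p))) \<partial>M)
        = (\<Sum>k<2^m. \<integral>\<^sup>+\<omega>. ennreal (w m * D m k \<omega> ^ (2 * p)) \<partial>M)"
      using D_meas by (intro nn_integral_sum) auto
    also have "\<dots> = (\<Sum>k<(2::nat)^m. ennreal (c * (r / 2) ^ m))"
    proof (rule sum.cong[OF refl])
      fix k :: nat assume "k \<in> {..<2 ^ m}"
      then have k: "k < 2 ^ m" by simp
      have "(\<integral>\<^sup>+\<omega>. ennreal (w m * D m k \<omega> ^ (2 * p)) \<partial>M) = ennreal (expectation (\<lambda>\<omega>. w m * D m k \<omega> ^ (2 * p)))"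
        using D_int[OF k] by (intro nn_integral_eq_integral) (auto simp: w_def power_mult)
      then show "(\<integral>\<^sup>+\<omega>. ennreal (w m * D m k \<omega> ^ (2 * p)) \<partial>M) = ennreal (c * (r / 2) ^ m)"
        unfolding D_exp[OF k] .
    qed
    also have "\<dots> = ennreal (\<Sum>k<(2::nat)^m. c * (r / 2) ^ m)" using c r by (intro sum_ennreal) auto
    also have "(\<Sum>k<(2::nat)^m. c * (r / 2) ^ m) = c * r ^ m" by (simp add: power_divide)
    finally show "(\<integral>\<^sup>+\<omega>. (\<Sum>k<2^m. ennreal (w m * D m k \<omega> ^ (2 * p))) \<partial>M) = ennreal (c * r ^ m)" .
  qed
  also have "\<dots> = ennreal (\<Sum>m. c * r ^ m)"
    using c r by (intro suminf_ennreal2 summable_mult summable_geometric) auto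
  finally have "(\<integral>\<^sup>+\<omega>. Z \<omega> \<partial>M) \<noteq> \<infinity>" by simp
  then have "AE \<omega> in M. Z \<omega> \<noteq> \<infinity>" using nn_integral_PInf_AE[OF Z_meas] by blast
  moreover have "AE \<omega> in M. continuous_on {0..T} (\<lambda>t. B t \<omega>)"
    using fBm unfolding fractional_brownian_motion_def by blast
  ultimately show ?thesis
  proof eventually_elim
    case (elim \<omega>)
    define z where "z = enn2real (Z \<omega>)"
    have z: "0 \<le> z" "ennreal z = Z \<omega>" using elim(1) unfolding z_def by (auto simp: less_top)
    have single: "w m * D m k \<omega> ^ (2 * p) \<le> z" if "k < 2 ^ m" for m k
    proof -
      have "ennreal (w m * D m k \<omega> ^ (2 * p)) \<le> (\<Sum>k<2^m. ennreal (w m * D m k \<omega> ^ (2 * p)))"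
        using that by (intro member_le_sum) auto
      also have "\<dots> \<le> Z \<omega>"
        unfolding Z_def using sum_le_suminf[OF summableI, of "{m}"] by simp
      finally show ?thesis unfolding z(2)[symmetric] using z(1) by (simp add: ennreal_le_iff)
    qed
    have "\<bar>D m k \<omega>\<bar> \<le> root (2 * p) z * (2 powr (- \<gamma>)) ^ m" if "k < 2 ^ m" for m k
    proof -
      have wm: "w m = (inverse ((2 powr (- \<gamma>)) ^ m)) ^ (2 * p)"
      proof -
        have "(2 powr (- \<gamma>)) ^ m = 2 powr (real m * - \<gamma>)" by (rule powr_power) simp
        then have "inverse ((2 powr (- \<gamma>)) ^ m) = 2 powr (real m * \<gamma>)" by (simp add: powr_minus)
        moreover have "(2 powr (real m * \<gamma>)) ^ (2 * p) = 2 powr (real (2 * p) * (real m * \<gamma>))"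
          by (rule powr_power) simp
        ultimately show ?thesis unfolding w_def by (simp add: mult_ac)
      qed
      have "(\<bar>D m k \<omega>\<bar> * inverse ((2 powr (- \<gamma>)) ^ m)) ^ (2 * p) \<le> z"
        using single[OF that] unfolding wm power_mult_distrib by (simp add: power_even_abs mult.commute)
      then have "root (2 * p) ((\<bar>D m k \<omega>\<bar> * inverse ((2 powr (- \<gamma>)) ^ m)) ^ (2 * p)) \<le> root (2 * p) z"
        using p0 by (intro real_root_le_mono) auto
      then have "\<bar>D m k \<omega>\<bar> * inverse ((2 powr (- \<gamma>)) ^ m) \<le> root (2 * p) z"
        using p0 by (subst (asm) real_root_power_cancel) auto
      then show ?thesis by (simp add: field_simps)
    qed
    then show ?case
      unfolding D_def inc_def
      using p0 z by (intro dyadic_increments_imp_holder[OF T_pos elim(2) \<gamma>(1), of "root (2 * p) z"]) auto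
  qed
qed

end

section \<open>Fluctuations of products of increments\<close>

locale fbm_plane = prob_space M for M :: "'a measure" +
  fixes T H :: real and B :: "2 \<Rightarrow> real \<Rightarrow> 'a \<Rightarrow> real"
  assumes T_pos: "0 < T" and H_bounds: "1 / 2 < H" "H < 1"
    and fBm2: "fractional_brownian_motion_2d M T H B"

sublocale fbm_plane \<subseteq> comp: fbm M T H "B j" for j
  using T_pos H_bounds fBm2 unfolding fractional_brownian_motion_2d_def
  by unfold_locales auto

context fbm_plane
begin

abbreviation cell :: "2 \<Rightarrow> real \<Rightarrow> nat \<Rightarrow> 'a \<Rightarrow> real" where
  "cell j h k \<equiv> comp.inc j (real k * h) (real (Suc k) * h)"

abbreviation cell_cov :: "real \<Rightarrow> nat \<Rightarrow> nat \<Rightarrow> real" where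
  "cell_cov h k l \<equiv> expectation (\<lambda>\<omega>. cell 1 h k \<omega> * cell 1 h l \<omega>)"

definition fluctuation :: "2 \<Rightarrow> 2 \<Rightarrow> real \<Rightarrow> nat \<Rightarrow> 'a \<Rightarrow> real" where
  "fluctuation j l h k \<omega> = cell j h k \<omega> * cell l h k \<omega> - (if j = l then h powr (2 * H) else 0)"

lemma cell_mem:
  assumes "0 \<le> h" "real (Suc k) * h \<le> T"
  shows "real k * h \<in> {0..T}" "real (Suc k) * h \<in> {0..T}"
proof -
  have "real k * h \<le> real (Suc k) * h" using assms by (intro mult_right_mono) auto
  then show "real k * h \<in> {0..T}" "real (Suc k) * h \<in> {0..T}" using assms by auto
qed

lemma cell_cov_eq:
  assumes "0 \<le> h" "real (Suc k) * h \<le> T" "real (Suc m) * h \<le> T"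
  shows "expectation (\<lambda>\<omega>. cell j h k \<omega> * cell j h m \<omega>) = cell_cov h k m"
  using assms by (simp only: comp.covariance_inc cell_mem)

lemma cell_variance:
  assumes "0 \<le> h" "real (Suc k) * h \<le> T"
  shows "expectation (\<lambda>\<omega>. (cell j h k \<omega>)\<^sup>2) = h powr (2 * H)"
proof -
  have "\<bar>real (Suc k) * h - real k * h\<bar> = h" using assms(1) by (simp add: algebra_simps)
  then show ?thesis using comp.variance_inc[OF cell_mem[OF assms], of j] by simp
qed

lemma cell_square_integrable:
  assumes "0 \<le> h" "real (Suc k) * h \<le> T"
  shows "integrable M (\<lambda>\<omega>. (cell j h k \<omega>)\<^sup>2)"
  using comp.even_moment_inc(1)[OF cell_mem[OF assms], of j 1] by simp

lemma cell_combination: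
  assumes "0 \<le> h" "real (Suc k) * h \<le> T"
  shows "cell j h k \<in> linear_combinations {0..T} (B j)"
  by (rule comp.inc_combination[OF cell_mem[OF assms]])

lemma cell_measurable:
  assumes "0 \<le> h" "real (Suc k) * h \<le> T"
  shows "cell j h k \<in> borel_measurable M"
  using comp.gaussian_combination[OF cell_combination[OF assms]] unfolding gaussian_rv_def by blast

lemma independent_components:
  assumes "0 \<le> h" "real (Suc k) * h \<le> T" "real (Suc m) * h \<le> T"
  shows "integrable M (\<lambda>\<omega>. (cell 1 h k \<omega> * cell 1 h m \<omega>) * (cell 2 h k \<omega> * cell 2 h m \<omega>))"
    and "expectation (\<lambda>\<omega>. (cell 1 h k \<omega> * cell 1 h m \<omega>) * (cell 2 h k \<omega> * cell 2 h m \<omega>))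
      = (cell_cov h k m)\<^sup>2"
proof -
  note mem = cell_mem[OF assms(1,2)] cell_mem[OF assms(1,3)]
  \<comment> \<open>The same functional of the path for both components, so that independence of the paths applies.\<close>
  define D :: "(real \<Rightarrow> real) \<Rightarrow> real" where "D p = (p (real (Suc k) * h) - p (real k * h)) * (p (real (Suc m) * h) - p (real m * h))" for p
  have D_meas: "D \<in> borel_measurable (Pi\<^sub>M {0..T} (\<lambda>t. borel))"
  proof -
    have coord: "(\<lambda>p. p u) \<in> borel_measurable (Pi\<^sub>M {0..T} (\<lambda>t. borel))" if "u \<in> {0..T}" for u :: real
      using that by (rule measurable_component_singleton)
    note [measurable] = mem[THEN coord]
    show ?thesis unfolding D_def[abs_def] by measurable
  qed
  have indep: "indep_vars (\<lambda>j. borel) (\<lambda>j \<omega>. D (\<lambda>t\<in>{0..T}. B j t \<omega>)) (UNIV :: 2 set)"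
  proof (rule indep_vars_compose2[where Y = "\<lambda>_. D"])
    show "indep_vars (\<lambda>j. Pi\<^sub>M {0..T} (\<lambda>t. borel)) (\<lambda>j \<omega>. \<lambda>t\<in>{0..T}. B j t \<omega>) UNIV"
      using fBm2 unfolding fractional_brownian_motion_2d_def by (rule conjunct2)
    show "D \<in> borel_measurable (Pi\<^sub>M {0..T} (\<lambda>t. borel))" by (rule D_meas)
  qed
  have eq: "D (\<lambda>t\<in>{0..T}. B j t \<omega>) = cell j h k \<omega> * cell j h m \<omega>" for j \<omega>
    unfolding D_def comp.inc_def using mem by simp
  have int: "integrable M (\<lambda>\<omega>. cell j h k \<omega> * cell j h m \<omega>)" for j
    by (rule comp.combination_pair[OF cell_combination cell_combination]) (use assms in auto)
  note i = indep_vars_integrable[OF _ indep] indep_vars_lebesgue_integral[OF _ indep]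
  show "integrable M (\<lambda>\<omega>. (cell 1 h k \<omega> * cell 1 h m \<omega>) * (cell 2 h k \<omega> * cell 2 h m \<omega>))"
    using i(1)[unfolded eq UNIV_2] int by (simp del: of_nat_Suc)
  have "expectation (\<lambda>\<omega>. (cell 1 h k \<omega> * cell 1 h m \<omega>) * (cell 2 h k \<omega> * cell 2 h m \<omega>))
      = cell_cov h k m * expectation (\<lambda>\<omega>. cell 2 h k \<omega> * cell 2 h m \<omega>)"
    using i(2)[unfolded eq UNIV_2] int by (simp del: of_nat_Suc)
  then show "expectation (\<lambda>\<omega>. (cell 1 h k \<omega> * cell 1 h m \<omega>) * (cell 2 h k \<omega> * cell 2 h m \<omega>))
      = (cell_cov h k m)\<^sup>2"
    unfolding cell_cov_eq[OF assms, of 2] power2_eq_square .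
qed

text \<open>For \<open>j = l\<close> this is the Gaussian fourth moment formula, with equality. For \<open>j \<noteq> l\<close> the factors from the two
  components are independent and each contributes \<open>cell_cov h k m\<close>.\<close>

lemma fluctuation_covariance:
  assumes h: "0 \<le> h" "real (Suc k) * h \<le> T" "real (Suc m) * h \<le> T"
  shows "integrable M (\<lambda>\<omega>. fluctuation j l h k \<omega> * fluctuation j l h m \<omega>)"
    and "expectation (\<lambda>\<omega>. fluctuation j l h k \<omega> * fluctuation j l h m \<omega>) \<le> 2 * (cell_cov h k m)\<^sup>2"
proof -
  have "integrable M (\<lambda>\<omega>. fluctuation j l h k \<omega> * fluctuation j l h m \<omega>) \<and>
    expectation (\<lambda>\<omega>. fluctuation j l h k \<omega> * fluctuation j l h m \<omega>) \<le> 2 * (cell_cov h k m)\<^sup>2"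
  proof (cases "j = l")
    case True
    let ?v = "h powr (2 * H)"
    have eq: "fluctuation j l h k \<omega> * fluctuation j l h m \<omega>
        = (cell j h k \<omega>)\<^sup>2 * (cell j h m \<omega>)\<^sup>2 - ?v * (cell j h k \<omega>)\<^sup>2 - ?v * (cell j h m \<omega>)\<^sup>2 + ?v\<^sup>2" for \<omega>
      unfolding fluctuation_def True by (simp add: power2_eq_square algebra_simps)
    note pair = comp.combination_pair[OF cell_combination[OF h(1,2)] cell_combination[OF h(1,3)], of j]
    note sq = cell_square_integrable[OF h(1,2), of j] cell_square_integrable[OF h(1,3), of j]
    have "expectation (\<lambda>\<omega>. fluctuation j l h k \<omega> * fluctuation j l h m \<omega>)
        = (?v * ?v + 2 * (cell_cov h k m)\<^sup>2) - ?v * ?v - ?v * ?v + ?v\<^sup>2"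
      unfolding eq using pair(2) sq
      by (simp add: pair(3) cell_variance[OF h(1,2)] cell_variance[OF h(1,3)] cell_cov_eq[OF h, of j]
          prob_space del: of_nat_Suc)
    then show ?thesis unfolding eq using pair(2) sq by (simp add: power2_eq_square)
  next
    case False
    then have jl: "j = 1 \<and> l = 2 \<or> j = 2 \<and> l = 1" using exhaust_2[of j] exhaust_2[of l] by auto
    then have eq: "fluctuation j l h k \<omega> * fluctuation j l h m \<omega>
        = (cell 1 h k \<omega> * cell 1 h m \<omega>) * (cell 2 h k \<omega> * cell 2 h m \<omega>)" for \<omega>
      unfolding fluctuation_def using False by (auto simp: mult_ac)
    show ?thesis unfolding eq using independent_components[OF h] by simp
  qed
  then show "integrable M (\<lambda>\<omega>. fluctuation j l h k \<omega> * fluctuation j l h m \<omega>)"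
    and "expectation (\<lambda>\<omega>. fluctuation j l h k \<omega> * fluctuation j l h m \<omega>) \<le> 2 * (cell_cov h k m)\<^sup>2"
    by blast+
qed

lemma fluctuation_measurable:
  assumes "0 \<le> h" "real (Suc k) * h \<le> T"
  shows "fluctuation j l h k \<in> borel_measurable M"
  unfolding fluctuation_def[abs_def] using cell_measurable[OF assms] by measurable

lemma fluctuation_integrable:
  assumes "0 \<le> h" "real (Suc k) * h \<le> T"
  shows "integrable M (fluctuation j l h k)"
proof (rule square_integrable_imp_integrable[OF fluctuation_measurable[OF assms]])
  show "integrable M (\<lambda>\<omega>. (fluctuation j l h k \<omega>)\<^sup>2)"
    using fluctuation_covariance(1)[OF assms assms(2), of j l] unfolding power2_eq_square .
qed

lemma fluctuation_abs_expectation: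
  assumes h: "0 \<le> h" "real (Suc k) * h \<le> T"
  shows "expectation (\<lambda>\<omega>. \<bar>fluctuation j l h k \<omega>\<bar>) \<le> 2 * h powr (2 * H)"
proof -
  note sq = cell_square_integrable[OF h]
  have "expectation (\<lambda>\<omega>. \<bar>fluctuation j l h k \<omega>\<bar>)
      \<le> expectation (\<lambda>\<omega>. ((cell j h k \<omega>)\<^sup>2 + (cell l h k \<omega>)\<^sup>2) / 2 + h powr (2 * H))"
  proof (rule integral_mono)
    show "integrable M (\<lambda>\<omega>. \<bar>fluctuation j l h k \<omega>\<bar>)"
      using fluctuation_integrable[OF h] by auto
    show "integrable M (\<lambda>\<omega>. ((cell j h k \<omega>)\<^sup>2 + (cell l h k \<omega>)\<^sup>2) / 2 + h powr (2 * H))"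
      using sq[of j] sq[of l] by (simp del: of_nat_Suc)
    fix \<omega>
    have "\<bar>fluctuation j l h k \<omega>\<bar> \<le> \<bar>cell j h k \<omega>\<bar> * \<bar>cell l h k \<omega>\<bar> + h powr (2 * H)"
      unfolding fluctuation_def abs_mult[symmetric]
      by (rule order_trans[OF abs_triangle_ineq4]) (auto simp del: of_nat_Suc)
    also have "\<bar>cell j h k \<omega>\<bar> * \<bar>cell l h k \<omega>\<bar> \<le> ((cell j h k \<omega>)\<^sup>2 + (cell l h k \<omega>)\<^sup>2) / 2"
    proof -
      have "u * v \<le> (u\<^sup>2 + v\<^sup>2) / 2" for u v :: real
        using sum_squares_bound[of u v] by simp
      from this[of "\<bar>cell j h k \<omega>\<bar>" "\<bar>cell l h k \<omega>\<bar>"] show ?thesis unfolding power2_abs .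
    qed
    finally show "\<bar>fluctuation j l h k \<omega>\<bar>
      \<le> ((cell j h k \<omega>)\<^sup>2 + (cell l h k \<omega>)\<^sup>2) / 2 + h powr (2 * H)" by simp
  qed
  also have "\<dots> = 2 * h powr (2 * H)"
    using sq[of j] sq[of l] by (simp add: cell_variance[OF h] prob_space del: of_nat_Suc)
  finally show ?thesis .
qed

text \<open>By \<open>fluctuation_covariance\<close> and \<open>sum_squared_covariance\<close> the second moment of the block is at most \<open>2 h\<^bsup>4H\<^esup> (q - p)\<^bsup>2H\<^esup>\<close>. The factor
  \<open>2\<close> in the bound for the first moment stands for \<open>\<surd>2\<close>.\<close>

lemma fluctuation_block:
  assumes h: "0 \<le> h" "p \<le> q" "real q * h \<le> T"
  shows "expectation (\<lambda>\<omega>. \<bar>\<Sum>k\<in>{p..<q}. fluctuation j l h k \<omega>\<bar>) \<le> 2 * h powr (2 * H) * real (q - p) powr H"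
proof -
  have bound: "real (Suc k) * h \<le> T" if "k < q" for k
    using mult_right_mono[of "real (Suc k)" "real q" h] that h by linarith
  let ?S = "\<lambda>\<omega>. \<Sum>k\<in>{p..<q}. fluctuation j l h k \<omega>"
  have sq: "(?S \<omega>)\<^sup>2 = (\<Sum>k\<in>{p..<q}. \<Sum>m\<in>{p..<q}. fluctuation j l h k \<omega> * fluctuation j l h m \<omega>)" for \<omega>
    unfolding power2_eq_square sum_product ..
  have int: "integrable M (\<lambda>\<omega>. fluctuation j l h k \<omega> * fluctuation j l h m \<omega>)" if "k < q" "m < q" for k m
    using fluctuation_covariance(1)[OF h(1) bound bound] that by blast
  have int2: "integrable M (\<lambda>\<omega>. (?S \<omega>)\<^sup>2)"
    unfolding sq using int by (intro Bochner_Integration.integrable_sum) auto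
  have "expectation (\<lambda>\<omega>. (?S \<omega>)\<^sup>2)
      = (\<Sum>k\<in>{p..<q}. expectation (\<lambda>\<omega>. \<Sum>m\<in>{p..<q}. fluctuation j l h k \<omega> * fluctuation j l h m \<omega>))"
    unfolding sq by (rule Bochner_Integration.integral_sum, rule Bochner_Integration.integrable_sum)
        (rule int, simp_all)
  also have "\<dots> = (\<Sum>k\<in>{p..<q}. \<Sum>m\<in>{p..<q}. expectation (\<lambda>\<omega>. fluctuation j l h k \<omega> * fluctuation j l h m \<omega>))"
    by (rule sum.cong[OF refl], rule Bochner_Integration.integral_sum) (rule int, simp_all)
  also have "\<dots> \<le> (\<Sum>k\<in>{p..<q}. \<Sum>m\<in>{p..<q}. 2 * (cell_cov h k m)\<^sup>2)"
    by (intro sum_mono fluctuation_covariance(2)[OF h(1) bound bound]) auto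
  also have "\<dots> = 2 * (\<Sum>k\<in>{p..<q}. \<Sum>m\<in>{p..<q}. (cell_cov h k m)\<^sup>2)"
    by (simp only: sum_distrib_left)
  also have "\<dots> \<le> 2 * (h powr (2 * H) * (real (q - p) * h) powr (2 * H))"
    using comp.sum_squared_covariance[OF h, of 1] by (intro mult_left_mono) auto
  also have "\<dots> = 2 * (h powr (2 * H) * real (q - p) powr H)\<^sup>2"
  proof -
    have "real (q - p) powr (2 * H) = (real (q - p) powr H)\<^sup>2"
      unfolding mult_2 powr_add power2_eq_square ..
    then show ?thesis unfolding powr_mult by (simp only: power_mult_distrib power2_eq_square mult_ac)
  qed
  also have "\<dots> \<le> (2 * h powr (2 * H) * real (q - p) powr H)\<^sup>2"
    by (simp add: power_mult_distrib)
  finally have second: "expectation (\<lambda>\<omega>. (?S \<omega>)\<^sup>2) \<le> (2 * h powr (2 * H) * real (q - p) powr H)\<^sup>2" .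
  have meas: "?S \<in> borel_measurable M"
    using fluctuation_measurable[OF h(1) bound] by (intro borel_measurable_sum) auto
  have int1: "integrable M ?S" by (rule square_integrable_imp_integrable[OF meas int2])
  \<comment> \<open>Nonnegativity of the variance is the Cauchy-Schwarz bound for the first absolute moment.\<close>
  have "0 \<le> variance (\<lambda>\<omega>. \<bar>?S \<omega>\<bar>)" by simp
  also have "variance (\<lambda>\<omega>. \<bar>?S \<omega>\<bar>) = expectation (\<lambda>\<omega>. \<bar>?S \<omega>\<bar>\<^sup>2) - (expectation (\<lambda>\<omega>. \<bar>?S \<omega>\<bar>))\<^sup>2"
    using int1 int2 by (intro variance_eq) auto
  finally have "(expectation (\<lambda>\<omega>. \<bar>?S \<omega>\<bar>))\<^sup>2 \<le> (2 * h powr (2 * H) * real (q - p) powr H)\<^sup>2"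
    using second unfolding power2_abs by linarith
  then show ?thesis by (rule power2_le_imp_le) auto
qed

text \<open>The cells \<open>0, \<dots>, N - 1\<close> are cut into blocks of length \<open>b\<close>. The last block may be shorter or empty, so that the
  number \<open>N div b + 1\<close> of blocks is correct in all cases.\<close>

definition block_error :: "2 \<Rightarrow> 2 \<Rightarrow> real \<Rightarrow> nat \<Rightarrow> nat \<Rightarrow> 'a \<Rightarrow> real" where
  "block_error j l h N b \<omega> = (\<Sum>i<Suc (N div b). \<bar>\<Sum>k\<in>{i * b..<min (i * b + b) N}. fluctuation j l h k \<omega>\<bar>)"

lemma block_error_integrable:
  assumes h: "0 \<le> h" "real N * h \<le> T"
  shows "integrable M (block_error j l h N b)"
proof -
  have bound: "real (Suc k) * h \<le> T" if "k < N" for k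
    using mult_right_mono[of "real (Suc k)" "real N" h] that h by linarith
  show ?thesis unfolding block_error_def[abs_def]
    using fluctuation_integrable[OF h(1) bound]
    by (intro Bochner_Integration.integrable_sum integrable_abs) auto
qed

lemma block_error_expectation:
  assumes h: "0 \<le> h" "real N * h \<le> T" and b: "0 < b"
  shows "expectation (block_error j l h N b) \<le> (real N / real b + 1) * (2 * h powr (2 * H) * real b powr H)"
proof -
  have bound: "real (Suc k) * h \<le> T" if "k < N" for k
    using mult_right_mono[of "real (Suc k)" "real N" h] that h by linarith
  let ?S = "\<lambda>i \<omega>. \<Sum>k\<in>{i * b..<min (i * b + b) N}. fluctuation j l h k \<omega>"
  have int: "integrable M (\<lambda>\<omega>. \<bar>?S i \<omega>\<bar>)" for i
    using fluctuation_integrable[OF h(1) bound]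
    by (intro Bochner_Integration.integrable_sum integrable_abs) auto
  have one: "expectation (\<lambda>\<omega>. \<bar>?S i \<omega>\<bar>) \<le> 2 * h powr (2 * H) * real b powr H" for i
  proof (cases "i * b \<le> N")
    case True
    then have le: "i * b \<le> min (i * b + b) N" by simp
    have "real (min (i * b + b) N) * h \<le> real N * h" using h by (intro mult_right_mono) auto
    then have T: "real (min (i * b + b) N) * h \<le> T" using h by linarith
    have "expectation (\<lambda>\<omega>. \<bar>?S i \<omega>\<bar>) \<le> 2 * h powr (2 * H) * real (min (i * b + b) N - i * b) powr H"
      by (rule fluctuation_block[OF h(1) le T])
    also have "\<dots> \<le> 2 * h powr (2 * H) * real b powr H"
      using H_bounds by (intro mult_left_mono powr_mono2) auto
    finally show ?thesis .
  qed simp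
  have "expectation (block_error j l h N b) = (\<Sum>i<Suc (N div b). expectation (\<lambda>\<omega>. \<bar>?S i \<omega>\<bar>))"
    unfolding block_error_def[abs_def] by (rule Bochner_Integration.integral_sum) (rule int)
  also have "\<dots> \<le> (\<Sum>i<Suc (N div b). 2 * h powr (2 * H) * real b powr H)" by (intro sum_mono one)
  also have "\<dots> = real (Suc (N div b)) * (2 * h powr (2 * H) * real b powr H)" by simp
  also have "\<dots> \<le> (real N / real b + 1) * (2 * h powr (2 * H) * real b powr H)"
    using of_nat_div_le_of_nat[of N b] by (intro mult_right_mono) auto
  finally show ?thesis .
qed

text \<open>On each block the weight is replaced by its value at the first cell. The replacement costs its oscillation
  \<open>F (b h)\<^bsup>\<alpha>\<^esup>\<close> against the absolute fluctuations, and the constant weights leave the block sums. As this holds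
  for each \<open>\<omega>\<close> separately, the weight may be random and anticipating.\<close>

lemma weighted_fluctuations:
  assumes a: "holder_with T \<alpha> F a" "\<And>u. u \<in> {0..T} \<Longrightarrow> \<bar>a u\<bar> \<le> A" and "0 \<le> F" "0 < \<alpha>"
    and h: "0 \<le> h" "real N * h \<le> T" and b: "0 < b"
  shows "\<bar>\<Sum>k<N. a (real k * h) * fluctuation j l h k \<omega>\<bar>
    \<le> F * (real b * h) powr \<alpha> * (\<Sum>k<N. \<bar>fluctuation j l h k \<omega>\<bar>) + A * block_error j l h N b \<omega>"
proof -
  have mem: "real k * h \<in> {0..T}" if "k \<le> N" for k
    using mult_right_mono[of "real k" "real N" h] that h by auto
  have A: "0 \<le> A" using a(2)[of 0] T_pos by auto
  let ?u = "\<lambda>k. fluctuation j l h k \<omega>"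
  let ?n = "Suc (N div b)"
  have cover: "N \<le> ?n * b"
    using b by (metis add.commute dividend_less_div_times less_imp_le mult_Suc)
  have blocks: "(\<Sum>k<N. c k) = (\<Sum>i<?n. \<Sum>k\<in>{i * b..<min (i * b + b) N}. c k)" for c :: "nat \<Rightarrow> real"
  proof -
    have "(\<Sum>k<N. c k) = (\<Sum>k<?n * b. if k < N then c k else 0)"
      using cover by (intro sum.mono_neutral_cong_left) auto
    also have "\<dots> = (\<Sum>i<?n. \<Sum>k\<in>{i * b..<i * b + b}. if k < N then c k else 0)"
      by (rule sum.nat_group[symmetric])
    also have "\<dots> = (\<Sum>i<?n. \<Sum>k\<in>{i * b..<min (i * b + b) N}. c k)"
      by (intro sum.cong[OF refl] sum.mono_neutral_cong_right) auto
    finally show ?thesis .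
  qed
  \<comment> \<open>The first cell of block \<open>i\<close>. The minimum keeps the sampling point inside \<open>[0,T]\<close> when block \<open>i\<close> is empty.\<close>
  define p where "p i = min (i * b) N" for i
  have block: "\<bar>\<Sum>k\<in>{i * b..<min (i * b + b) N}. a (real k * h) * ?u k\<bar>
      \<le> F * (real b * h) powr \<alpha> * (\<Sum>k\<in>{i * b..<min (i * b + b) N}. \<bar>?u k\<bar>)
        + A * \<bar>\<Sum>k\<in>{i * b..<min (i * b + b) N}. ?u k\<bar>" for i
  proof -
    let ?K = "{i * b..<min (i * b + b) N}"
    let ?a0 = "a (real (p i) * h)"
    have "(\<Sum>k\<in>?K. a (real k * h) * ?u k) = (\<Sum>k\<in>?K. (a (real k * h) - ?a0) * ?u k) + ?a0 * (\<Sum>k\<in>?K. ?u k)"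
      by (simp add: sum_distrib_left sum.distrib[symmetric] algebra_simps)
    moreover have "\<bar>\<Sum>k\<in>?K. (a (real k * h) - ?a0) * ?u k\<bar> \<le> F * (real b * h) powr \<alpha> * (\<Sum>k\<in>?K. \<bar>?u k\<bar>)"
    proof -
      have "\<bar>\<Sum>k\<in>?K. (a (real k * h) - ?a0) * ?u k\<bar> \<le> (\<Sum>k\<in>?K. \<bar>(a (real k * h) - ?a0) * ?u k\<bar>)" by (rule sum_abs)
      also have "\<dots> \<le> (\<Sum>k\<in>?K. F * (real b * h) powr \<alpha> * \<bar>?u k\<bar>)"
      proof (rule sum_mono)
        fix k assume k: "k \<in> ?K"
        then have pk: "p i = i * b" "k \<le> N" "p i \<le> k" "k - p i \<le> b" unfolding p_def by auto
        have "\<bar>a (real k * h) - ?a0\<bar> \<le> F * (real k * h - real (p i) * h) powr \<alpha>"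
        proof (rule holder_withD[OF a(1)])
          show "real (p i) * h \<le> real k * h"
            using pk(3) h by (intro mult_right_mono of_nat_mono)
          show "0 \<le> real (p i) * h" "real k * h \<le> T" using h mem[OF pk(2)] by auto
        qed
        also have "real k * h - real (p i) * h = real (k - p i) * h"
          using pk by (simp add: of_nat_diff left_diff_distrib)
        also have "F * (real (k - p i) * h) powr \<alpha> \<le> F * (real b * h) powr \<alpha>"
          using of_nat_mono[OF pk(4), where ?'a = real] h \<open>0 \<le> F\<close> \<open>0 < \<alpha>\<close>
          by (intro mult_left_mono powr_mono2 mult_right_mono) simp_all
        finally show "\<bar>(a (real k * h) - ?a0) * ?u k\<bar> \<le> F * (real b * h) powr \<alpha> * \<bar>?u k\<bar>"
          unfolding abs_mult by (intro mult_right_mono) auto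
      qed
      finally show ?thesis by (simp add: sum_distrib_left)
    qed
    moreover have "\<bar>?a0 * (\<Sum>k\<in>?K. ?u k)\<bar> \<le> A * \<bar>\<Sum>k\<in>?K. ?u k\<bar>"
      unfolding abs_mult by (intro mult_right_mono a(2) mem) (auto simp: p_def)
    ultimately show ?thesis by linarith
  qed
  have "\<bar>\<Sum>k<N. a (real k * h) * ?u k\<bar>
      \<le> (\<Sum>i<?n. \<bar>\<Sum>k\<in>{i * b..<min (i * b + b) N}. a (real k * h) * ?u k\<bar>)"
    unfolding blocks by (rule sum_abs)
  also have "\<dots> \<le> (\<Sum>i<?n. F * (real b * h) powr \<alpha> * (\<Sum>k\<in>{i * b..<min (i * b + b) N}. \<bar>?u k\<bar>)
        + A * \<bar>\<Sum>k\<in>{i * b..<min (i * b + b) N}. ?u k\<bar>)"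
    by (intro sum_mono block)
  also have "\<dots> = F * (real b * h) powr \<alpha> * (\<Sum>k<N. \<bar>?u k\<bar>) + A * block_error j l h N b \<omega>"
    unfolding blocks block_error_def sum.distrib by (simp only: sum_distrib_left)
  finally show ?thesis .
qed

end

section \<open>Convergence in probability from a dominating rate\<close>

lemma (in complete_measure) borel_measurable_AE_eq:
  fixes f g :: "'a \<Rightarrow> real"
  assumes f: "f \<in> borel_measurable M" and ae: "AE \<omega> in M. f \<omega> = g \<omega>"
  shows "g \<in> borel_measurable M"
proof (rule measurableI)
  fix A :: "real set" assume A: "A \<in> sets borel"
  show "g -` A \<inter> space M \<in> sets M"
  proof (rule in_sets_AE)
    show "AE \<omega> in M. \<omega> \<in> f -` A \<inter> space M \<longleftrightarrow> \<omega> \<in> g -` A \<inter> space M" using ae by auto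
    show "f -` A \<inter> space M \<in> sets M" using f A by (rule measurable_sets)
  qed simp
qed simp

lemma (in complete_measure) borel_measurable_AE_limit:
  fixes f :: "nat \<Rightarrow> 'a \<Rightarrow> real"
  assumes f: "\<And>n. f n \<in> borel_measurable M" and lim: "AE \<omega> in M. (\<lambda>n. f n \<omega>) \<longlonglongrightarrow> g \<omega>"
  shows "g \<in> borel_measurable M"
proof (rule borel_measurable_AE_eq)
  show "(\<lambda>\<omega>. lim (\<lambda>n. f n \<omega>)) \<in> borel_measurable M" using f by (rule borel_measurable_lim_metric)
  show "AE \<omega> in M. lim (\<lambda>n. f n \<omega>) = g \<omega>" using lim by eventually_elim (rule limI)
qed

lemma (in prob_space) AE_tendsto_imp_prob_tendsto_0:
  fixes Y :: "nat \<Rightarrow> 'a \<Rightarrow> real"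
  assumes meas: "\<And>n. Y n \<in> borel_measurable M" "Z \<in> borel_measurable M"
    and lim: "AE \<omega> in M. (\<lambda>n. Y n \<omega>) \<longlonglongrightarrow> Z \<omega>" and "0 < \<epsilon>"
  shows "(\<lambda>n. prob {\<omega> \<in> space M. \<bar>Y n \<omega> - Z \<omega>\<bar> > \<epsilon>}) \<longlonglongrightarrow> 0"
proof -
  note [measurable] = meas
  let ?E = "\<lambda>n. {\<omega> \<in> space M. \<bar>Y n \<omega> - Z \<omega>\<bar> > \<epsilon>}"
  have "(\<lambda>n. expectation (indicator (?E n))) \<longlonglongrightarrow> expectation (\<lambda>\<omega>. 0 :: real)"
  proof (rule integral_dominated_convergence[where w = "\<lambda>_. 1"])
    show "AE \<omega> in M. (\<lambda>n. indicator (?E n) \<omega> :: real) \<longlonglongrightarrow> 0"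
      using lim
    proof eventually_elim
      case (elim \<omega>)
      have "\<forall>\<^sub>F n in sequentially. \<bar>Y n \<omega> - Z \<omega>\<bar> < \<epsilon>"
        using elim \<open>0 < \<epsilon>\<close> unfolding tendsto_iff dist_real_def by blast
      then show ?case by (intro tendsto_eventually) (auto elim!: eventually_mono)
    qed
    show "AE \<omega> in M. norm (indicator (?E n) \<omega> :: real) \<le> 1" for n
      by (auto simp: indicator_def)
  qed simp_all
  then show ?thesis by simp
qed

text \<open>Every subsequence has a further subsequence along which \<open>Q\<close>, and then \<open>Y - Z\<close>, tends to \<open>0\<close> almost surely.
  The argument by subsequences allows \<open>C\<close> to depend on \<open>\<omega>\<close> without a measurable choice. The index \<open>0\<close>, where the
  mesh \<open>1/n\<close> is meaningless, is left out.\<close>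

lemma (in prob_space) converges_in_probability_if_dominated:
  fixes Y Q :: "nat \<Rightarrow> 'a \<Rightarrow> real"
  assumes meas: "\<And>n. Y n \<in> borel_measurable M" "Z \<in> borel_measurable M"
    and Q: "\<And>n. integrable M (Q n)" "(\<lambda>n. expectation (\<lambda>\<omega>. \<bar>Q n \<omega>\<bar>)) \<longlonglongrightarrow> 0"
    and dom: "AE \<omega> in M. \<exists>C. \<forall>n>0. \<bar>Y n \<omega> - Z \<omega>\<bar> \<le> C * Q n \<omega>"
  shows "converges_in_probability M Y Z"
  unfolding converges_in_probability_def
proof (intro conjI allI impI meas)
  fix \<epsilon> :: real assume "0 < \<epsilon>"
  let ?p = "\<lambda>n. prob {\<omega> \<in> space M. \<bar>Y n \<omega> - Z \<omega>\<bar> > \<epsilon>}"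
  show "?p \<longlonglongrightarrow> 0"
  proof (rule ccontr)
    assume "\<not> ?p \<longlonglongrightarrow> 0"
    then obtain d where d: "0 < d" "\<not> (\<forall>\<^sub>F n in sequentially. ?p n < d)"
      unfolding tendsto_iff by (auto simp: dist_real_def)
    define p where "p = ?p"
    have "infinite {n. \<not> p n < d}"
      using d(2) unfolding p_def cofinite_eq_sequentially[symmetric] eventually_cofinite .
    from infinite_enumerate[OF this]
    obtain r :: "nat \<Rightarrow> nat" where r: "strict_mono r" "\<And>n. \<not> p (r n) < d" by auto
    have "(\<lambda>n. expectation (\<lambda>\<omega>. norm (Q (r n) \<omega>))) \<longlonglongrightarrow> 0"
      using LIMSEQ_subseq_LIMSEQ[OF Q(2) r(1)] by (simp add: comp_def)
    then obtain s :: "nat \<Rightarrow> nat" where s: "strict_mono s" "AE \<omega> in M. (\<lambda>n. Q (r (s n)) \<omega>) \<longlonglongrightarrow> 0"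
      using tendsto_L1_AE_subseq[of M "\<lambda>n. Q (r n)"] Q(1) by blast
    have "AE \<omega> in M. (\<lambda>n. Y (r (s (Suc n))) \<omega>) \<longlonglongrightarrow> Z \<omega>"
      using s(2) dom
    proof eventually_elim
      case (elim \<omega>)
      obtain C where C: "\<And>n. n > 0 \<Longrightarrow> \<bar>Y n \<omega> - Z \<omega>\<bar> \<le> C * Q n \<omega>" using elim(2) by blast
      have pos: "r (s (Suc n)) > 0" for n
        using seq_suble[OF strict_mono_o[OF r(1) s(1)], of "Suc n"] by simp
      have "(\<lambda>n. Q (r (s (Suc n))) \<omega>) \<longlonglongrightarrow> 0" using elim(1) by (rule LIMSEQ_Suc)
      then have "(\<lambda>n. C * Q (r (s (Suc n))) \<omega>) \<longlonglongrightarrow> 0" by (rule tendsto_mult_right_zero)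
      then show ?case by (rule LIMSEQ_abs_diff_le[rotated]) (rule C[OF pos])
    qed
    then have "(\<lambda>n. ?p (r (s (Suc n)))) \<longlonglongrightarrow> 0"
      by (rule AE_tendsto_imp_prob_tendsto_0[OF meas(1) meas(2) _ \<open>0 < \<epsilon>\<close>])
    then have "\<forall>\<^sub>F n in sequentially. ?p (r (s (Suc n))) < d"
      using d(1) by (rule order_tendstoD(2))
    then have "\<forall>\<^sub>F n in sequentially. p (r (s (Suc n))) < d" unfolding p_def .
    then show False using r(2) by (simp add: eventually_False)
  qed
qed

section \<open>Rate of the cross-variation\<close>

lemma product_perturbation:
  fixes x1 x2 m1 m2 m r :: real
  assumes "\<bar>x1 - m1\<bar> \<le> r" "\<bar>x2 - m2\<bar> \<le> r" "\<bar>m1\<bar> \<le> m" "\<bar>m2\<bar> \<le> m"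
  shows "\<bar>x1 * x2 - m1 * m2\<bar> \<le> 2 * m * r + r * r"
proof -
  have "0 \<le> r" "0 \<le> m" using assms by linarith+
  then have "\<bar>(x1 - m1) * (x2 - m2)\<bar> \<le> r * r" "\<bar>m1 * (x2 - m2)\<bar> \<le> m * r" "\<bar>(x1 - m1) * m2\<bar> \<le> r * m"
    unfolding abs_mult using assms by (intro mult_mono; simp)+
  moreover have "x1 * x2 - m1 * m2 = (x1 - m1) * (x2 - m2) + m1 * (x2 - m2) + (x1 - m1) * m2"
    by (simp add: algebra_simps)
  moreover have "2 * m * r + r * r = r * r + m * r + r * m" by simp
  ultimately show ?thesis by linarith
qed

text \<open>The grid of mesh \<open>h\<close> stops at \<open>N h\<close>, up to one cell short of \<open>t\<close>. The incomplete cell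
  contributes the summand \<open>A h\<close>, and the \<open>1\<close> in \<open>t + 1\<close>.\<close>

lemma left_riemann_sum_error:
  assumes S: "holder_with T \<alpha> C S" and A: "\<And>u. u \<in> {0..T} \<Longrightarrow> \<bar>S u\<bar> \<le> A" and "0 \<le> C" "0 < \<alpha>"
    and h: "0 < h" "h \<le> 1" and t: "real N * h \<le> t" "t \<le> real N * h + h" "t \<le> T"
  shows "\<bar>(\<Sum>k<N. h * S (real k * h)) - integral {0..t} S\<bar>
    \<le> (t + 1) * (C / (2 powr (\<alpha> + 1) - 2)) * h powr \<alpha> + A * h"
proof -
  define c where "c = C / (2 powr (\<alpha> + 1) - 2)"
  have c: "0 \<le> c" using powr_less_mono[of 1 "\<alpha> + 1" 2] assms by (simp add: c_def)
  define J where "J u = integral {0..u} S" for u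
  have inc: "\<bar>J v - J u - S u * (v - u)\<bar> \<le> c * h powr \<alpha> * h" if "0 \<le> u" "u \<le> v" "v \<le> u + h" "v \<le> T" for u v
  proof -
    have "\<bar>J v - J u - S u * (v - u)\<bar> \<le> c * (v - u) powr (\<alpha> + 1)"
      unfolding J_def c_def by (rule integral_increment_estimate[OF S]) (use that assms in auto)
    also have "\<dots> \<le> c * h powr (\<alpha> + 1)" using that c assms by (intro mult_left_mono powr_mono2) auto
    finally show ?thesis using h by (simp add: powr_add)
  qed
  have node: "0 \<le> real k * h" "real k * h \<le> t" if "k \<le> N" for k
  proof -
    have "real k * h \<le> real N * h" using that h by (intro mult_right_mono) auto
    then show "real k * h \<le> t" using t by linarith
    show "0 \<le> real k * h" using h by simp
  qed
  have "J (real N * h) = (\<Sum>k<N. J (real (Suc k) * h) - J (real k * h))"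
    using sum_lessThan_telescope[of "\<lambda>k. J (real k * h)" N] by (simp add: J_def)
  then have "\<bar>(\<Sum>k<N. h * S (real k * h)) - J (real N * h)\<bar>
      = \<bar>\<Sum>k<N. h * S (real k * h) - (J (real (Suc k) * h) - J (real k * h))\<bar>"
    by (simp only: sum_subtractf)
  also have "\<dots> \<le> (\<Sum>k<N. \<bar>h * S (real k * h) - (J (real (Suc k) * h) - J (real k * h))\<bar>)" by (rule sum_abs)
  also have "\<dots> \<le> (\<Sum>k<N. c * h powr \<alpha> * h)"
  proof (rule sum_mono)
    fix k assume "k \<in> {..<N}"
    then have k: "k \<le> N" "Suc k \<le> N" by auto
    have d: "real (Suc k) * h - real k * h = h" by (simp add: algebra_simps)
    then have "\<bar>J (real (Suc k) * h) - J (real k * h) - S (real k * h) * h\<bar> \<le> c * h powr \<alpha> * h"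
      using inc[of "real k * h" "real (Suc k) * h"] node[OF k(1)] node[OF k(2)] h t by simp
    then show "\<bar>h * S (real k * h) - (J (real (Suc k) * h) - J (real k * h))\<bar> \<le> c * h powr \<alpha> * h"
      by (simp add: abs_minus_commute mult.commute)
  qed
  also have "\<dots> = c * h powr \<alpha> * (real N * h)" by simp
  also have "\<dots> \<le> c * h powr \<alpha> * t" using c t by (intro mult_left_mono) auto
  finally have 1: "\<bar>(\<Sum>k<N. h * S (real k * h)) - J (real N * h)\<bar> \<le> c * h powr \<alpha> * t" .
  have N: "0 \<le> real N * h" "real N * h \<le> T" using node[of N] t by auto
  have "\<bar>J t - J (real N * h) - S (real N * h) * (t - real N * h)\<bar> \<le> c * h powr \<alpha> * h"
    using N t by (intro inc) auto
  also have "\<dots> \<le> c * h powr \<alpha> * 1" using c h by (intro mult_left_mono) auto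
  finally have 2: "\<bar>J t - J (real N * h) - S (real N * h) * (t - real N * h)\<bar> \<le> c * h powr \<alpha>" by simp
  have "\<bar>S (real N * h) * (t - real N * h)\<bar> \<le> A * h"
    unfolding abs_mult using N t A[of "real N * h"] h by (intro mult_mono) auto
  with 1 2 have "\<bar>(\<Sum>k<N. h * S (real k * h)) - J t\<bar> \<le> c * h powr \<alpha> * t + c * h powr \<alpha> + A * h" by linarith
  then show ?thesis unfolding J_def c_def[symmetric] by (simp add: algebra_simps)
qed

lemma tendsto_powr_zero:
  fixes f :: "nat \<Rightarrow> real"
  assumes "f \<longlonglongrightarrow> 0" "\<And>n. 0 \<le> f n" "0 < p"
  shows "(\<lambda>n. f n powr p) \<longlonglongrightarrow> 0"
proof -
  have "(\<lambda>n. f n powr p) \<longlonglongrightarrow> 0 powr p"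
    using assms by (intro tendsto_powr' tendsto_const) auto
  then show ?thesis by simp
qed

context fbm_plane
begin

text \<open>Any length tending to infinity more slowly than \<open>n\<close> would do.\<close>

definition block_length :: "nat \<Rightarrow> nat" where
  "block_length n = nat \<lceil>sqrt (real n)\<rceil>"

text \<open>A bound, up to a constant, for \<open>n\<^bsup>2H-1\<^esup>\<close> times a weighted sum of fluctuations on the grid of mesh \<open>1/n\<close>, for
  \<open>\<alpha>\<close>-Hoelder weights.\<close>

definition fluctuation_size :: "real \<Rightarrow> real \<Rightarrow> nat \<Rightarrow> 2 \<Rightarrow> 2 \<Rightarrow> 'a \<Rightarrow> real" where
  "fluctuation_size \<alpha> t n j l \<omega> = real n powr (2 * H - 1) *
     ((real (block_length n) * (1 / real n)) powr \<alpha> * (\<Sum>k<nat \<lfloor>real n * t\<rfloor>. \<bar>fluctuation j l (1 / real n) k \<omega>\<bar>)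
      + block_error j l (1 / real n) (nat \<lfloor>real n * t\<rfloor>) (block_length n) \<omega>)"

lemma fluctuation_size_nonneg: "0 \<le> fluctuation_size \<alpha> t n j l \<omega>"
  unfolding fluctuation_size_def block_error_def
  by (intro mult_nonneg_nonneg add_nonneg_nonneg sum_nonneg) auto

lemma grid_le:
  assumes "t \<in> {0..T}" "0 < n"
  shows "real (nat \<lfloor>real n * t\<rfloor>) * (1 / real n) \<le> t" "t \<le> real (nat \<lfloor>real n * t\<rfloor>) * (1 / real n) + 1 / real n"
proof -
  have "0 \<le> real n * t" using assms by auto
  then have "real (nat \<lfloor>real n * t\<rfloor>) \<le> real n * t" "real n * t \<le> real (nat \<lfloor>real n * t\<rfloor>) + 1" by linarith+
  then show "real (nat \<lfloor>real n * t\<rfloor>) * (1 / real n) \<le> t" "t \<le> real (nat \<lfloor>real n * t\<rfloor>) * (1 / real n) + 1 / real n"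
    using assms by (auto simp: field_simps)
qed

text \<open>Each fluctuation has \<open>L\<^sup>1\<close> norm at most \<open>2 h\<^bsup>2H\<^esup>\<close> and each of the at most \<open>t/(b h) + 1\<close> blocks at most
  \<open>2 h\<^bsup>2H\<^esup> b\<^bsup>H\<^esup>\<close>, while \<open>n\<^bsup>2H-1\<^esup> h\<^bsup>2H\<^esup> = h\<close>. Both contributions are then estimated by \<open>\<surd>n \<le> b \<le> 2 \<surd>n\<close>.\<close>

lemma fluctuation_size_expectation:
  assumes t: "t \<in> {0..T}" and n: "0 < n" and \<alpha>: "0 < \<alpha>"
  shows "integrable M (fluctuation_size \<alpha> t n j l)"
    and "expectation (fluctuation_size \<alpha> t n j l)
      \<le> 2 * (t * (2 * sqrt (1 / real n)) powr \<alpha> + t * sqrt (1 / real n) powr (1 - H) + 2 * sqrt (1 / real n))"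
proof -
  define h where "h = 1 / real n"
  define N where "N = nat \<lfloor>real n * t\<rfloor>"
  define b where "b = block_length n"
  have h: "0 < h" "h \<le> 1" using n by (auto simp: h_def)
  have Nt: "real N * h \<le> t" using grid_le[OF t n] by (simp add: h_def N_def)
  then have NT: "real N * h \<le> T" using t by auto
  have bound: "real (Suc k) * h \<le> T" if "k < N" for k
    using mult_right_mono[of "real (Suc k)" "real N" h] that h NT by linarith
  have sqn: "1 \<le> sqrt (real n)" using n by simp
  have b: "sqrt (real n) \<le> real b" "real b \<le> 2 * sqrt (real n)"
    unfolding b_def block_length_def using sqn by linarith+
  have b0: "0 < b" using b sqn by (cases b) auto
  have e: "sqrt h = 1 / sqrt (real n)" "h * sqrt (real n) = sqrt h"
    unfolding h_def using n by (simp_all add: real_sqrt_divide real_div_sqrt field_simps)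
  have hb: "h * real b \<le> 2 * sqrt h"
  proof -
    have "h * real b \<le> h * (2 * sqrt (real n))" using b(2) h by (intro mult_left_mono) auto
    also have "\<dots> = 2 * (h * sqrt (real n))" by simp
    finally show ?thesis unfolding e(2) .
  qed
  note int = fluctuation_integrable[OF less_imp_le[OF h(1)] bound, of _ j l]
  have int1: "integrable M (\<lambda>\<omega>. \<Sum>k<N. \<bar>fluctuation j l h k \<omega>\<bar>)"
    using int by (intro Bochner_Integration.integrable_sum integrable_abs) auto
  have int2: "integrable M (block_error j l h N b)"
    by (rule block_error_integrable) (use h NT in auto)
  have eq: "fluctuation_size \<alpha> t n j l = (\<lambda>\<omega>. real n powr (2 * H - 1) *
     ((real b * h) powr \<alpha> * (\<Sum>k<N. \<bar>fluctuation j l h k \<omega>\<bar>) + block_error j l h N b \<omega>))"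
    unfolding fluctuation_size_def[abs_def] h_def N_def b_def ..
  show "integrable M (fluctuation_size \<alpha> t n j l)" unfolding eq using int1 int2 by simp
  have "expectation (\<lambda>\<omega>. \<Sum>k<N. \<bar>fluctuation j l h k \<omega>\<bar>) = (\<Sum>k<N. expectation (\<lambda>\<omega>. \<bar>fluctuation j l h k \<omega>\<bar>))"
    using int by (intro Bochner_Integration.integral_sum integrable_abs) auto
  also have "\<dots> \<le> (\<Sum>k<N. 2 * h powr (2 * H))"
    using h bound by (intro sum_mono fluctuation_abs_expectation) auto
  finally have E1: "expectation (\<lambda>\<omega>. \<Sum>k<N. \<bar>fluctuation j l h k \<omega>\<bar>) \<le> real N * (2 * h powr (2 * H))" by simp
  have E2: "expectation (block_error j l h N b) \<le> (real N / real b + 1) * (2 * h powr (2 * H) * real b powr H)"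
    by (rule block_error_expectation) (use h NT b0 in auto)
  have scale: "real n powr (2 * H - 1) * h powr (2 * H) = h"
  proof -
    have "real n powr (2 * H - 1) = h powr (1 - 2 * H)"
      unfolding h_def using n by (simp add: powr_divide powr_diff field_simps)
    then show ?thesis using h by (simp flip: powr_add)
  qed
  have "expectation (fluctuation_size \<alpha> t n j l) = real n powr (2 * H - 1) *
     ((real b * h) powr \<alpha> * expectation (\<lambda>\<omega>. \<Sum>k<N. \<bar>fluctuation j l h k \<omega>\<bar>) + expectation (block_error j l h N b))"
    unfolding eq using int1 int2 by simp
  also have "\<dots> \<le> real n powr (2 * H - 1) * ((real b * h) powr \<alpha> * (real N * (2 * h powr (2 * H)))
      + (real N / real b + 1) * (2 * h powr (2 * H) * real b powr H))"
    using E1 E2 by (intro mult_left_mono add_mono) auto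
  also have "\<dots> = 2 * (real n powr (2 * H - 1) * h powr (2 * H)) *
      (real N * (real b * h) powr \<alpha> + (real N / real b + 1) * real b powr H)"
    by (simp only: algebra_simps)
  also have "\<dots> = 2 * ((real N * h) * (h * real b) powr \<alpha> + (real N * h) * (real b powr H / real b) + h * real b powr H)"
    unfolding scale by (simp add: algebra_simps)
  also have "\<dots> \<le> 2 * (t * (2 * sqrt h) powr \<alpha> + t * sqrt h powr (1 - H) + 2 * sqrt h)"
  proof -
    have 1: "(h * real b) powr \<alpha> \<le> (2 * sqrt h) powr \<alpha>" using hb h \<alpha> by (intro powr_mono2) auto
    have "real b powr H / real b = (1 / real b) powr (1 - H)"
      using b0 by (simp add: powr_divide powr_diff)
    also have "\<dots> \<le> sqrt h powr (1 - H)"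
      unfolding e(1) using b(1) sqn H_bounds by (intro powr_mono2 frac_le) simp_all
    finally have 2: "real b powr H / real b \<le> sqrt h powr (1 - H)" .
    have "real b powr H \<le> real b powr 1" using b0 H_bounds by (intro powr_mono) auto
    then have "h * real b powr H \<le> h * real b" using h b0 by (intro mult_left_mono) auto
    then have 3: "h * real b powr H \<le> 2 * sqrt h" using hb by linarith
    have 4: "(real N * h) * (h * real b) powr \<alpha> \<le> t * (2 * sqrt h) powr \<alpha>"
      using Nt 1 h t by (intro mult_mono) auto
    have 5: "(real N * h) * (real b powr H / real b) \<le> t * sqrt h powr (1 - H)"
      using Nt 2 h t by (intro mult_mono) auto
    show ?thesis by (rule mult_left_mono[OF add_mono[OF add_mono[OF 4 5] 3]]) simp
  qed
  finally show "expectation (fluctuation_size \<alpha> t n j l)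
      \<le> 2 * (t * (2 * sqrt (1 / real n)) powr \<alpha> + t * sqrt (1 / real n) powr (1 - H) + 2 * sqrt (1 / real n))"
    unfolding h_def .
qed

lemma fluctuation_size_tendsto:
  assumes t: "t \<in> {0..T}" and \<alpha>: "0 < \<alpha>"
  shows "(\<lambda>n. expectation (fluctuation_size \<alpha> t n j l)) \<longlonglongrightarrow> 0"
proof (rule tendsto_sandwich[OF _ _ tendsto_const])
  let ?e = "\<lambda>n. sqrt (1 / real n)"
  let ?r = "\<lambda>n. 2 * (t * (2 * ?e n) powr \<alpha> + t * ?e n powr (1 - H) + 2 * ?e n)"
  have e: "?e \<longlonglongrightarrow> 0" using tendsto_real_sqrt[OF lim_1_over_n] by simp
  show "?r \<longlonglongrightarrow> 0"
    using H_bounds by (intro tendsto_mult_right_zero tendsto_add_zero tendsto_powr_zero e \<alpha>) auto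
  show "\<forall>\<^sub>F n in sequentially. expectation (fluctuation_size \<alpha> t n j l) \<le> ?r n"
    using eventually_gt_at_top[of 0] by eventually_elim (rule fluctuation_size_expectation(2)[OF t _ \<alpha>])
  show "\<forall>\<^sub>F n in sequentially. 0 \<le> expectation (fluctuation_size \<alpha> t n j l)"
    by (intro always_eventually allI Bochner_Integration.integral_nonneg fluctuation_size_nonneg)
qed

end

context fbm_plane
begin

text \<open>The four sources of error: the fluctuations, the replacement of Young increments by left-point products, the
  Riemann sum of the limit integral, and the incomplete last cell.\<close>

definition approximation_rate :: "real \<Rightarrow> real \<Rightarrow> real \<Rightarrow> nat \<Rightarrow> 'a \<Rightarrow> real" where
  "approximation_rate \<alpha> \<gamma> t n \<omega> = (\<Sum>j\<in>UNIV. \<Sum>l\<in>UNIV. fluctuation_size \<alpha> t n j l \<omega>)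
     + (1 / real n) powr (\<alpha> + 2 * \<gamma> - 2 * H) + (1 / real n) powr \<alpha> + 1 / real n"

lemma scaled_fluctuations:
  assumes a: "holder_with T \<alpha> (2 * (K * K)) a" "\<And>u. u \<in> {0..T} \<Longrightarrow> \<bar>a u\<bar> \<le> K * K" and \<alpha>: "0 < \<alpha>"
    and t: "t \<in> {0..T}" and n: "0 < n"
  shows "\<bar>real n powr (2 * H - 1) *
      (\<Sum>k<nat \<lfloor>real n * t\<rfloor>. a (real k * (1 / real n)) * fluctuation j l (1 / real n) k \<omega>)\<bar>
    \<le> 2 * (K * K) * fluctuation_size \<alpha> t n j l \<omega>"
proof -
  define h where "h = 1 / real n"
  define N where "N = nat \<lfloor>real n * t\<rfloor>"
  define b where "b = block_length n"
  have h: "0 \<le> h" "real N * h \<le> T" using grid_le(1)[OF t n] t by (auto simp: h_def N_def)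
  have b: "0 < b"
  proof -
    have "0 < sqrt (real n)" using n by simp
    then show ?thesis unfolding b_def block_length_def by linarith
  qed
  have BE: "0 \<le> block_error j l h N b \<omega>" unfolding block_error_def by (intro sum_nonneg) auto
  have "\<bar>\<Sum>k<N. a (real k * h) * fluctuation j l h k \<omega>\<bar>
      \<le> 2 * (K * K) * (real b * h) powr \<alpha> * (\<Sum>k<N. \<bar>fluctuation j l h k \<omega>\<bar>) + K * K * block_error j l h N b \<omega>"
    by (rule weighted_fluctuations[OF a]) (use \<alpha> h b in auto)
  also have "K * K * block_error j l h N b \<omega> \<le> 2 * (K * K) * block_error j l h N b \<omega>"
    using BE by (intro mult_right_mono) auto
  finally have "\<bar>\<Sum>k<N. a (real k * h) * fluctuation j l h k \<omega>\<bar>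
      \<le> 2 * (K * K) * ((real b * h) powr \<alpha> * (\<Sum>k<N. \<bar>fluctuation j l h k \<omega>\<bar>) + block_error j l h N b \<omega>)"
    by (simp add: algebra_simps)
  then have "real n powr (2 * H - 1) * \<bar>\<Sum>k<N. a (real k * h) * fluctuation j l h k \<omega>\<bar>
      \<le> real n powr (2 * H - 1) * (2 * (K * K) * ((real b * h) powr \<alpha> *
          (\<Sum>k<N. \<bar>fluctuation j l h k \<omega>\<bar>) + block_error j l h N b \<omega>))"
    by (intro mult_left_mono) auto
  then show ?thesis
    unfolding fluctuation_size_def h_def[symmetric] N_def[symmetric] b_def[symmetric]
    by (simp only: abs_mult abs_of_nonneg[OF powr_ge_zero] mult_ac)
qed

text \<open>The difference has three parts, treated in the steps \<open>E1\<close>, \<open>E2\<close> and \<open>E3\<close>: the error of freezing the integrands,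
  the weighted fluctuations, and the error of the Riemann sum that arises from the means \<open>h\<^bsup>2H\<^esup>\<close> of the squared increments.\<close>

lemma pathwise_rate:
  assumes \<alpha>: "0 < \<alpha>" "\<alpha> < 1" and \<gamma>: "\<gamma> < 1" "1 < \<alpha> + \<gamma>" and K: "0 \<le> K"
    and \<sigma>: "\<And>i j. holder_with T \<alpha> K (\<lambda>s. \<sigma> i j s \<omega>)" "\<And>i j u. u \<in> {0..T} \<Longrightarrow> \<bar>\<sigma> i j u \<omega>\<bar> \<le> K"
    and Bh: "\<And>j. holder_with T \<gamma> K (\<lambda>u. B j u \<omega>)" and t: "t \<in> {0..T}"
  shows "\<exists>C. \<forall>n>0. \<bar>real n powr (2 * H - 1) * cross_variation (young_process T \<alpha> x \<sigma> B) n t \<omega>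
      - integral {0..t} (\<lambda>s. \<sigma> 1 1 s \<omega> * \<sigma> 2 1 s \<omega> + \<sigma> 1 2 s \<omega> * \<sigma> 2 2 s \<omega>)\<bar>
    \<le> C * approximation_rate \<alpha> \<gamma> t n \<omega>"
proof -
  define c where "c = K * K / (2 powr (\<alpha> + \<gamma>) - 2)"
  have c: "0 \<le> c" using powr_less_mono[of 1 "\<alpha> + \<gamma>" 2] \<gamma> K by (simp add: c_def)
  \<comment> \<open>The bound \<open>2 m r + r\<^sup>2\<close> of the perturbed product, for \<open>m = 2 K\<^sup>2 h\<^bsup>\<gamma>\<^esup>\<close>, \<open>r = 2 c h\<^bsup>\<alpha>+\<gamma>\<^esup>\<close> and \<open>h \<le> 1\<close>, is at most \<open>D h\<^bsup>\<alpha>+2\<gamma>\<^esup>\<close>.\<close>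
  define D where "D = 8 * (K * K) * c + 4 * (c * c)"
  have D: "0 \<le> D" unfolding D_def using c K by (intro add_nonneg_nonneg mult_nonneg_nonneg) auto
  define S where "S s = \<sigma> 1 1 s \<omega> * \<sigma> 2 1 s \<omega> + \<sigma> 1 2 s \<omega> * \<sigma> 2 2 s \<omega>" for s
  define c2 where "c2 = 4 * (K * K) / (2 powr (\<alpha> + 1) - 2)"
  have c2: "0 \<le> c2" using powr_less_mono[of 1 "\<alpha> + 1" 2] \<alpha> K by (simp add: c2_def)
  have prod_h: "holder_with T \<alpha> (2 * (K * K)) (\<lambda>s. \<sigma> i j s \<omega> * \<sigma> i' j' s \<omega>)" for i j i' j'
    using holder_with_mult[OF \<sigma>(1)[of i j] \<sigma>(2)[of _ i j] \<sigma>(1)[of i' j'] \<sigma>(2)[of _ i' j'] K K] by simp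
  have prod_b: "\<bar>\<sigma> i j u \<omega> * \<sigma> i' j' u \<omega>\<bar> \<le> K * K" if "u \<in> {0..T}" for i j i' j' u
    unfolding abs_mult using \<sigma>(2)[OF that] K by (intro mult_mono) auto
  have S_h: "holder_with T \<alpha> (4 * (K * K)) S"
    using holder_with_lincomb[OF prod_h[of 1 1 2 1] prod_h[of 1 2 2 2], of 1 1] unfolding S_def by simp
  have S_b: "\<bar>S u\<bar> \<le> 2 * (K * K)" if "u \<in> {0..T}" for u
    using prod_b[OF that, of 1 1 2 1] prod_b[OF that, of 1 2 2 2] unfolding S_def by linarith
  define C where "C = t * D + 2 * (K * K) + (t + 1) * c2 + 2 * (K * K)"
  let ?X = "young_process T \<alpha> x \<sigma> B"
  have "\<bar>real n powr (2 * H - 1) * cross_variation ?X n t \<omega> - integral {0..t} S\<bar>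
      \<le> C * approximation_rate \<alpha> \<gamma> t n \<omega>" if n: "0 < n" for n
  proof -
    define h where "h = 1 / real n"
    define N where "N = nat \<lfloor>real n * t\<rfloor>"
    define w where "w = real n powr (2 * H - 1)"
    have h: "0 < h" "h \<le> 1" using n by (auto simp: h_def)
    have Nt: "real N * h \<le> t" "t \<le> real N * h + h" using grid_le[OF t n] by (simp_all add: h_def N_def)
    have node: "real k * h \<in> {0..T}" if "k \<le> N" for k
    proof -
      have "real k * h \<le> real N * h" using that h by (intro mult_right_mono) auto
      then have "real k * h \<le> T" using Nt t unfolding atLeastAtMost_iff by linarith
      moreover have "0 \<le> real k * h" using h by simp
      ultimately show ?thesis by simp
    qed
    have w: "0 \<le> w" "w * h powr (2 * H) = h" "w = h powr (1 - 2 * H)"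
    proof -
      show "0 \<le> w" unfolding w_def by simp
      show w3: "w = h powr (1 - 2 * H)"
        unfolding h_def w_def using n by (simp add: powr_divide powr_diff field_simps)
      show "w * h powr (2 * H) = h" unfolding w3 using h by (simp flip: powr_add)
    qed
    define d where "d i k = ?X i (real (Suc k) * h) \<omega> - ?X i (real k * h) \<omega>" for i k
    define m where "m i k = \<sigma> i 1 (real k * h) \<omega> * cell 1 h k \<omega> + \<sigma> i 2 (real k * h) \<omega> * cell 2 h k \<omega>" for i k
    have cell_b: "\<bar>cell j h k \<omega>\<bar> \<le> K * h powr \<gamma>" if "k < N" for j k
    proof -
      have "real (Suc k) * h - real k * h = h" by (simp add: algebra_simps)
      moreover have "real k * h \<le> real (Suc k) * h" using h by (intro mult_right_mono) auto
      ultimately show ?thesis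
        using holder_withD[OF Bh, of "real k * h" "real (Suc k) * h" j] node[of k] node[of "Suc k"] that
        unfolding comp.inc_def by (simp del: of_nat_Suc)
    qed
    have m_b: "\<bar>m i k\<bar> \<le> 2 * (K * K) * h powr \<gamma>" if "k < N" for i k
    proof -
      have "\<bar>\<sigma> i j (real k * h) \<omega> * cell j h k \<omega>\<bar> \<le> K * (K * h powr \<gamma>)" for j
        unfolding abs_mult using cell_b[OF that] \<sigma>(2)[OF node] that K by (intro mult_mono) auto
      from this[of 1] this[of 2] show ?thesis unfolding m_def by (simp add: mult.assoc)
    qed
    have d_m: "\<bar>d i k - m i k\<bar> \<le> 2 * c * h powr (\<alpha> + \<gamma>)" if "k < N" for i k
    proof -
      have k: "real k * h \<in> {0..T}" "real (Suc k) * h \<in> {0..T}"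
        using node[of k] node[of "Suc k"] that by auto
      have le: "real k * h \<le> real (Suc k) * h" using h by (intro mult_right_mono) auto
      have diff: "real (Suc k) * h - real k * h = h" by (simp add: algebra_simps)
      have "\<bar>young_integral T \<alpha> (\<lambda>s. \<sigma> i j s \<omega>) (\<lambda>s. B j s \<omega>) (real (Suc k) * h)
          - young_integral T \<alpha> (\<lambda>s. \<sigma> i j s \<omega>) (\<lambda>s. B j s \<omega>) (real k * h)
          - \<sigma> i j (real k * h) \<omega> * cell j h k \<omega>\<bar> \<le> c * h powr (\<alpha> + \<gamma>)" for j
        using young_integral_increment[OF \<sigma>(1)[of i j] K Bh[of j] K \<alpha> \<gamma>(2,1) _ le] k
        unfolding c_def comp.inc_def diff by (simp del: of_nat_Suc)
      from this[of 1] this[of 2] show ?thesis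
        unfolding d_def m_def young_process_def by (simp del: of_nat_Suc)
    qed
    have CV: "cross_variation ?X n t \<omega> = (\<Sum>k<N. d 1 k * d 2 k)"
    proof -
      have "cross_variation ?X n t \<omega> = (\<Sum>k = Suc 0..<Suc N.
          (?X 1 (real k / real n) \<omega> - ?X 1 (real (k - 1) / real n) \<omega>) *
          (?X 2 (real k / real n) \<omega> - ?X 2 (real (k - 1) / real n) \<omega>))"
        unfolding cross_variation_def N_def by (intro sum.cong) auto
      also have "\<dots> = (\<Sum>k = 0..<N. d 1 k * d 2 k)"
        unfolding sum.shift_bounds_Suc_ivl d_def h_def by (intro sum.cong) auto
      finally show ?thesis by (simp add: atLeast0LessThan)
    qed
    have E1: "\<bar>w * (\<Sum>k<N. d 1 k * d 2 k - m 1 k * m 2 k)\<bar> \<le> t * D * h powr (\<alpha> + 2 * \<gamma> - 2 * H)"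
    proof -
      have one: "\<bar>d 1 k * d 2 k - m 1 k * m 2 k\<bar> \<le> D * h powr (\<alpha> + 2 * \<gamma>)" if "k < N" for k
      proof -
        have "\<bar>d 1 k * d 2 k - m 1 k * m 2 k\<bar> \<le> 2 * (2 * (K * K) * h powr \<gamma>) * (2 * c * h powr (\<alpha> + \<gamma>))
            + (2 * c * h powr (\<alpha> + \<gamma>)) * (2 * c * h powr (\<alpha> + \<gamma>))"
          by (rule product_perturbation[OF d_m[OF that] d_m[OF that] m_b[OF that] m_b[OF that]])
        also have "\<dots> = 8 * (K * K) * c * h powr (\<alpha> + 2 * \<gamma>) + 4 * (c * c) * (h powr \<alpha> * h powr (\<alpha> + 2 * \<gamma>))"
        proof -
          have e: "h powr (\<alpha> + 2 * \<gamma>) = h powr \<gamma> * h powr (\<alpha> + \<gamma>)"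
            "h powr \<alpha> * h powr (\<alpha> + 2 * \<gamma>) = h powr (\<alpha> + \<gamma>) * h powr (\<alpha> + \<gamma>)"
            unfolding powr_add[symmetric] by (rule arg_cong[of _ _ "(powr) h"], simp)+
          show ?thesis unfolding e(2) unfolding e(1) by algebra
        qed
        also have "\<dots> \<le> 8 * (K * K) * c * h powr (\<alpha> + 2 * \<gamma>) + 4 * (c * c) * (1 * h powr (\<alpha> + 2 * \<gamma>))"
        proof -
          have "h powr \<alpha> * h powr (\<alpha> + 2 * \<gamma>) \<le> 1 * h powr (\<alpha> + 2 * \<gamma>)"
            using h \<alpha> powr_le1[of \<alpha> h] by (intro mult_right_mono) simp_all
          then show ?thesis
            using c by (intro add_left_mono mult_left_mono[of "h powr \<alpha> * h powr (\<alpha> + 2 * \<gamma>)"]) simp_all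
        qed
        finally show ?thesis by (simp add: D_def algebra_simps)
      qed
      have "\<bar>\<Sum>k<N. d 1 k * d 2 k - m 1 k * m 2 k\<bar> \<le> (\<Sum>k<N. \<bar>d 1 k * d 2 k - m 1 k * m 2 k\<bar>)" by (rule sum_abs)
      also have "\<dots> \<le> (\<Sum>k<N. D * h powr (\<alpha> + 2 * \<gamma>))" by (intro sum_mono one) auto
      also have "\<dots> = (real N * h) * (D * h powr (\<alpha> + 2 * \<gamma> - 1))"
        using h by (simp add: powr_diff)
      also have "\<dots> \<le> t * (D * h powr (\<alpha> + 2 * \<gamma> - 1))"
        using Nt D by (intro mult_right_mono) auto
      finally have "w * \<bar>\<Sum>k<N. d 1 k * d 2 k - m 1 k * m 2 k\<bar> \<le> w * (t * (D * h powr (\<alpha> + 2 * \<gamma> - 1)))"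
        using w(1) by (rule mult_left_mono)
      also have "\<dots> = t * D * (h powr (1 - 2 * H) * h powr (\<alpha> + 2 * \<gamma> - 1))" unfolding w(3) by simp
      also have "h powr (1 - 2 * H) * h powr (\<alpha> + 2 * \<gamma> - 1) = h powr (\<alpha> + 2 * \<gamma> - 2 * H)"
        by (simp flip: powr_add)
      finally show ?thesis using w(1) by (simp add: abs_mult)
    qed
    define W where "W j l = w * (\<Sum>k<N. (\<sigma> 1 j (real k * h) \<omega> * \<sigma> 2 l (real k * h) \<omega>) * fluctuation j l h k \<omega>)" for j l
    have W_b: "\<bar>W j l\<bar> \<le> 2 * (K * K) * fluctuation_size \<alpha> t n j l \<omega>" for j l
      unfolding W_def w_def h_def N_def
      by (rule scaled_fluctuations[OF prod_h prod_b \<alpha>(1) t n])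
    have E2: "w * (\<Sum>k<N. m 1 k * m 2 k - h powr (2 * H) * S (real k * h)) = (\<Sum>j\<in>UNIV. \<Sum>l\<in>UNIV. W j l)"
    proof -
      have ne: "(1::2) \<noteq> 2" "(2::2) \<noteq> 1" by simp_all
      have "m 1 k * m 2 k - h powr (2 * H) * S (real k * h)
        = (\<Sum>j\<in>UNIV. \<Sum>l\<in>UNIV. (\<sigma> 1 j (real k * h) \<omega> * \<sigma> 2 l (real k * h) \<omega>) * fluctuation j l h k \<omega>)" for k
        unfolding m_def S_def fluctuation_def UNIV_2 by (simp add: ne algebra_simps del: of_nat_Suc)
      then show ?thesis unfolding W_def UNIV_2 by (simp add: sum.distrib algebra_simps)
    qed
    have E3: "\<bar>(\<Sum>k<N. h * S (real k * h)) - integral {0..t} S\<bar> \<le> (t + 1) * c2 * h powr \<alpha> + 2 * (K * K) * h"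
      unfolding c2_def by (rule left_riemann_sum_error[OF S_h S_b]) (use K \<alpha> h Nt t in auto)
    have "w * (\<Sum>k<N. d 1 k * d 2 k) - integral {0..t} S
        = w * (\<Sum>k<N. d 1 k * d 2 k - m 1 k * m 2 k) + w * (\<Sum>k<N. m 1 k * m 2 k - h powr (2 * H) * S (real k * h))
          + ((\<Sum>k<N. h * S (real k * h)) - integral {0..t} S)"
    proof -
      have "(\<Sum>k<N. h * S (real k * h)) = w * (\<Sum>k<N. h powr (2 * H) * S (real k * h))"
        unfolding sum_distrib_left by (simp add: w(2) flip: mult.assoc)
      then show ?thesis by (simp add: sum_subtractf right_diff_distrib)
    qed
    then have "\<bar>w * (\<Sum>k<N. d 1 k * d 2 k) - integral {0..t} S\<bar>
        \<le> t * D * h powr (\<alpha> + 2 * \<gamma> - 2 * H) + \<bar>\<Sum>j\<in>UNIV. \<Sum>l\<in>UNIV. W j l\<bar>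
          + ((t + 1) * c2 * h powr \<alpha> + 2 * (K * K) * h)"
      using E1 E3 unfolding E2 by linarith
    also have "\<bar>\<Sum>j\<in>UNIV. \<Sum>l\<in>UNIV. W j l\<bar> \<le> (\<Sum>j\<in>UNIV. \<Sum>l\<in>UNIV. 2 * (K * K) * fluctuation_size \<alpha> t n j l \<omega>)"
      by (intro order_trans[OF sum_abs] sum_mono W_b)
    also have "\<dots> = 2 * (K * K) * (\<Sum>j\<in>UNIV. \<Sum>l\<in>UNIV. fluctuation_size \<alpha> t n j l \<omega>)"
      by (simp only: sum_distrib_left)
    finally have total: "\<bar>w * (\<Sum>k<N. d 1 k * d 2 k) - integral {0..t} S\<bar>
        \<le> t * D * h powr (\<alpha> + 2 * \<gamma> - 2 * H) + 2 * (K * K) * (\<Sum>j\<in>UNIV. \<Sum>l\<in>UNIV. fluctuation_size \<alpha> t n j l \<omega>)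
          + ((t + 1) * c2 * h powr \<alpha> + 2 * (K * K) * h)" by simp
    have parts: "0 \<le> t * D" "0 \<le> 2 * (K * K)" "0 \<le> (t + 1) * c2" using t D K c2 by auto
    have F: "0 \<le> (\<Sum>j\<in>UNIV. \<Sum>l\<in>UNIV. fluctuation_size \<alpha> t n j l \<omega>)"
      by (intro sum_nonneg fluctuation_size_nonneg)
    have "t * D * a1 + 2 * (K * K) * a2 + ((t + 1) * c2 * a3 + 2 * (K * K) * a4) \<le> C * (a2 + a1 + a3 + a4)"
      if "0 \<le> a1" "0 \<le> a2" "0 \<le> a3" "0 \<le> a4" for a1 a2 a3 a4 :: real
    proof -
      have "t * D \<le> C" "2 * (K * K) \<le> C" "(t + 1) * c2 \<le> C" using parts unfolding C_def by linarith+
      then have "t * D * a1 \<le> C * a1" "2 * (K * K) * a2 \<le> C * a2" "(t + 1) * c2 * a3 \<le> C * a3"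
        "2 * (K * K) * a4 \<le> C * a4"
        using that by (auto intro!: mult_right_mono)
      then show ?thesis by (simp add: distrib_left)
    qed
    from this[OF _ F, of "h powr (\<alpha> + 2 * \<gamma> - 2 * H)" "h powr \<alpha>" h] total h
    show ?thesis unfolding CV approximation_rate_def w_def[symmetric] h_def[symmetric] by simp
  qed
  then show ?thesis unfolding S_def by blast
qed

lemma approximation_rate_tendsto:
  assumes t: "t \<in> {0..T}" and \<alpha>: "0 < \<alpha>" and \<gamma>: "2 * H < \<alpha> + 2 * \<gamma>"
  shows "integrable M (approximation_rate \<alpha> \<gamma> t n)"
    and "(\<lambda>n. expectation (\<lambda>\<omega>. \<bar>approximation_rate \<alpha> \<gamma> t n \<omega>\<bar>)) \<longlonglongrightarrow> 0"
proof -
  have int: "integrable M (fluctuation_size \<alpha> t n j l)" for n j l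
  proof (cases "n = 0")
    case True
    then show ?thesis unfolding fluctuation_size_def[abs_def] by simp
  qed (use fluctuation_size_expectation(1)[OF t _ \<alpha>] in auto)
  show "integrable M (approximation_rate \<alpha> \<gamma> t n)" for n
    unfolding approximation_rate_def[abs_def]
    by (intro Bochner_Integration.integrable_add Bochner_Integration.integrable_sum int integrable_const)
  have "expectation (\<lambda>\<omega>. \<bar>approximation_rate \<alpha> \<gamma> t n \<omega>\<bar>)
      = (\<Sum>j\<in>UNIV. \<Sum>l\<in>UNIV. expectation (fluctuation_size \<alpha> t n j l))
       + (1 / real n) powr (\<alpha> + 2 * \<gamma> - 2 * H) + (1 / real n) powr \<alpha> + 1 / real n" for n
  proof -
    have "\<bar>approximation_rate \<alpha> \<gamma> t n \<omega>\<bar> = approximation_rate \<alpha> \<gamma> t n \<omega>" for \<omega>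
      unfolding approximation_rate_def
      by (intro abs_of_nonneg add_nonneg_nonneg sum_nonneg fluctuation_size_nonneg) auto
    then show ?thesis
      unfolding approximation_rate_def UNIV_2 using int by (simp add: prob_space)
  qed
  moreover have "(\<lambda>n. (\<Sum>j\<in>UNIV. \<Sum>l\<in>UNIV. expectation (fluctuation_size \<alpha> t n j l))
       + (1 / real n) powr (\<alpha> + 2 * \<gamma> - 2 * H) + (1 / real n) powr \<alpha> + 1 / real n) \<longlonglongrightarrow> 0"
    using \<gamma> \<alpha> by (intro tendsto_add_zero tendsto_null_sum fluctuation_size_tendsto[OF t \<alpha>]
        tendsto_powr_zero lim_1_over_n) auto
  ultimately show "(\<lambda>n. expectation (\<lambda>\<omega>. \<bar>approximation_rate \<alpha> \<gamma> t n \<omega>\<bar>)) \<longlonglongrightarrow> 0" by simp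
qed

end

section \<open>Measurability and convergence\<close>

lemma completed_generated_by_complete:
  assumes "completed_generated_by M T B"
  shows "complete_measure M"
proof -
  have "M = completion (restr_to_subalg M (generated_sigma_field M T B))"
    using assms unfolding completed_generated_by_def by blast
  then show ?thesis using completion.complete_measure_axioms by metis
qed

lemma (in complete_measure) riemann_limit_measurable:
  fixes f g :: "real \<Rightarrow> 'a \<Rightarrow> real"
  assumes f: "\<And>s. s \<in> {0..T} \<Longrightarrow> f s \<in> borel_measurable M"
    and g: "\<And>s. s \<in> {0..T} \<Longrightarrow> g s \<in> borel_measurable M" and u: "u \<in> {0..T}"
    and lim: "AE \<omega> in M. (\<lambda>n. \<Sum>k<n. f (u * real k / real n) \<omega> *
      (g (u * real (Suc k) / real n) \<omega> - g (u * real k / real n) \<omega>)) \<longlonglongrightarrow> L \<omega>"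
  shows "L \<in> borel_measurable M"
proof (rule borel_measurable_AE_limit[OF _ lim])
  fix n
  have node: "u * real k / real n \<in> {0..T}" if "k \<le> n" "0 < n" for k
  proof -
    have "u * real k \<le> u * real n" using that u by (intro mult_left_mono) auto
    then have "u * real k / real n \<le> u" using that by (simp add: divide_le_eq)
    then show ?thesis using u by auto
  qed
  show "(\<lambda>\<omega>. \<Sum>k<n. f (u * real k / real n) \<omega> *
      (g (u * real (Suc k) / real n) \<omega> - g (u * real k / real n) \<omega>)) \<in> borel_measurable M"
  proof (rule borel_measurable_sum)
    fix k assume "k \<in> {..<n}"
    then have k: "k \<le> n" "Suc k \<le> n" "0 < n" by auto
    show "(\<lambda>\<omega>. f (u * real k / real n) \<omega> *
      (g (u * real (Suc k) / real n) \<omega> - g (u * real k / real n) \<omega>)) \<in> borel_measurable M"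
      by (rule borel_measurable_times[OF f[OF node[OF k(1,3)]]
            borel_measurable_diff[OF g[OF node[OF k(2,3)]] g[OF node[OF k(1,3)]]]])
  qed
qed

lemma holder_norm_finite_AE:
  assumes "has_moments_of_all_orders M (\<lambda>\<omega>. holder_norm T \<alpha> (\<lambda>s. f s \<omega>))"
  shows "AE \<omega> in M. \<exists>K\<ge>0. holder_with T \<alpha> K (\<lambda>s. f s \<omega>) \<and> (\<forall>u\<in>{0..T}. \<bar>f u \<omega>\<bar> \<le> K)"
proof -
  have "(\<integral>\<^sup>+ \<omega>. holder_norm T \<alpha> (\<lambda>s. f s \<omega>) ^ 1 \<partial>M) < \<infinity>"
    using assms unfolding has_moments_of_all_orders_def by blast
  then have "AE \<omega> in M. holder_norm T \<alpha> (\<lambda>s. f s \<omega>) \<noteq> \<infinity>"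
    using assms unfolding has_moments_of_all_orders_def
    by (intro nn_integral_PInf_AE) auto
  then show ?thesis
  proof eventually_elim
    case (elim \<omega>)
    let ?n = "holder_norm T \<alpha> (\<lambda>s. f s \<omega>)"
    define K where "K = enn2real ?n"
    have K: "0 \<le> K" "ennreal K = ?n" using elim unfolding K_def by (auto simp: less_top)
    have "holder_seminorm T \<alpha> (\<lambda>s. f s \<omega>) \<le> ennreal K"
      unfolding K(2) holder_norm_def by simp
    then have "holder_with T \<alpha> K (\<lambda>s. f s \<omega>)" by (rule holder_seminorm_imp_holder_with[OF _ K(1)])
    moreover have "\<bar>f u \<omega>\<bar> \<le> K" if "u \<in> {0..T}" for u
      using abs_le_holder_norm[OF that, of "\<lambda>s. f s \<omega>" \<alpha>] K by (metis ennreal_le_iff)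
    ultimately show ?case using K(1) by blast
  qed
qed

theorem theorem1p1:
  fixes M :: "'a measure" and T H \<alpha> t :: real
    and B :: "2 \<Rightarrow> real \<Rightarrow> 'a \<Rightarrow> real"
    and \<sigma> :: "2 \<Rightarrow> 2 \<Rightarrow> real \<Rightarrow> 'a \<Rightarrow> real"
    and x :: "real ^ 2"
  assumes "prob_space M"
    and "T > 0"
    and "1 / 2 < H" and "H < 1"
    and "fractional_brownian_motion_2d M T H B"
    and "completed_generated_by M T B"
    and "\<And>i j s. s \<in> {0..T} \<Longrightarrow> \<sigma> i j s \<in> borel_measurable M"
    and "1 / 4 + H / 2 < \<alpha>" and "\<alpha> < H"
    and "\<And>i j. has_moments_of_all_orders M (\<lambda>\<omega>. holder_norm T \<alpha> (\<lambda>s. \<sigma> i j s \<omega>))"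
    and "t \<in> {0..T}"
  shows "converges_in_probability M
           (\<lambda>n \<omega>. real n powr (2 * H - 1) * cross_variation (young_process T \<alpha> x \<sigma> B) n t \<omega>)
           (\<lambda>\<omega>. integral {0..t} (\<lambda>s. \<sigma> 1 1 s \<omega> * \<sigma> 2 1 s \<omega> + \<sigma> 1 2 s \<omega> * \<sigma> 2 2 s \<omega>))"
proof -
  interpret fbm_plane M T H B
    using assms(1-5) by (simp add: fbm_plane_def fbm_plane_axioms_def)
  interpret complete_measure M by (rule completed_generated_by_complete[OF assms(6)])
  note \<sigma>_meas = assms(7) and t = assms(11)
  have \<alpha>: "0 < \<alpha>" "\<alpha> < 1" using assms(3,4,8,9) by auto
  \<comment> \<open>The path regularity must satisfy \<open>\<alpha> + \<gamma> > 1\<close> for Young integration and \<open>\<alpha> + 2 \<gamma> > 2 H\<close> for the error of freezing.\<close>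
  define \<gamma> where "\<gamma> = (max (1 - \<alpha>) (H - \<alpha> / 2) + H) / 2"
  have "1 - \<alpha> < H" "H - \<alpha> / 2 < H" using assms(3,8) \<alpha> by auto
  then have "1 - \<alpha> < \<gamma>" "H - \<alpha> / 2 < \<gamma>" "\<gamma> < H" unfolding \<gamma>_def by (auto simp: max_def)
  then have \<gamma>: "0 < \<gamma>" "\<gamma> < 1" "1 < \<alpha> + \<gamma>" "\<gamma> < H" "2 * H < \<alpha> + 2 * \<gamma>" using \<alpha> assms(4) by auto
  define good where "good \<omega> K \<longleftrightarrow> 0 \<le> K \<and> (\<forall>i j. holder_with T \<alpha> K (\<lambda>s. \<sigma> i j s \<omega>)) \<and>
    (\<forall>i j. \<forall>u\<in>{0..T}. \<bar>\<sigma> i j u \<omega>\<bar> \<le> K) \<and> (\<forall>j. holder_with T \<gamma> K (\<lambda>u. B j u \<omega>))" for \<omega> K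
  have "AE \<omega> in M. \<forall>i j. \<exists>K\<ge>0. holder_with T \<alpha> K (\<lambda>s. \<sigma> i j s \<omega>) \<and> (\<forall>u\<in>{0..T}. \<bar>\<sigma> i j u \<omega>\<bar> \<le> K)"
    unfolding AE_all_countable using holder_norm_finite_AE[OF assms(10)] by blast
  moreover have "AE \<omega> in M. \<forall>j. \<exists>K\<ge>0. holder_with T \<gamma> K (\<lambda>u. B j u \<omega>)"
    unfolding AE_all_countable using comp.holder_paths[OF \<gamma>(1,4)] by blast
  ultimately have good_AE: "AE \<omega> in M. \<exists>K. good \<omega> K"
  proof eventually_elim
    case (elim \<omega>)
    obtain f where f: "\<And>i j. 0 \<le> f i j" "\<And>i j. holder_with T \<alpha> (f i j) (\<lambda>s. \<sigma> i j s \<omega>)"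
      "\<And>i j u. u \<in> {0..T} \<Longrightarrow> \<bar>\<sigma> i j u \<omega>\<bar> \<le> f i j" using elim(1) by metis
    obtain g where g: "\<And>j. 0 \<le> g j" "\<And>j. holder_with T \<gamma> (g j) (\<lambda>u. B j u \<omega>)" using elim(2) by metis
    define K where "K = (\<Sum>i\<in>UNIV. \<Sum>j\<in>UNIV. f i j) + (\<Sum>j\<in>UNIV. g j)"
    have nn: "0 \<le> (\<Sum>i\<in>UNIV. \<Sum>j\<in>UNIV. f i j)" "0 \<le> (\<Sum>j\<in>UNIV. g j)"
      using f g by (auto intro!: sum_nonneg)
    have fK: "f i j \<le> K" for i j
    proof -
      have "f i j \<le> (\<Sum>j\<in>UNIV. f i j)" using f by (intro member_le_sum) auto
      also have "\<dots> \<le> (\<Sum>i\<in>UNIV. \<Sum>j\<in>UNIV. f i j)"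
        using f by (intro member_le_sum[of i UNIV "\<lambda>i. \<Sum>j\<in>UNIV. f i j"]) (auto intro!: sum_nonneg)
      finally show ?thesis unfolding K_def using nn by linarith
    qed
    have gK: "g j \<le> K" for j
      using member_le_sum[of j UNIV g] g nn unfolding K_def by fastforce
    have "good \<omega> K"
      unfolding good_def
      using nn holder_with_mono[OF f(2) fK] holder_with_mono[OF g(2) gK] order_trans[OF f(3) fK]
      by (simp add: K_def)
    then show ?case by blast
  qed
  have young_meas: "(\<lambda>\<omega>. young_integral T \<alpha> (\<lambda>s. \<sigma> i j s \<omega>) (\<lambda>s. B j s \<omega>) u) \<in> borel_measurable M"
    if u: "u \<in> {0..T}" for i j u
  proof (rule riemann_limit_measurable[OF \<sigma>_meas[of _ i j] comp.measurable_B u])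
    show "AE \<omega> in M. (\<lambda>n. \<Sum>k<n. \<sigma> i j (u * real k / real n) \<omega> *
        (B j (u * real (Suc k) / real n) \<omega> - B j (u * real k / real n) \<omega>))
        \<longlonglongrightarrow> young_integral T \<alpha> (\<lambda>s. \<sigma> i j s \<omega>) (\<lambda>s. B j s \<omega>) u"
      using good_AE
    proof eventually_elim
      case (elim \<omega>)
      then obtain K where K: "0 \<le> K" "holder_with T \<alpha> K (\<lambda>s. \<sigma> i j s \<omega>)" "holder_with T \<gamma> K (\<lambda>u. B j u \<omega>)"
        unfolding good_def by blast
      let ?J = "young_integral T \<alpha> (\<lambda>s. \<sigma> i j s \<omega>) (\<lambda>s. B j s \<omega>)"
      have "(\<lambda>n. \<Sum>k<n. \<sigma> i j (u * real k / real n) \<omega> *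
        (B j (u * real (Suc k) / real n) \<omega> - B j (u * real k / real n) \<omega>)) \<longlonglongrightarrow> ?J u - ?J 0"
        using young_integral_increment[OF K(2,1) K(3,1) \<alpha> \<gamma>(3,2)] u \<gamma>(3)
        by (intro riemann_sum_tendsto[where K = "K * K / (2 powr (\<alpha> + \<gamma>) - 2)" and \<theta> = "\<alpha> + \<gamma>"]) auto
      then show ?case using young_integral_0[OF K(2,1) K(3,1) \<alpha> \<gamma>(3,2)] T_pos by simp
    qed
  qed auto
  have X_meas: "young_process T \<alpha> x \<sigma> B i u \<in> borel_measurable M" if "u \<in> {0..T}" for i u
    unfolding young_process_def[abs_def]
    by (intro borel_measurable_add borel_measurable_const young_meas that)
  have Y_meas: "(\<lambda>\<omega>. real n powr (2 * H - 1) * cross_variation (young_process T \<alpha> x \<sigma> B) n t \<omega>)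
      \<in> borel_measurable M" for n
  proof -
    have node: "real k / real n \<in> {0..T}" if "k \<le> nat \<lfloor>real n * t\<rfloor>" for k
    proof (cases "n = 0")
      case False
      have "0 \<le> real n * t" using t by auto
      then have "real k \<le> real n * t" using that by linarith
      then have "real k / real n \<le> t" using False by (simp add: divide_le_eq mult.commute)
      then show ?thesis using t by auto
    qed (use T_pos in auto)
    show ?thesis unfolding cross_variation_def[abs_def]
      by (intro borel_measurable_times borel_measurable_const borel_measurable_sum
          borel_measurable_diff X_meas node) auto
  qed
  let ?S = "\<lambda>\<omega> s. \<sigma> 1 1 s \<omega> * \<sigma> 2 1 s \<omega> + \<sigma> 1 2 s \<omega> * \<sigma> 2 2 s \<omega>"
  have Z_meas: "(\<lambda>\<omega>. integral {0..t} (?S \<omega>)) \<in> borel_measurable M"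
  proof (rule riemann_limit_measurable[where f = "\<lambda>s \<omega>. ?S \<omega> s" and g = "\<lambda>s \<omega>. s", OF _ _ t])
    show "(\<lambda>\<omega>. ?S \<omega> s) \<in> borel_measurable M" if "s \<in> {0..T}" for s
      by (intro borel_measurable_add borel_measurable_times \<sigma>_meas that)
    show "AE \<omega> in M. (\<lambda>n. \<Sum>k<n. ?S \<omega> (t * real k / real n) * (t * real (Suc k) / real n - t * real k / real n))
        \<longlonglongrightarrow> integral {0..t} (?S \<omega>)"
      using good_AE
    proof eventually_elim
      case (elim \<omega>)
      then obtain K where K: "0 \<le> K" "\<And>i j. holder_with T \<alpha> K (\<lambda>s. \<sigma> i j s \<omega>)"
        "\<And>i j u. u \<in> {0..T} \<Longrightarrow> \<bar>\<sigma> i j u \<omega>\<bar> \<le> K" unfolding good_def by blast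
      have prod: "holder_with T \<alpha> (K * K + K * K) (\<lambda>s. \<sigma> i j s \<omega> * \<sigma> i' j' s \<omega>)" for i j i' j'
        by (rule holder_with_mult[OF K(2) K(3) K(2) K(3) K(1) K(1)])
      have S: "holder_with T \<alpha> (4 * (K * K)) (?S \<omega>)"
        using holder_with_lincomb[OF prod[of 1 1 2 1] prod[of 1 2 2 2], of 1 1] by simp
      have "(\<lambda>n. \<Sum>k<n. ?S \<omega> (t * real k / real n) * (t * real (Suc k) / real n - t * real k / real n))
        \<longlonglongrightarrow> integral {0..t} (?S \<omega>) - integral {0..0} (?S \<omega>)"
        using integral_increment_estimate[OF S _ \<alpha>(1)] t \<alpha>(1) K(1)
        by (intro riemann_sum_tendsto[where K = "4 * (K * K) / (2 powr (\<alpha> + 1) - 2)" and \<theta> = "\<alpha> + 1"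
              and J = "\<lambda>u. integral {0..u} (?S \<omega>)"]) auto
      then show ?case by simp
    qed
  qed simp
  show ?thesis
  proof (rule converges_in_probability_if_dominated[OF Y_meas Z_meas])
    show "integrable M (approximation_rate \<alpha> \<gamma> t n)" for n
      by (rule approximation_rate_tendsto(1)[OF t \<alpha>(1) \<gamma>(5)])
    show "(\<lambda>n. expectation (\<lambda>\<omega>. \<bar>approximation_rate \<alpha> \<gamma> t n \<omega>\<bar>)) \<longlonglongrightarrow> 0"
      by (rule approximation_rate_tendsto(2)[OF t \<alpha>(1) \<gamma>(5)])
    show "AE \<omega> in M. \<exists>C. \<forall>n>0. \<bar>real n powr (2 * H - 1) * cross_variation (young_process T \<alpha> x \<sigma> B) n t \<omega>
        - integral {0..t} (?S \<omega>)\<bar> \<le> C * approximation_rate \<alpha> \<gamma> t n \<omega>"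
      using good_AE
    proof eventually_elim
      case (elim \<omega>)
      then obtain K where K: "0 \<le> K" "\<And>i j. holder_with T \<alpha> K (\<lambda>s. \<sigma> i j s \<omega>)"
        "\<And>i j u. u \<in> {0..T} \<Longrightarrow> \<bar>\<sigma> i j u \<omega>\<bar> \<le> K" "\<And>j. holder_with T \<gamma> K (\<lambda>u. B j u \<omega>)"
        unfolding good_def by blast
      show ?case by (rule pathwise_rate[where \<sigma> = \<sigma> and \<omega> = \<omega>, OF \<alpha> \<gamma>(2,3) K t])
    qed
  qed
qed

end
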